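(* Let $K\ge2$ and let $\{\mathbf{X}_i^j:1\le j\le K,\ 1\le i\le n_j\}$ be independent random vectors in $\mathbb{R}^d$ with $\mathbf{X}_1^j,\ldots,\mathbf{X}_{n_j}^j\sim\mu_j$, and $n=\sum_{j=1}^Kn_j$. For each $n$ let $\mathcal{H}_n^d\subset[0,1]^d$ be a fixed set of $n$ points. Consider testing $\mathrm{H}_0:\mu_1=\mu_2=\cdots=\mu_K$ against $\mathrm{H}_1$: not $\mathrm{H}_0$. If the $\mu_j$'s are Lebesgue absolutely continuous, then under $\mathrm{H}_0$, $\mathrm{RE}_{1:K,n}^2$ is a distribution-free statistic (its law does not depend on the common distribution). If, additionally, $n_j/n\to\lambda_j\in(0,1)$ for each $j$, with $\sum_{j=1}^K\lambda_j=1$, and the empirical distribution on $\mathcal{H}_n^d$ converges weakly to $\mathcal{U}^d$, then the test which rejects $\mathrm{H}_0$ when $n\,\mathrm{RE}_{1:K,n}^2\ge c_n$ is consistent: for all fixed absolutely continuous $\mu_1,\ldots,\mu_K$ satisfying $\mathrm{H}_1$, $\mathbb{P}(n\,\mathrm{RE}_{1:K,n}^2\ge c_n)\to1$ as $n\to\infty$.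
   Context: $\mathcal{U}^d$: uniform distribution on $[0,1]^d$. $S_n$: permutations of $\{1,\ldots,n\}$. Pooled empirical rank map: write the pooled sample (all $\mathbf{X}_i^j$) as $\mathbf{W}_1,\ldots,\mathbf{W}_n$ and $\mathcal{H}_n^d=\{\mathbf{h}_1,\ldots,\mathbf{h}_n\}$; let $\hat\sigma\in\arg\min_{\sigma\in S_n}\sum_i\|\mathbf{W}_i-\mathbf{h}_{\sigma(i)}\|^2$ (almost surely unique) and $\hat R_n(\mathbf{W}_i):=\mathbf{h}_{\hat\sigma(i)}$. Test statistic: $\mathrm{RE}_{1:K,n}^2:=\sum_{j=1}^{K-1}\mathrm{RE}_{j:(j+1),n}^2$, where $$\mathrm{RE}_{j:(j+1),n}^2=\frac2{n_jn_{j+1}}\sum_{m=1}^{n_j}\sum_{l=1}^{n_{j+1}}\|\hat R_n(\mathbf{X}_m^j)-\hat R_n(\mathbf{X}_l^{j+1})\|-\frac1{n_j^2}\sum_{m,l=1}^{n_j}\|\hat R_n(\mathbf{X}_m^j)-\hat R_n(\mathbf{X}_l^j)\|-\frac1{n_{j+1}^2}\sum_{m,l=1}^{n_{j+1}}\|\hat R_n(\mathbf{X}_m^{j+1})-\hat R_n(\mathbf{X}_l^{j+1})\|.$$ Critical value: for a prespecified level $\alpha\in(0,1)$, $c_n:=\inf\{c:\mathbb{P}_{\mathrm{H}_0}(n\,\mathrm{RE}_{1:K,n}^2\ge c)\le\alpha\}$, with $\mathbb{P}_{\mathrm{H}_0}$ the law under $\mathrm{H}_0$ (absolutely continuous common law,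 same sample sizes). *)

theory Defs
  imports "HOL-Probability.Probability" "HOL-Combinatorics.Permutations"
begin

section \<open>Samples, hypotheses, weak convergence\<close>

definition k_sample ::
  "'a measure \<Rightarrow> nat \<Rightarrow> (nat \<Rightarrow> nat) \<Rightarrow> (nat \<Rightarrow> nat \<Rightarrow> 'a \<Rightarrow> real^'d) \<Rightarrow> (nat \<Rightarrow> (real^'d) measure) \<Rightarrow> bool"
where
  "k_sample M K ns X \<mu> \<longleftrightarrow>
     prob_space M \<and>
     prob_space.indep_vars M (\<lambda>_. borel) (\<lambda>(j, i). X j i) (SIGMA j:{1..K}. {1..ns j}) \<and>
     (\<forall>j\<in>{1..K}. \<forall>i\<in>{1..ns j}. distr M borel (X j i) = \<mu> j)"

definition abs_cont_law :: "(real^'d) measure \<Rightarrow> bool" where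
  "abs_cont_law \<mu> \<longleftrightarrow> prob_space \<mu> \<and> sets \<mu> = sets borel \<and> absolutely_continuous lborel \<mu>"

definition null_hypothesis :: "nat \<Rightarrow> (nat \<Rightarrow> (real^'d) measure) \<Rightarrow> bool" where
  "null_hypothesis K \<mu> \<longleftrightarrow> (\<forall>i\<in>{1..K}. \<forall>j\<in>{1..K}. \<mu> i = \<mu> j)"

definition weakly_converges :: "(nat \<Rightarrow> (real^'d) measure) \<Rightarrow> (real^'d) measure \<Rightarrow> bool" where
  "weakly_converges P Q \<longleftrightarrow>
     (\<forall>f :: real^'d \<Rightarrow> real. continuous_on UNIV f \<longrightarrow> bounded (range f) \<longrightarrow>
        (\<lambda>n. \<integral>x. f x \<partial>P n) \<longlonglongrightarrow> (\<integral>x. f x \<partial>Q))"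

definition empirical_law :: "(real^'d) set \<Rightarrow> (real^'d) measure" where
  "empirical_law A = distr (uniform_count_measure A) borel (\<lambda>x. x)"

definition uniform_cube :: "(real^'d) measure" where
  "uniform_cube = uniform_measure lborel (cbox 0 1)"


section \<open>Pooled empirical ranks\<close>

text \<open>The pooled sample \<open>W\<^sub>1, \<dots>, W\<^sub>n\<close> lists the groups one after the other;
  \<open>pool_index ns j m\<close> is the position in it of the \<open>m\<close>-th observation of group \<open>j\<close>.
  All indices start at 1.\<close>

definition pool_index :: "(nat \<Rightarrow> nat) \<Rightarrow> nat \<Rightarrow> nat \<Rightarrow> nat" where
  "pool_index ns j m = (\<Sum>k=1..<j. ns k) + m"

definition pooled_sample :: "nat \<Rightarrow> (nat \<Rightarrow> nat) \<Rightarrow> (nat \<Rightarrow> nat \<Rightarrow> 'b) \<Rightarrow> nat \<Rightarrow> 'b" where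
  "pooled_sample K ns x i =
     concat (map (\<lambda>j. map (x j) [1..<Suc (ns j)]) [1..<Suc K]) ! (i - 1)"

lemma length_pooled:
  "length (concat (map (\<lambda>j. map (x j) [1..<Suc (ns j)]) [1..<Suc K])) = (\<Sum>j=1..K. ns j)"
  by (induction K) auto

lemma pooled_sample_pool_index:
  assumes "j \<in> {1..K}" "m \<in> {1..ns j}"
  shows "pooled_sample K ns x (pool_index ns j m) = x j m"
  using assms
proof (induction K)
  case 0
  then show ?case by simp
next
  case (Suc K)
  let ?L = "\<lambda>K. concat (map (\<lambda>j. map (x j) [1..<Suc (ns j)]) [1..<Suc K])"
  have split: "?L (Suc K) = ?L K @ map (x (Suc K)) [1..<Suc (ns (Suc K))]"
    by simp
  show ?case
  proof (cases "j = Suc K")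
    case True
    obtain m' where m': "m = Suc m'" "m' < ns (Suc K)"
      using Suc.prems True by (cases m) auto
    have "pool_index ns j m - 1 = length (?L K) + m'"
      using True m' unfolding length_pooled pool_index_def
      by (simp add: atLeastLessThanSuc_atLeastAtMost)
    then have "pooled_sample (Suc K) ns x (pool_index ns j m) =
        map (x (Suc K)) [1..<Suc (ns (Suc K))] ! m'"
      unfolding pooled_sample_def split by (simp only: nth_append_length_plus)
    then show ?thesis
      using True m' by (simp del: upt_Suc)
  next
    case False
    then have j: "j \<in> {1..K}" using Suc.prems by auto
    have "(\<Sum>k=1..<j. ns k) + ns j = (\<Sum>k=1..j. ns k)"
      using j by (metis atLeastAtMost_iff atLeastLessThanSuc_atLeastAtMost sum.atLeastLessThan_Suc)
    also have "\<dots> \<le> (\<Sum>k=1..K. ns k)"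
      using j by (intro sum_mono2) auto
    finally have "pool_index ns j m - 1 < length (?L K)"
      using Suc.prems unfolding length_pooled pool_index_def by auto
    then show ?thesis
      using Suc.IH[OF j Suc.prems(2)] unfolding pooled_sample_def split nth_append by simp
  qed
qed

definition opt_assignment :: "nat \<Rightarrow> (nat \<Rightarrow> real^'d) \<Rightarrow> (nat \<Rightarrow> real^'d) \<Rightarrow> nat \<Rightarrow> nat" where
  "opt_assignment n W h =
     (SOME \<sigma>. is_arg_min (\<lambda>\<sigma>. \<Sum>i=1..n. (norm (W i - h (\<sigma> i)))\<^sup>2) (\<lambda>\<sigma>. \<sigma> permutes {1..n}) \<sigma>)"

lemma opt_assignment_is_arg_min:
  "is_arg_min (\<lambda>\<sigma>. \<Sum>i=1..n. (norm (W i - h (\<sigma> i)))\<^sup>2) (\<lambda>\<sigma>. \<sigma> permutes {1..n})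
     (opt_assignment n W h)"
proof -
  have "finite {\<sigma>. \<sigma> permutes {1..n}}" "{\<sigma>. \<sigma> permutes {1..n}} \<noteq> {}"
    using finite_permutations[of "{1..n}"] permutes_id[of "{1..n}"] by blast+
  from ex_is_arg_min_if_finite[OF this] show ?thesis
    unfolding opt_assignment_def mem_Collect_eq by (rule someI_ex)
qed

definition empirical_rank :: "nat \<Rightarrow> (nat \<Rightarrow> real^'d) \<Rightarrow> (nat \<Rightarrow> real^'d) \<Rightarrow> nat \<Rightarrow> real^'d" where
  "empirical_rank n W h i = h (opt_assignment n W h i)"

text \<open>The rank of the \<open>m\<close>-th observation of group \<open>j\<close>. Ranks are attached to sample positions
  instead of sample values; the two agree unless observations coincide.\<close>

definition pooled_rank ::
  "nat \<Rightarrow> (nat \<Rightarrow> nat) \<Rightarrow> (nat \<Rightarrow> real^'d) \<Rightarrow> (nat \<Rightarrow> nat \<Rightarrow> real^'d) \<Rightarrow> nat \<Rightarrow> nat \<Rightarrow> real^'d"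
where
  "pooled_rank K ns h x j m =
     empirical_rank (\<Sum>k=1..K. ns k) (pooled_sample K ns x) h (pool_index ns j m)"


section \<open>Rank energy statistic and critical value\<close>

definition RE2_pair ::
  "nat \<Rightarrow> (nat \<Rightarrow> nat) \<Rightarrow> (nat \<Rightarrow> real^'d) \<Rightarrow> (nat \<Rightarrow> nat \<Rightarrow> real^'d) \<Rightarrow> nat \<Rightarrow> nat \<Rightarrow> real"
where
  "RE2_pair K ns h x j k =
     (let R = pooled_rank K ns h x in
       2 / (real (ns j) * real (ns k)) * (\<Sum>m=1..ns j. \<Sum>l=1..ns k. norm (R j m - R k l))
       - 1 / (real (ns j))\<^sup>2 * (\<Sum>m=1..ns j. \<Sum>l=1..ns j. norm (R j m - R j l))
       - 1 / (real (ns k))\<^sup>2 * (\<Sum>m=1..ns k. \<Sum>l=1..ns k. norm (R k m - R k l)))"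

definition RE2 ::
  "nat \<Rightarrow> (nat \<Rightarrow> nat) \<Rightarrow> (nat \<Rightarrow> real^'d) \<Rightarrow> (nat \<Rightarrow> nat \<Rightarrow> real^'d) \<Rightarrow> real"
where
  "RE2 K ns h x = (\<Sum>j=1..K - 1. RE2_pair K ns h x j (j + 1))"

definition null_space :: "nat \<Rightarrow> (nat \<Rightarrow> nat) \<Rightarrow> (real^'d) measure \<Rightarrow> (nat \<times> nat \<Rightarrow> real^'d) measure"
where
  "null_space K ns \<nu> = PiM (SIGMA j:{1..K}. {1..ns j}) (\<lambda>_. \<nu>)"

text \<open>The law under the null hypothesis is represented by an i.i.d. sample from a reference law
  \<open>\<nu>\<close>. By distribution-freeness the value is the same for every absolutely continuous \<open>\<nu>\<close>.\<close>

definition critical_value ::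
  "(real^'d) measure \<Rightarrow> real \<Rightarrow> nat \<Rightarrow> (nat \<Rightarrow> nat) \<Rightarrow> (nat \<Rightarrow> real^'d) \<Rightarrow> real"
where
  "critical_value \<nu> \<alpha> K ns h =
     Inf {c. measure (null_space K ns \<nu>)
               {y \<in> space (null_space K ns \<nu>).
                  real (\<Sum>k=1..K. ns k) * RE2 K ns h (\<lambda>j i. y (j, i)) \<ge> c} \<le> \<alpha>}"

end

theory Submission
  imports Defs
begin

text \<open>
  Under the null hypothesis the pooled sample is exchangeable and almost surely has a unique optimal
  assignment, because a tie forces the sample onto a hyperplane. Hence the assignment is uniform on the
  symmetric group whatever the common law is. Averaging over the symmetric group gives the statistic
  mean \<open>O(1/n)\<close>; being nonnegative, it tends to \<open>0\<close> in probability, so \<open>c\<^sub>n \<le> n \<delta>\<close> eventually for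
  every \<open>\<delta> > 0\<close>.

  Under the alternative the statistic stays above some \<open>\<delta> > 0\<close>. No limiting transport map is needed.
  Optimality makes the assignment monotone. The ranks fill the cube evenly, so cut the cube into small cells:
  monotonicity along each coordinate direction forces the observations assigned to a typical cell to be close
  to each other, since the oscillations telescope along lines of cells. If two groups had nearly the same
  mass in every cell, a Lipschitz function would therefore have nearly the same average over both groups,
  which the law of large numbers excludes when the two laws differ. So some cell carries different masses
  of the two groups, and the energy distance detects this: it is a mixture of Gaussian kernel discrepancies,
  and combinations of Gaussians are dense among the continuous functions on the cube.
\<close>

section \<open>Energy distance and Gaussian kernels\<close>

text \<open>The lower bound \<delta> has to be fixed before n, although the families of ranks grow
  with n. Hence grid size, Gaussian gap and \<delta> are all obtained before the finite families
  over which the estimates are quantified. Cells are overlapping continuous tents, not disjoint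
  boxes: the same functions must serve as test functions for weak convergence and be approximable by
  Gaussians. A single cell may still hold widely scattered observations; only the sum of the
  oscillations over all cells is controlled, so no cell may carry too large a share of a group. This
  cap is deterministic: the pooled ranks exhaust the n reference points, so a group's share is at
  most n / n_j times the share of all the points. Finally, two ranks in neighbouring cells differ in
  no definite direction; comparing cells L steps apart makes their difference almost parallel to a
  coordinate axis, which is why L must be large, and N large compared with L.\<close>

lemma inner_power_psd:
  fixes y :: "'i \<Rightarrow> 'a::euclidean_space"
  shows "0 \<le> (\<Sum>a\<in>I. \<Sum>b\<in>I. w a * w b * (y a \<bullet> y b) ^ k)"
proof (induction k arbitrary: w)
  case 0
  have "(\<Sum>a\<in>I. \<Sum>b\<in>I. w a * w b) = (\<Sum>a\<in>I. w a)\<^sup>2"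
    by (simp add: power2_eq_square sum_product)
  then show ?case by simp
next
  case (Suc k)
  \<comment> \<open>One factor of the power is expanded over \<open>Basis\<close> and its two
    coordinates are absorbed into the weights, so the induction has to run over all
    \<open>w\<close>.\<close>
  have "w a * w b * (y a \<bullet> y b) ^ Suc k
      = (\<Sum>e\<in>Basis. (w a * (y a \<bullet> e)) * (w b * (y b \<bullet> e)) * (y a \<bullet> y b) ^ k)" for a b
    by (simp add: euclidean_inner[of "y a" "y b"] sum_distrib_left sum_distrib_right mult_ac)
  then have "(\<Sum>a\<in>I. \<Sum>b\<in>I. w a * w b * (y a \<bullet> y b) ^ Suc k)
      = (\<Sum>a\<in>I. \<Sum>b\<in>I. \<Sum>e\<in>Basis. (w a * (y a \<bullet> e)) * (w b * (y b \<bullet> e)) * (y a \<bullet> y b) ^ k)"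
    by simp
  also have "\<dots> = (\<Sum>a\<in>I. \<Sum>e\<in>Basis. \<Sum>b\<in>I. (w a * (y a \<bullet> e)) * (w b * (y b \<bullet> e)) * (y a \<bullet> y b) ^ k)"
    by (intro sum.cong refl sum.swap)
  also have "\<dots> = (\<Sum>e\<in>Basis. \<Sum>a\<in>I. \<Sum>b\<in>I. (w a * (y a \<bullet> e)) * (w b * (y b \<bullet> e)) * (y a \<bullet> y b) ^ k)"
    by (rule sum.swap)
  also have "\<dots> \<ge> 0" by (intro sum_nonneg Suc.IH)
  finally show ?case .
qed

lemma exp_inner_psd:
  fixes y :: "'i \<Rightarrow> 'a::euclidean_space"
  assumes "t \<ge> 0"
  shows "0 \<le> (\<Sum>a\<in>I. \<Sum>b\<in>I. w a * w b * exp (t * (y a \<bullet> y b)))"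
proof -
  have "(\<lambda>k. \<Sum>a\<in>I. \<Sum>b\<in>I. w a * w b * ((t * (y a \<bullet> y b)) ^ k /\<^sub>R fact k))
      sums (\<Sum>a\<in>I. \<Sum>b\<in>I. w a * w b * exp (t * (y a \<bullet> y b)))"
    by (intro sums_sum sums_mult exp_converges)
  moreover have "0 \<le> (\<Sum>a\<in>I. \<Sum>b\<in>I. w a * w b * ((t * (y a \<bullet> y b)) ^ k /\<^sub>R fact k))" for k
  proof -
    have "(\<Sum>a\<in>I. \<Sum>b\<in>I. w a * w b * ((t * (y a \<bullet> y b)) ^ k /\<^sub>R fact k))
        = t ^ k / fact k * (\<Sum>a\<in>I. \<Sum>b\<in>I. w a * w b * (y a \<bullet> y b) ^ k)"
      by (simp add: sum_distrib_left power_mult_distrib divide_inverse mult_ac)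
    also have "\<dots> \<ge> 0" using assms by (intro mult_nonneg_nonneg inner_power_psd) auto
    finally show ?thesis .
  qed
  ultimately show ?thesis
    by (rule sums_le[OF _ sums_zero, rotated])
qed

text \<open>Squared norm, in the reproducing kernel Hilbert space of the Gaussian kernel with
  parameter \<open>s\<close>, of the signed measure with mass \<open>w a\<close> at
  \<open>y a\<close>; a squared maximum mean discrepancy when \<open>w\<close> is a difference of
  two probability weights.\<close>

definition gauss_energy :: "real \<Rightarrow> 'i set \<Rightarrow> ('i \<Rightarrow> real) \<Rightarrow> ('i \<Rightarrow> 'a::euclidean_space) \<Rightarrow> real" where
  "gauss_energy s I w y = (\<Sum>a\<in>I. \<Sum>b\<in>I. w a * w b * exp (- s * (norm (y a - y b))\<^sup>2))"

text \<open>The norm is conditionally negative definite, whence the minus sign: for weights of total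
  mass zero the value is nonnegative, and for a difference of two empirical laws it is their energy
  distance.\<close>

definition energy :: "'i set \<Rightarrow> ('i \<Rightarrow> real) \<Rightarrow> ('i \<Rightarrow> 'a::euclidean_space) \<Rightarrow> real" where
  "energy I w y = - (\<Sum>a\<in>I. \<Sum>b\<in>I. w a * w b * norm (y a - y b))"

lemma exp_norm_diff:
  fixes x y :: "'a::euclidean_space"
  shows "exp (- s * (norm (x - y))\<^sup>2) = exp (- s * (norm x)\<^sup>2) * exp (- s * (norm y)\<^sup>2) * exp (2 * s * (x \<bullet> y))"
  unfolding exp_add[symmetric]
  by (simp add: power2_norm_eq_inner algebra_simps inner_commute)

text \<open>The factors exp (- s |x|^2) of the kernel go into the weights, which leaves the positive
  semidefinite kernel exp (2 s x . y).\<close>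

lemma gauss_energy_nonneg:
  assumes "s \<ge> 0"
  shows "0 \<le> gauss_energy s I w y"
proof -
  have "gauss_energy s I w y = (\<Sum>a\<in>I. \<Sum>b\<in>I. (w a * exp (- s * (norm (y a))\<^sup>2)) *
      (w b * exp (- s * (norm (y b))\<^sup>2)) * exp ((2 * s) * (y a \<bullet> y b)))"
    unfolding gauss_energy_def exp_norm_diff by (simp add: mult_ac)
  then show ?thesis using exp_inner_psd[of "2 * s"] assms by simp
qed

text \<open>Cauchy--Schwarz in the reproducing kernel Hilbert space of the Gaussian kernel.\<close>

lemma gauss_feature_le:
  assumes "finite I"
  shows "(\<Sum>a\<in>I. w a * exp (- (norm (y a - z))\<^sup>2))\<^sup>2 \<le> gauss_energy 1 I w y"
proof -
  define f where "f = (\<Sum>a\<in>I. w a * exp (- (norm (y a - z))\<^sup>2))"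
  \<comment> \<open>Adjoin z as a new point \<open>None\<close> with weight - f. The kernel equals 1
    at (z, z), so this weight minimises the extended energy, whose value is then the old one minus
    f^2.\<close>
  define w' where "w' = case_option (- f) w"
  define y' where "y' = case_option z y"
  have split: "(\<Sum>a\<in>insert None (Some ` I). g a) = g None + (\<Sum>a\<in>I. g (Some a))" for g :: "_ \<Rightarrow> real"
    using assms by (simp add: sum.reindex)
  have "gauss_energy 1 (insert None (Some ` I)) w' y' =
     f\<^sup>2 + (\<Sum>a\<in>I. - f * (w a * exp (- (norm (y a - z))\<^sup>2))) +
       ((\<Sum>a\<in>I. - f * (w a * exp (- (norm (y a - z))\<^sup>2))) + gauss_energy 1 I w y)"
    unfolding gauss_energy_def split w'_def y'_def
    by (simp add: sum.distrib power2_eq_square norm_minus_commute mult_ac sum_subtractf sum_negf)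
  also have "\<dots> = gauss_energy 1 I w y - f\<^sup>2"
    unfolding sum_distrib_left[symmetric] f_def[symmetric] by (simp add: power2_eq_square)
  finally show ?thesis
    using gauss_energy_nonneg[of 1 "insert None (Some ` I)" w' y'] unfolding f_def by simp
qed

section \<open>Energy as a mixture of Gaussian discrepancies\<close>

text \<open>Normalising constant in the integral representation of the norm; partial integration
  gives 2 * sqrt pi, and the later estimates rest on its positivity.\<close>

definition root_const :: real where
  "root_const = (\<integral>t. (1 - exp (- t\<^sup>2)) / t\<^sup>2 \<partial>lborel)"

lemma integrable_inverse_one_plus_square:
  "integrable lborel (\<lambda>t::real. 1 / (1 + t\<^sup>2))"
proof -
  have "set_integrable lborel (einterval (-\<infinity>) \<infinity>) (\<lambda>x. inverse (1 + x^2) :: real)"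
  proof (rule interval_integral_FTC_nonneg(1)[where F = arctan and A = "-pi/2" and B = "pi/2"])
    show "((arctan \<circ> real_of_ereal) \<longlongrightarrow> - pi / 2) (at_right (- \<infinity>))"
      using tendsto_arctan_at_bot by (simp add: ereal_tendsto_simps)
    show "((arctan \<circ> real_of_ereal) \<longlongrightarrow> pi / 2) (at_left \<infinity>)"
      using tendsto_arctan_at_top by (simp add: ereal_tendsto_simps)
    show "AE x in lborel. -\<infinity> < ereal x \<longrightarrow> ereal x < \<infinity> \<longrightarrow> 0 \<le> inverse (1 + x\<^sup>2)" by simp
    show "DERIV arctan x :> inverse (1 + x\<^sup>2)" for x by (rule DERIV_arctan)
    have nz: "1 + x\<^sup>2 \<noteq> 0" for x :: real
      by (smt (verit) zero_le_power2)
    show "isCont (\<lambda>x. inverse (1 + x\<^sup>2)) x" for x :: real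
      using nz by (intro continuous_intros) auto
  qed auto
  then show ?thesis
    by (simp add: set_integrable_def inverse_eq_divide)
qed

lemma one_minus_exp_bounds:
  fixes u :: real assumes "u \<ge> 0"
  shows "0 \<le> 1 - exp (- u)" "1 - exp (- u) \<le> 1" "1 - exp (- u) \<le> u"
  using assms exp_ge_add_one_self[of "-u"] by auto

lemma integrable_root_integrand:
  "integrable lborel (\<lambda>t::real. (1 - exp (- t\<^sup>2)) / t\<^sup>2)"
proof (rule Bochner_Integration.integrable_bound)
  show "integrable lborel (\<lambda>t::real. 2 * (1 / (1 + t\<^sup>2)))"
    by (intro integrable_mult_right integrable_inverse_one_plus_square)
  show "AE t::real in lborel. norm ((1 - exp (- t\<^sup>2)) / t\<^sup>2) \<le> norm (2 * (1 / (1 + t\<^sup>2)))" 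
  proof (intro AE_I2)
    fix t :: real
    show "norm ((1 - exp (- t\<^sup>2)) / t\<^sup>2) \<le> norm (2 * (1 / (1 + t\<^sup>2)))"
    proof (cases "t = 0")
      case False
      define u where "u = t\<^sup>2"
      have u: "u > 0" using False by (simp add: u_def)
      \<comment> \<open>Both 1 - exp (-u) and u * (1 - exp (-u)) are at most u. This controls the
        integrand near 0 and at infinity at once.\<close>
      have "(1 - exp (- u)) * (1 + u) \<le> 2 * u"
        using one_minus_exp_bounds(3)[OF less_imp_le[OF u]] mult_pos_pos[OF exp_gt_zero[of "- u"] u]
        unfolding ring_distribs by linarith
      then show ?thesis
        using u one_minus_exp_bounds[of u] unfolding u_def[symmetric]
        by (simp add: field_simps)
    qed simp
  qed
qed simp

lemma root_const_pos: "root_const > 0"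
proof -
  \<comment> \<open>On [1, 2] the numerator is at least 1 - exp (-1) and the denominator at most
    4.\<close>
  have "0 < (1 - exp (-1)) / (4::real)" by simp
  also have "\<dots> = (\<integral>t. (1 - exp (-1)) / 4 * indicator {1..2::real} t \<partial>lborel)"
    by simp
  also have "\<dots> \<le> root_const" unfolding root_const_def
  proof (rule integral_mono[OF _ integrable_root_integrand])
    show "integrable lborel (\<lambda>t::real. (1 - exp (-1)) / 4 * indicator {1..2} t :: real)"
      by (intro integrable_mult_right) simp
    fix t :: real
    show "(1 - exp (-1)) / 4 * indicator {1..2} t \<le> (1 - exp (- t\<^sup>2)) / t\<^sup>2"
    proof (cases "t \<in> {1..2}")
      case True
      then have "t\<^sup>2 \<ge> 1" "t\<^sup>2 \<le> 4" using power_mono[of t 2 2] by auto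
      then have "(1 - exp (-1)) / 4 \<le> (1 - exp (- t\<^sup>2)) / t\<^sup>2" by (intro frac_le) auto
      then show ?thesis using True by simp
    qed (use one_minus_exp_bounds in simp)
  qed
  finally show ?thesis .
qed

text \<open>Substituting \<open>a * t\<close> for t turns 1 / t^2 into a factor a^2, of which the
  Jacobian takes back one a.\<close>

lemma norm_as_gauss_integral:
  assumes "a \<ge> 0"
  shows "has_bochner_integral lborel (\<lambda>t::real. (1 - exp (- t\<^sup>2 * a\<^sup>2)) / t\<^sup>2) (root_const * a)"
proof (cases "a = 0")
  case False
  then have a: "a > 0" using assms by simp
  let ?g = "\<lambda>t::real. (1 - exp (- t\<^sup>2)) / t\<^sup>2"
  have eq: "(1 - exp (- t\<^sup>2 * a\<^sup>2)) / t\<^sup>2 = a\<^sup>2 * ?g (0 + a * t)" for t :: real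
    using a by (cases "t = 0") (simp_all add: power_mult_distrib field_simps)
  have "integrable lborel (\<lambda>t. ?g (0 + a * t))"
    using lborel_integrable_real_affine[OF integrable_root_integrand, of a 0] a by simp
  moreover have "root_const = a * (\<integral>t. ?g (0 + a * t) \<partial>lborel)"
    unfolding root_const_def
    using lborel_integral_real_affine[of a ?g 0] a by simp
  ultimately show ?thesis
    unfolding eq has_bochner_integral_iff integral_mult_right_zero using a
    by (intro conjI integrable_mult_right) (simp_all only: power2_eq_square mult_ac)
qed (simp add: has_bochner_integral_zero)

text \<open>In the representation of the norm the constants 1 contribute the square of the total
  weight, which vanishes; only the Gaussian energies at scale t^2 remain.\<close>

lemma energy_gauss_integral:
  assumes "(\<Sum>a\<in>I. w a) = 0"
  shows "has_bochner_integral lborel (\<lambda>t::real. gauss_energy (t\<^sup>2) I w y / t\<^sup>2) (root_const * energy I w y)"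
proof -
  have "has_bochner_integral lborel
      (\<lambda>t::real. \<Sum>a\<in>I. \<Sum>b\<in>I. - (w a * w b) * ((1 - exp (- t\<^sup>2 * (norm (y a - y b))\<^sup>2)) / t\<^sup>2))
      (\<Sum>a\<in>I. \<Sum>b\<in>I. - (w a * w b) * (root_const * norm (y a - y b)))"
    by (intro has_bochner_integral_sum has_bochner_integral_mult_right norm_as_gauss_integral) simp
  moreover have "(\<Sum>a\<in>I. \<Sum>b\<in>I. - (w a * w b) * (root_const * norm (y a - y b))) = root_const * energy I w y"
    unfolding energy_def by (simp add: sum_distrib_left sum_negf mult_ac)
  moreover have "(\<Sum>a\<in>I. \<Sum>b\<in>I. - (w a * w b) * ((1 - exp (- t\<^sup>2 * (norm (y a - y b))\<^sup>2)) / t\<^sup>2))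
      = gauss_energy (t\<^sup>2) I w y / t\<^sup>2" for t :: real
  proof -
    have "(\<Sum>a\<in>I. \<Sum>b\<in>I. w a * w b) = 0"
      using assms by (simp add: sum_distrib_left[symmetric])
    then have "gauss_energy (t\<^sup>2) I w y = (\<Sum>a\<in>I. \<Sum>b\<in>I. w a * w b * exp (- t\<^sup>2 * (norm (y a - y b))\<^sup>2)) - (\<Sum>a\<in>I. \<Sum>b\<in>I. w a * w b)"
      by (simp add: gauss_energy_def)
    also have "\<dots> = (\<Sum>a\<in>I. \<Sum>b\<in>I. - (w a * w b) * (1 - exp (- t\<^sup>2 * (norm (y a - y b))\<^sup>2)))"
      by (simp add: sum_subtractf[symmetric] algebra_simps)
    finally show ?thesis by (simp add: sum_divide_distrib)
  qed
  ultimately show ?thesis by simp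
qed

lemma energy_nonneg:
  assumes "(\<Sum>a\<in>I. w a) = 0"
  shows "0 \<le> energy I w y"
proof -
  have "0 \<le> root_const * energy I w y"
    unfolding has_bochner_integral_integral_eq[OF energy_gauss_integral[OF assms], symmetric]
    by (rule integral_nonneg_AE) (simp add: gauss_energy_nonneg)
  then show ?thesis using root_const_pos by (simp add: zero_le_mult_iff)
qed

text \<open>Continuity in the scale at s = 1, uniform over configurations of bounded diameter: each
  kernel entry changes by at most \<open>D * (s - 1)\<close>, and the absolute weights multiply to
  at most 2^2.\<close>

lemma gauss_energy_lipschitz:
  assumes "s \<ge> 1" "D \<ge> 0" "\<And>a b. a \<in> I \<Longrightarrow> b \<in> I \<Longrightarrow> (norm (y a - y b))\<^sup>2 \<le> D" "(\<Sum>a\<in>I. \<bar>w a\<bar>) \<le> 2" 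
  shows "gauss_energy 1 I w y - 4 * D * (s - 1) \<le> gauss_energy s I w y"
proof -
  have "gauss_energy 1 I w y - gauss_energy s I w y \<le>
      (\<Sum>a\<in>I. \<Sum>b\<in>I. \<bar>w a\<bar> * \<bar>w b\<bar> * (D * (s - 1)))"
    unfolding gauss_energy_def sum_subtractf[symmetric]
  proof (intro sum_mono)
    fix a b assume ab: "a \<in> I" "b \<in> I"
    define v where "v = (norm (y a - y b))\<^sup>2"
    have v: "0 \<le> v" "v \<le> D" using assms(3)[OF ab] by (simp_all add: v_def)
    have e: "exp (- v) - exp (- s * v) = exp (- v) * (1 - exp (- ((s - 1) * v)))"
      by (simp add: algebra_simps exp_add[symmetric])
    have "\<bar>exp (- v) * (1 - exp (- ((s - 1) * v)))\<bar> \<le> 1 * ((s - 1) * v)"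
      unfolding abs_mult using v assms(1) one_minus_exp_bounds[of "(s - 1) * v"]
      by (intro mult_mono) auto
    also have "\<dots> \<le> D * (s - 1)" using v assms(1) by (simp add: mult.commute mult_right_mono)
    finally have "\<bar>w a * w b * (exp (- v) - exp (- s * v))\<bar> \<le> \<bar>w a\<bar> * \<bar>w b\<bar> * (D * (s - 1))"
      unfolding e[symmetric] abs_mult by (intro mult_left_mono) auto
    then show "w a * w b * exp (- 1 * (norm (y a - y b))\<^sup>2) - w a * w b * exp (- s * (norm (y a - y b))\<^sup>2)
        \<le> \<bar>w a\<bar> * \<bar>w b\<bar> * (D * (s - 1))"
      unfolding v_def[symmetric] by (simp add: algebra_simps)
  qed
  also have "\<dots> = (\<Sum>a\<in>I. \<bar>w a\<bar>)\<^sup>2 * (D * (s - 1))"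
    unfolding power2_eq_square sum_product by (simp only: sum_distrib_right)
  also have "\<dots> \<le> 2\<^sup>2 * (D * (s - 1))"
    using assms by (intro mult_right_mono power_mono) (auto simp: sum_nonneg)
  finally show ?thesis by simp
qed

text \<open>The energy integrates nonnegative Gaussian energies over all scales, so a short interval
  of scales next to 1, on which the Gaussian energy stays above g / 2, already bounds it below. The
  bound depends on g and D alone.\<close>

lemma energy_ge_gauss_energy:
  assumes "g > 0" "D \<ge> 0"
  obtains \<delta> where "\<delta> > 0"
    "\<And>(I :: 'i set) w (y :: 'i \<Rightarrow> 'a::euclidean_space). (\<Sum>a\<in>I. w a) = 0 \<Longrightarrow> (\<Sum>a\<in>I. \<bar>w a\<bar>) \<le> 2 \<Longrightarrow>
      (\<And>a b. a \<in> I \<Longrightarrow> b \<in> I \<Longrightarrow> (norm (y a - y b))\<^sup>2 \<le> D) \<Longrightarrow> g \<le> gauss_energy 1 I w y \<Longrightarrow> \<delta> \<le> energy I w y"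
proof -
  \<comment> \<open>On [1, 1 + \<eta>] one has t^2 - 1 \<le> 3 \<eta>, so the Lipschitz loss 4 D
    (t^2 - 1) is at most 12 D \<eta> \<le> g / 2. The + 1 keeps the denominator positive when D =
    0.\<close>
  define \<eta> where "\<eta> = min 1 (g / (24 * D + 1))"
  have \<eta>: "0 < \<eta>" "\<eta> \<le> 1" "24 * D * \<eta> \<le> g"
  proof -
    show "0 < \<eta>" "\<eta> \<le> 1" using assms by (auto simp: \<eta>_def)
    have "24 * D * \<eta> \<le> (24 * D + 1) * \<eta>" using \<open>0 < \<eta>\<close> by simp
    also have "\<dots> \<le> (24 * D + 1) * (g / (24 * D + 1))"
      using assms by (intro mult_left_mono) (auto simp: \<eta>_def)
    also have "\<dots> = g" using assms by simp
    finally show "24 * D * \<eta> \<le> g" .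
  qed
  show thesis
  proof (rule that)
    show "0 < g * \<eta> / 8 / root_const" using assms \<eta> root_const_pos by simp
    fix I :: "'i set" and w and y :: "'i \<Rightarrow> 'a"
    assume w: "(\<Sum>a\<in>I. w a) = 0" "(\<Sum>a\<in>I. \<bar>w a\<bar>) \<le> 2"
      and y: "\<And>a b. a \<in> I \<Longrightarrow> b \<in> I \<Longrightarrow> (norm (y a - y b))\<^sup>2 \<le> D" and g: "g \<le> gauss_energy 1 I w y"
    have "g * \<eta> / 8 = (\<integral>t. g / 8 * indicator {1..1+\<eta>} t \<partial>lborel)" using \<eta> by simp
    also have "\<dots> \<le> (\<integral>t. gauss_energy (t\<^sup>2) I w y / t\<^sup>2 \<partial>lborel)"
    proof (rule integral_mono)
      show "integrable lborel (\<lambda>t. g / 8 * indicator {1..1+\<eta>} t :: real)"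
        using \<eta> by (intro integrable_mult_right integrable_real_indicator) auto
      show "integrable lborel (\<lambda>t. gauss_energy (t\<^sup>2) I w y / t\<^sup>2)"
        using energy_gauss_integral[OF w(1), of y] by (simp add: has_bochner_integral_iff)
      fix t :: real
      show "g / 8 * indicator {1..1+\<eta>} t \<le> gauss_energy (t\<^sup>2) I w y / t\<^sup>2"
      proof (cases "t \<in> {1..1+\<eta>}")
        case True
        have t: "t\<^sup>2 \<ge> 1" "t\<^sup>2 \<le> 4" using True \<eta> power_mono[of t 2 2] by auto
        have gl: "gauss_energy 1 I w y - 4 * D * (t\<^sup>2 - 1) \<le> gauss_energy (t\<^sup>2) I w y"
          using t(1) assms(2) y w(2) by (rule gauss_energy_lipschitz)
        have "t\<^sup>2 \<le> (1 + \<eta>)\<^sup>2" using True by (intro power_mono) auto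
        also have "\<dots> \<le> 1 + 3 * \<eta>" using \<eta> by (simp add: power2_eq_square algebra_simps)
        finally have "4 * D * (t\<^sup>2 - 1) \<le> 4 * D * (3 * \<eta>)"
          using assms by (intro mult_left_mono) auto
        also have "\<dots> \<le> g / 2" using \<eta> by simp
        finally have "g / 2 \<le> gauss_energy (t\<^sup>2) I w y"
          using gl g by linarith
        then have "g / 2 / 4 \<le> gauss_energy (t\<^sup>2) I w y / t\<^sup>2"
          using t assms by (intro frac_le) auto
        then show ?thesis using True by simp
      qed (simp add: gauss_energy_nonneg)
    qed
    also have "\<dots> = root_const * energy I w y"
      using energy_gauss_integral[OF w(1), of y] by (simp add: has_bochner_integral_iff)
    finally show "g * \<eta> / 8 / root_const \<le> energy I w y"
      using root_const_pos by (simp add: field_simps)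
  qed
qed

section \<open>Exponentials as a dense algebra\<close>

text \<open>Multiplied by exp (- |x|^2), each exponential becomes a multiple of a Gaussian centred
  at z, whence the factor 2. Adding one term at a time gives the induction used for sums, products
  and the norm bound.\<close>

inductive_set exp_span :: "('a::euclidean_space \<Rightarrow> real) set" where
  zero: "(\<lambda>_. 0) \<in> exp_span"
| step: "f \<in> exp_span \<Longrightarrow> (\<lambda>x. c * exp (2 * (x \<bullet> z)) + f x) \<in> exp_span"

lemma exp_span_add:
  assumes "f \<in> exp_span" "g \<in> exp_span"
  shows "(\<lambda>x. f x + g x) \<in> exp_span"
  using assms(1)
proof induction
  case (step f c z)
  then show ?case using exp_span.step[of "\<lambda>x. f x + g x" c z] by (simp add: add.assoc)
qed (use assms(2) in simp)

lemma exp_span_mult_exp: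
  assumes "f \<in> exp_span"
  shows "(\<lambda>x. c * exp (2 * (x \<bullet> z)) * f x) \<in> exp_span"
  using assms
proof induction
  case (step f c' z')
  have "c * exp (2 * (x \<bullet> z)) * (c' * exp (2 * (x \<bullet> z')) + f x)
      = c * c' * exp (2 * (x \<bullet> (z + z'))) + c * exp (2 * (x \<bullet> z)) * f x" for x
    by (simp add: inner_add_right exp_add algebra_simps)
  then show ?case using exp_span.step[OF step.IH, of "c * c'" "z + z'"] by simp
qed (simp add: exp_span.zero)

lemma exp_span_mult:
  assumes "f \<in> exp_span" "g \<in> exp_span"
  shows "(\<lambda>x. f x * g x) \<in> exp_span"
  using assms(1)
proof induction
  case (step f c z)
  then show ?case
    using exp_span_add[OF exp_span_mult_exp[OF assms(2), of c z] step.IH] by (simp add: algebra_simps)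
qed (simp add: exp_span.zero)

lemma exp_span_exp: "(\<lambda>x. c * exp (2 * (x \<bullet> z))) \<in> exp_span"
  using exp_span.step[OF exp_span.zero, of c z] by simp

lemma continuous_on_exp_span: "f \<in> exp_span \<Longrightarrow> continuous_on S f"
  by (induction rule: exp_span.induct) (auto intro!: continuous_intros)

lemma function_ring_on_exp_span:
  assumes "compact S"
  shows "function_ring_on exp_span S"
proof
  show "(\<lambda>_::'a. c) \<in> exp_span" for c using exp_span_exp[of c 0] by simp
  \<comment> \<open>The exponential with z = x - y separates the two points: its exponents there
    differ by 2 |x - y|^2.\<close>
  fix x y :: 'a assume "x \<noteq> y"
  then have "(x - y) \<bullet> (x - y) \<noteq> 0" by simp
  then have "x \<bullet> (x - y) \<noteq> y \<bullet> (x - y)" by (simp add: inner_diff_left)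
  then show "\<exists>f\<in>exp_span. f x \<noteq> f y"
    by (intro bexI[OF _ exp_span_exp[of 1 "x - y"]]) simp
qed (use assms in \<open>auto intro: exp_span_add exp_span_mult continuous_on_exp_span\<close>)

text \<open>Each added term is a multiple of the kernel section at \<open>z\<close>, to which
  Cauchy-Schwarz applies. \<open>C\<close> bounds the Hilbert space norm of the combination of
  Gaussians and so depends on \<open>f\<close> only, not on points or weights.\<close>

lemma exp_span_le_gauss_energy:
  assumes "f \<in> (exp_span :: ('a::euclidean_space \<Rightarrow> real) set)"
  shows "\<exists>C\<ge>0. \<forall>(I :: 'i set) w y. finite I \<longrightarrow>
    \<bar>\<Sum>a\<in>I. w a * (exp (- (norm (y a))\<^sup>2) * f (y a))\<bar> \<le> C * sqrt (gauss_energy 1 I w y)"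
  using assms
proof induction
  case zero
  show ?case by (intro exI[of _ 0]) simp
next
  case (step f c z)
  then obtain C where C: "C \<ge> 0" "\<And>(I :: 'i set) w y. finite I \<Longrightarrow>
    \<bar>\<Sum>a\<in>I. w a * (exp (- (norm (y a))\<^sup>2) * f (y a))\<bar> \<le> C * sqrt (gauss_energy 1 I w y)"
    by blast
  \<comment> \<open>exp (|z|^2) is what is left when exp (- |x|^2) exp (2 x . z) is completed to a
    Gaussian centred at z.\<close>
  define B where "B = \<bar>c\<bar> * exp ((norm z)\<^sup>2)"
  have "\<bar>\<Sum>a\<in>I. w a * (exp (- (norm (y a))\<^sup>2) * (c * exp (2 * (y a \<bullet> z)) + f (y a)))\<bar>
      \<le> (B + C) * sqrt (gauss_energy 1 I w y)" if I: "finite I" for I :: "'i set" and w y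
  proof -
    have e: "exp (- (norm x)\<^sup>2) * exp (2 * (x \<bullet> z)) = exp ((norm z)\<^sup>2) * exp (- (norm (x - z))\<^sup>2)" for x
      using exp_norm_diff[of 1 x z] by (simp add: exp_minus)
    have "(\<Sum>a\<in>I. w a * (exp (- (norm (y a))\<^sup>2) * (c * exp (2 * (y a \<bullet> z)) + f (y a))))
       = (\<Sum>a\<in>I. c * exp ((norm z)\<^sup>2) * (w a * exp (- (norm (y a - z))\<^sup>2)) + w a * (exp (- (norm (y a))\<^sup>2) * f (y a)))"
    proof (intro sum.cong refl)
      fix a
      have "w a * (exp (- (norm (y a))\<^sup>2) * (c * exp (2 * (y a \<bullet> z)) + f (y a)))
        = c * w a * (exp (- (norm (y a))\<^sup>2) * exp (2 * (y a \<bullet> z))) + w a * (exp (- (norm (y a))\<^sup>2) * f (y a))"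
        by (simp add: algebra_simps)
      then show "w a * (exp (- (norm (y a))\<^sup>2) * (c * exp (2 * (y a \<bullet> z)) + f (y a)))
        = c * exp ((norm z)\<^sup>2) * (w a * exp (- (norm (y a - z))\<^sup>2)) + w a * (exp (- (norm (y a))\<^sup>2) * f (y a))"
        unfolding e by (simp add: mult_ac)
    qed
    also have "\<dots> = c * exp ((norm z)\<^sup>2) * (\<Sum>a\<in>I. w a * exp (- (norm (y a - z))\<^sup>2))
        + (\<Sum>a\<in>I. w a * (exp (- (norm (y a))\<^sup>2) * f (y a)))"
      by (simp add: sum.distrib sum_distrib_left)
    also have "\<bar>\<dots>\<bar> \<le> B * \<bar>\<Sum>a\<in>I. w a * exp (- (norm (y a - z))\<^sup>2)\<bar>
        + \<bar>\<Sum>a\<in>I. w a * (exp (- (norm (y a))\<^sup>2) * f (y a))\<bar>"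
      unfolding B_def by (rule order_trans[OF abs_triangle_ineq]) (simp add: abs_mult)
    also have "\<dots> \<le> B * sqrt (gauss_energy 1 I w y) + C * sqrt (gauss_energy 1 I w y)"
      using gauss_feature_le[OF I, of w y z] C(2)[OF I, of w y]
      by (intro add_mono mult_left_mono) (auto simp: B_def intro!: real_le_rsqrt)
    finally show ?thesis by (simp add: algebra_simps)
  qed
  moreover have "B + C \<ge> 0" using C by (simp add: B_def)
  ultimately show ?case by blast
qed

text \<open>Approximate
  \<open>\<phi>(x) exp |x|\<^sup>2\<close> by combinations of the functions \<open>exp (2 x \<bullet> z)\<close>, which turns \<open>\<phi>\<close> into a combination
  of translates of the Gaussian kernel.\<close>

lemma energy_separates:
  fixes \<phi> :: "'a::euclidean_space \<Rightarrow> real"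
  assumes S: "compact S" "continuous_on S \<phi>" and \<epsilon>: "\<epsilon> > 0"
  obtains \<delta> where "\<delta> > 0"
    "\<And>(I :: 'i set) w y. finite I \<Longrightarrow> (\<And>a. a \<in> I \<Longrightarrow> y a \<in> S) \<Longrightarrow> (\<Sum>a\<in>I. w a) = 0 \<Longrightarrow> (\<Sum>a\<in>I. \<bar>w a\<bar>) \<le> 2 \<Longrightarrow>
      \<epsilon> \<le> \<bar>\<Sum>a\<in>I. w a * \<phi> (y a)\<bar> \<Longrightarrow> \<delta> \<le> energy I w y"
proof -
  interpret function_ring_on exp_span S by (rule function_ring_on_exp_span[OF S(1)])
  have cont: "continuous_on S (\<lambda>x. \<phi> x * exp ((norm x)\<^sup>2))"
    using S by (intro continuous_intros)
  obtain F where F: "\<And>n. F n \<in> exp_span" "uniform_limit S F (\<lambda>x. \<phi> x * exp ((norm x)\<^sup>2)) sequentially"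
    using Stone_Weierstrass[OF cont] by blast
  have "\<forall>\<^sub>F n in sequentially. \<forall>x\<in>S. dist (F n x) (\<phi> x * exp ((norm x)\<^sup>2)) < \<epsilon> / 4"
    by (rule uniform_limitD[OF F(2)]) (use \<epsilon> in simp)
  then obtain n where n: "\<forall>x\<in>S. dist (F n x) (\<phi> x * exp ((norm x)\<^sup>2)) < \<epsilon> / 4"
    by (auto simp: eventually_sequentially)
  define f where "f = F n"
  have f: "f \<in> exp_span" "\<And>x. x \<in> S \<Longrightarrow> \<bar>\<phi> x * exp ((norm x)\<^sup>2) - f x\<bar> < \<epsilon> / 4"
    using F(1) n by (auto simp: f_def dist_real_def abs_minus_commute)
  obtain C where C: "C \<ge> 0" "\<And>(I :: 'i set) w y. finite I \<Longrightarrow>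
    \<bar>\<Sum>a\<in>I. w a * (exp (- (norm (y a))\<^sup>2) * f (y a))\<bar> \<le> C * sqrt (gauss_energy 1 I w y)"
    using exp_span_le_gauss_energy[OF f(1)] by blast
  \<comment> \<open>The uniform error \<epsilon> / 4 costs at most \<epsilon> / 2 against weights of
    total absolute mass 2, so \<epsilon> / 2 is left for the Gaussian part; \<open>C + 1\<close>
    avoids division by zero.\<close>
  define g where "g = (\<epsilon> / (2 * (C + 1)))\<^sup>2"
  have g: "g > 0" using \<epsilon> C by (simp add: g_def)
  define D where "D = (diameter S)\<^sup>2"
  obtain \<delta> where \<delta>: "\<delta> > 0" "\<And>(I :: 'i set) w (y :: 'i \<Rightarrow> 'a). (\<Sum>a\<in>I. w a) = 0 \<Longrightarrow> (\<Sum>a\<in>I. \<bar>w a\<bar>) \<le> 2 \<Longrightarrow>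
      (\<And>a b. a \<in> I \<Longrightarrow> b \<in> I \<Longrightarrow> (norm (y a - y b))\<^sup>2 \<le> D) \<Longrightarrow> g \<le> gauss_energy 1 I w y \<Longrightarrow> \<delta> \<le> energy I w y"
    using energy_ge_gauss_energy[OF g, of D] by (auto simp: D_def)
  show thesis
  proof (rule that[OF \<delta>(1)])
    fix I :: "'i set" and w y
    assume I: "finite I" "\<And>a. a \<in> I \<Longrightarrow> y a \<in> S"
      and w: "(\<Sum>a\<in>I. w a) = 0" "(\<Sum>a\<in>I. \<bar>w a\<bar>) \<le> 2" and big: "\<epsilon> \<le> \<bar>\<Sum>a\<in>I. w a * \<phi> (y a)\<bar>"
    have app: "\<bar>\<phi> x - exp (- (norm x)\<^sup>2) * f x\<bar> \<le> \<epsilon> / 4" if "x \<in> S" for x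
    proof -
      have "\<phi> x - exp (- (norm x)\<^sup>2) * f x = exp (- (norm x)\<^sup>2) * (\<phi> x * exp ((norm x)\<^sup>2) - f x)"
        by (simp add: algebra_simps exp_minus)
      also have "\<bar>\<dots>\<bar> \<le> 1 * (\<epsilon> / 4)"
        unfolding abs_mult using f(2)[OF that] by (intro mult_mono) auto
      finally show ?thesis by simp
    qed
    have "(\<Sum>a\<in>I. w a * \<phi> (y a)) = (\<Sum>a\<in>I. w a * (\<phi> (y a) - exp (- (norm (y a))\<^sup>2) * f (y a)))
        + (\<Sum>a\<in>I. w a * (exp (- (norm (y a))\<^sup>2) * f (y a)))"
      by (simp add: sum.distrib[symmetric] algebra_simps)
    moreover have "\<bar>\<Sum>a\<in>I. w a * (\<phi> (y a) - exp (- (norm (y a))\<^sup>2) * f (y a))\<bar> \<le> (\<Sum>a\<in>I. \<bar>w a\<bar> * (\<epsilon> / 4))"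
      unfolding abs_mult[symmetric] using I app
      by (intro order_trans[OF sum_abs] sum_mono) (simp only: abs_mult, intro mult_left_mono, auto)
    moreover have "(\<Sum>a\<in>I. \<bar>w a\<bar> * (\<epsilon> / 4)) \<le> 2 * (\<epsilon> / 4)"
      unfolding sum_distrib_right[symmetric] using w \<epsilon> by (intro mult_right_mono) auto
    moreover have "C * sqrt (gauss_energy 1 I w y) \<le> (C + 1) * sqrt (gauss_energy 1 I w y)"
      using gauss_energy_nonneg[of 1 I w y] by (intro mult_right_mono) auto
    ultimately have "\<epsilon> / 2 \<le> (C + 1) * sqrt (gauss_energy 1 I w y)"
      using C(2)[OF I(1), of w y] big by linarith
    then have "\<epsilon> / (2 * (C + 1)) \<le> sqrt (gauss_energy 1 I w y)"
      using C by (simp add: field_simps)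
    then have "g \<le> (sqrt (gauss_energy 1 I w y))\<^sup>2"
      unfolding g_def using \<epsilon> C by (intro power_mono) auto
    then have "g \<le> gauss_energy 1 I w y" by (simp add: gauss_energy_nonneg)
    moreover have "(norm (y a - y b))\<^sup>2 \<le> D" if "a \<in> I" "b \<in> I" for a b
      unfolding D_def using that I S(1)
      by (intro power_mono) (auto simp: dist_norm[symmetric] compact_imp_bounded diameter_bounded_bound)
    ultimately show "\<delta> \<le> energy I w y" using \<delta>(2)[OF w] by blast
  qed
qed

section \<open>Monotone assignments and cell averages\<close>

definition hat :: "real \<Rightarrow> real" where
  "hat t = max 0 (1 - \<bar>t\<bar>)"

definition grid :: "nat \<Rightarrow> ('d::finite \<Rightarrow> int) set" where
  "grid N = PiE UNIV (\<lambda>_. {0..int N})"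

text \<open>Multilinear tent centred at c / N and supported on the surrounding cube of side 2 / N.
  Integer indices let cells shifted out of the cube still make sense; the grid includes both ends of
  each axis, hence N + 1 centres per axis.\<close>

definition bump :: "nat \<Rightarrow> ('d::finite \<Rightarrow> int) \<Rightarrow> real^'d \<Rightarrow> real" where
  "bump N c y = (\<Prod>i\<in>UNIV. hat (real N * y $ i - of_int (c i)))"

lemma finite_grid: "finite (grid N :: ('d::finite \<Rightarrow> int) set)"
  unfolding grid_def by (intro finite_PiE) auto

lemma card_grid: "card (grid N :: ('d::finite \<Rightarrow> int) set) = (N + 1) ^ CARD('d)"
  unfolding grid_def by (subst card_PiE) (auto simp: nat_add_distrib)

lemma hat_nonneg: "0 \<le> hat t" and hat_le_1: "hat t \<le> 1"
  by (auto simp: hat_def)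

lemma bump_nonneg: "0 \<le> bump N c y"
  unfolding bump_def by (intro prod_nonneg) (auto simp: hat_nonneg)

lemma bump_le_1: "bump N c y \<le> 1"
  unfolding bump_def by (intro prod_le_1) (auto simp: hat_nonneg hat_le_1)

lemma continuous_on_bump: "continuous_on S (bump N c)"
  unfolding bump_def hat_def by (intro continuous_intros)

lemma bump_pos_iff: "bump N c y > 0 \<longleftrightarrow> (\<forall>i. \<bar>real N * y $ i - of_int (c i)\<bar> < 1)"
proof -
  have "bump N c y > 0 \<longleftrightarrow> bump N c y \<noteq> 0" using bump_nonneg[of N c y] by linarith
  also have "\<dots> \<longleftrightarrow> (\<forall>i. hat (real N * y $ i - of_int (c i)) \<noteq> 0)"
    by (simp add: bump_def)
  also have "\<dots> \<longleftrightarrow> (\<forall>i. \<bar>real N * y $ i - of_int (c i)\<bar> < 1)"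
  proof -
    have "hat t \<noteq> 0 \<longleftrightarrow> \<bar>t\<bar> < 1" for t by (auto simp: hat_def)
    then show ?thesis by blast
  qed
  finally show ?thesis .
qed

text \<open>Only the two tents at the integers around s can be nonzero, and their values are the
  weights of linear interpolation.\<close>

lemma sum_hat:
  assumes "0 \<le> s" "s \<le> real N"
  shows "(\<Sum>t\<in>{0..int N}. hat (s - of_int t)) = 1"
proof -
  define m where "m = \<lfloor>s\<rfloor>"
  have m: "of_int m \<le> s" "s < of_int m + 1" by (auto simp: m_def)
  have m_range: "0 \<le> m" "m \<le> int N" using assms by (auto simp: m_def floor_le_iff) 
  have zero: "hat (s - of_int t) = 0" if "t \<noteq> m" "t \<noteq> m + 1" for t
  proof -
    have "t \<le> m - 1 \<or> t \<ge> m + 2" using that by linarith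
    then have "of_int t \<le> of_int m - (1::real) \<or> of_int t \<ge> of_int m + (2::real)"
      by linarith
    then show ?thesis using m by (auto simp: hat_def)
  qed
  show ?thesis
  proof (cases "m = int N")
    case True
    \<comment> \<open>At the right end there is no tent m + 1, but s = m gives the tent at m the
      full value 1.\<close>
    then have s: "s = of_int m" using m assms by simp
    have "(\<Sum>t\<in>{0..int N}. hat (s - of_int t)) = (\<Sum>t\<in>{m}. hat (s - of_int t))"
      using m_range zero s True by (intro sum.mono_neutral_right) (auto simp: hat_def)
    then show ?thesis by (simp add: s hat_def)
  next
    case False
    have "(\<Sum>t\<in>{0..int N}. hat (s - of_int t)) = (\<Sum>t\<in>{m, m+1}. hat (s - of_int t))"
      using m_range zero False by (intro sum.mono_neutral_right) auto
    also have "\<dots> = hat (s - of_int m) + hat (s - of_int (m + 1))" by simp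
    also have "\<dots> = 1" using m by (auto simp: hat_def max_def)
    finally show ?thesis .
  qed
qed

lemma sum_bump:
  fixes y :: "real^'d"
  assumes "y \<in> cbox 0 1"
  shows "(\<Sum>c\<in>grid N. bump N c y) = 1"
proof -
  have y: "0 \<le> y $ i" "y $ i \<le> 1" for i
    using assms by (auto simp: mem_box_cart)
  have "(\<Sum>c\<in>grid N. bump N c y) = (\<Prod>i\<in>(UNIV::'d set). \<Sum>t\<in>{0..int N}. hat (real N * y $ i - of_int t))"
    unfolding grid_def bump_def by (subst prod_sum_PiE) auto
  also have "\<dots> = (\<Prod>i\<in>(UNIV::'d set). 1)"
    using y by (intro prod.cong sum_hat) (auto intro: mult_left_le)
  finally show ?thesis by simp
qed

section \<open>Oscillation of a monotone assignment along lines of cells\<close>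

text \<open>Scaled by N, the difference of the ranks is at least L - 2 in direction \<open>i\<close>
  and at most 2 in absolute value in every other coordinate. Monotonicity therefore tolerates a
  decrease in direction \<open>i\<close> only as far as the other coordinates, each varying by at
  most 2 R, compensate for it.\<close>

lemma bump_shift_monotone:
  fixes x x' y y' :: "real^'d"
  assumes y: "bump N c y > 0" and y': "bump N c' y' > 0"
    and c: "\<And>j. j \<noteq> i \<Longrightarrow> c' j = c j" "c i \<ge> c' i + L" and L: "L \<ge> 3" and N: "N > 0"
    and mono: "(x - x') \<bullet> (y - y') \<ge> 0" and R: "norm x \<le> R" "norm x' \<le> R"
  shows "x' $ i \<le> x $ i + 4 * R * real CARD('d) / of_int (L - 2)"
proof (cases "x' $ i \<le> x $ i")
  case True
  have "R \<ge> 0" using R norm_ge_zero[of x] by linarith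
  then have "0 \<le> 4 * R * real CARD('d) / of_int (L - 2)" using L by simp
  with True show ?thesis by linarith
next
  case False
  have "R \<ge> 0" using R norm_ge_zero[of x] by linarith
  have b: "\<bar>real N * y $ j - of_int (c j)\<bar> < 1" "\<bar>real N * y' $ j - of_int (c' j)\<bar> < 1" for j
    using y y' unfolding bump_pos_iff by auto
  define v where "v j = real N * (y $ j - y' $ j)" for j
  have vi: "v i \<ge> of_int (L - 2)"
  proof -
    have "real_of_int (c i) \<ge> of_int (c' i) + of_int L" using c(2) by linarith
    then show ?thesis using b[of i] unfolding v_def right_diff_distrib of_int_diff by (simp add: abs_less_iff)
  qed
  have vj: "\<bar>v j\<bar> \<le> 2" if "j \<noteq> i" for j
    using b[of j] c(1)[OF that] unfolding v_def right_diff_distrib by (simp add: abs_less_iff abs_le_iff)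
  have "0 \<le> real N * ((x - x') \<bullet> (y - y'))" using mono by simp
  also have "\<dots> = (\<Sum>j\<in>UNIV. (x $ j - x' $ j) * v j)"
    by (simp add: inner_vec_def v_def sum_distrib_left mult_ac)
  also have "\<dots> = (x $ i - x' $ i) * v i + (\<Sum>j\<in>UNIV - {i}. (x $ j - x' $ j) * v j)"
    by (subst sum.remove[of _ i]) auto
  finally have "(x' $ i - x $ i) * v i \<le> (\<Sum>j\<in>UNIV - {i}. (x $ j - x' $ j) * v j)"
    by (simp add: algebra_simps)
  also have "\<dots> \<le> (\<Sum>j\<in>UNIV - {i}. 2 * R * 2)"
  proof (intro sum_mono)
    fix j assume "j \<in> UNIV - {i}"
    then have "\<bar>v j\<bar> \<le> 2" using vj by simp
    moreover have "\<bar>x $ j - x' $ j\<bar> \<le> 2 * R"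
      using component_le_norm_cart[of x j] component_le_norm_cart[of x' j] R by linarith
    ultimately have "\<bar>(x $ j - x' $ j) * v j\<bar> \<le> 2 * R * 2"
      unfolding abs_mult by (intro mult_mono) (use \<open>R \<ge> 0\<close> in auto)
    then show "(x $ j - x' $ j) * v j \<le> 2 * R * 2" by linarith
  qed
  also have "\<dots> \<le> (\<Sum>j\<in>(UNIV::'d set). 2 * R * 2)"
    using \<open>R \<ge> 0\<close> by (intro sum_mono2) auto
  finally have "(x' $ i - x $ i) * v i \<le> 4 * R * real CARD('d)" by (simp add: mult_ac)
  moreover have "(x' $ i - x $ i) * of_int (L - 2) \<le> (x' $ i - x $ i) * v i"
    using False vi by (intro mult_left_mono) auto
  ultimately have "(x' $ i - x $ i) * of_int (L - 2) \<le> 4 * R * real CARD('d)" by linarith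
  moreover have "(0::real) < of_int (L - 2)" using L by simp
  ultimately have "x' $ i - x $ i \<le> 4 * R * real CARD('d) / of_int (L - 2)"
    by (simp add: pos_le_divide_eq)
  then show ?thesis by linarith
qed

lemma card_slab:
  "card (PiE (UNIV :: 'd::finite set) (\<lambda>k. if k = i then T else {0..int N})) = card T * (N + 1) ^ (CARD('d) - 1)"
proof -
  have "card (PiE (UNIV :: 'd set) (\<lambda>k. if k = i then T else {0..int N}))
      = (\<Prod>k\<in>(UNIV::'d set). card (if k = i then T else {0..int N}))"
    by (subst card_PiE) auto
  also have "\<dots> = card T * (\<Prod>k\<in>UNIV - {i}. card (if k = i then T else {0..int N}))"
    by (subst prod.remove[of _ i]) auto
  also have "(\<Prod>k\<in>UNIV - {i}. card (if k = i then T else {0..int N})) = (\<Prod>k\<in>UNIV - {i}. N + 1)"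
    by (intro prod.cong) auto
  finally show ?thesis by (simp add: card_Diff_singleton)
qed

text \<open>The shifted grid cancels against the grid itself except for slabs of thickness
  \<open>L\<close> at the two ends, whose size is of lower order than the number of cells.\<close>

lemma sum_grid_shift_le:
  fixes U :: "('d::finite \<Rightarrow> int) \<Rightarrow> real"
  assumes U: "\<And>c. \<bar>U c\<bar> \<le> R"
  shows "(\<Sum>c\<in>grid N. U c - U (c(i := c i - int L))) \<le> 2 * R * real L * (real N + 1) ^ (CARD('d) - 1)"
proof -
  let ?B = "\<lambda>T. PiE (UNIV :: 'd set) (\<lambda>k. if k = i then T else {0..int N})"
  define C :: "('d \<Rightarrow> int) set" where "C = grid N"
  define C' where "C' = (\<lambda>c. c(i := c i - int L)) ` C"
  have fin: "finite C" "finite C'" by (auto simp: C_def C'_def finite_grid)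
  have inj: "inj_on (\<lambda>c. c(i := c i - int L)) C"
  proof (rule inj_onI)
    fix c d assume eq: "c(i := c i - int L) = d(i := d i - int L)"
    show "c = d"
    proof
      fix k show "c k = d k" using fun_cong[OF eq, of k] by (cases "k = i") auto
    qed
  qed
  have "(\<Sum>c\<in>C. U c - U (c(i := c i - int L))) = sum U C - sum U C'"
    unfolding C'_def by (simp add: sum_subtractf sum.reindex[OF inj])
  also have "\<dots> = sum U (C - C') - sum U (C' - C)"
    using fin by (simp add: sum.Int_Diff[of C U C'] sum.Int_Diff[of C' U C] Int_commute)
  also have "\<dots> \<le> (\<Sum>c\<in>C - C'. R) + (\<Sum>c\<in>C' - C. R)"
  proof -
    have "sum U (C - C') \<le> (\<Sum>c\<in>C - C'. R)"
      using U by (intro sum_mono) (auto simp: abs_le_iff)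
    moreover have "- sum U (C' - C) \<le> (\<Sum>c\<in>C' - C. R)"
      unfolding sum_negf[symmetric] using U by (intro sum_mono) (auto simp: abs_le_iff)
    ultimately show ?thesis by linarith
  qed
  also have "\<dots> = R * (real (card (C - C')) + real (card (C' - C)))"
    by (simp add: algebra_simps)
  also have "\<dots> \<le> R * (real (L * (N + 1) ^ (CARD('d) - 1)) + real (L * (N + 1) ^ (CARD('d) - 1)))"
  proof (intro mult_left_mono add_mono of_nat_mono)
    have "C - C' \<subseteq> ?B {int N - int L + 1..int N}"
    proof
      fix c assume c: "c \<in> C - C'"
      have r: "0 \<le> c k" "c k \<le> int N" for k using c by (auto simp: C_def grid_def PiE_def)
      have "\<not> c i \<le> int N - int L"
      proof
        assume "c i \<le> int N - int L"
        then have "c(i := c i + int L) \<in> C" using r by (auto simp: C_def grid_def PiE_def)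
        then have "c \<in> C'" unfolding C'_def by (intro image_eqI[of _ _ "c(i := c i + int L)"]) auto
        then show False using c by simp
      qed
      then show "c \<in> ?B {int N - int L + 1..int N}" using r by (auto simp: PiE_def)
    qed
    then have "card (C - C') \<le> card (?B {int N - int L + 1..int N})"
      by (intro card_mono finite_PiE) auto
    then show "card (C - C') \<le> L * (N + 1) ^ (CARD('d) - 1)"
      unfolding card_slab by simp
    have "C' - C \<subseteq> ?B {- int L..-1}"
    proof
      fix c assume c: "c \<in> C' - C"
      then obtain d where d: "d \<in> C" "c = d(i := d i - int L)" by (auto simp: C'_def)
      have r: "0 \<le> d k" "d k \<le> int N" for k using d by (auto simp: C_def grid_def PiE_def)
      have "\<not> c i \<ge> 0"
      proof
        assume "c i \<ge> 0"
        moreover have "c i \<le> int N" using d r(2)[of i] by simp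
        ultimately have "c \<in> C" using d r by (auto simp: C_def grid_def PiE_def)
        then show False using c by simp
      qed
      then show "c \<in> ?B {- int L..-1}" using r r[of i] d by (auto simp: PiE_def)
    qed
    then have "card (C' - C) \<le> card (?B {- int L..-1})"
      by (intro card_mono finite_PiE) auto
    then show "card (C' - C) \<le> L * (N + 1) ^ (CARD('d) - 1)"
      unfolding card_slab by simp
    show "0 \<le> R" using U abs_ge_zero order_trans by blast
  qed
  finally show ?thesis by (simp add: C_def algebra_simps)
qed

text \<open>In direction \<open>i\<close>, let \<open>U c\<close> be the largest \<open>i\<close>-th coordinate seen at or before cell \<open>c\<close>
  when cells are visited in steps of length \<open>L\<close>. Monotonicity makes the oscillation over a cell at
  most the increment of \<open>U\<close> up to a small error, and the increments telescope.\<close>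

lemma coordinate_oscillation:
  fixes x y :: "'i \<Rightarrow> real^'d"
  assumes G: "finite G" and R: "R \<ge> 0" "\<And>a. a \<in> G \<Longrightarrow> norm (x a) \<le> R"
    and mono: "\<And>a b. a \<in> G \<Longrightarrow> b \<in> G \<Longrightarrow> (x a - x b) \<bullet> (y a - y b) \<ge> 0"
    and N: "N > 0" and L: "L \<ge> (3::nat)"
  obtains osc :: "('d \<Rightarrow> int) \<Rightarrow> real" where "\<And>c. osc c \<ge> 0"
    "\<And>a b c. a \<in> G \<Longrightarrow> b \<in> G \<Longrightarrow> bump N c (y a) > 0 \<Longrightarrow> bump N c (y b) > 0 \<Longrightarrow> x a $ i - x b $ i \<le> osc c"
    "(\<Sum>c\<in>grid N. osc c) \<le> 2 * R * real L * (real N + 1) ^ (CARD('d) - 1)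
        + 4 * R * real CARD('d) / (real L - 2) * (real N + 1) ^ CARD('d)"
proof -
  define err where "err = 4 * R * real CARD('d) / (real L - 2)"
  have err: "err \<ge> 0" using R L by (simp add: err_def)
  define P where "P c = {a\<in>G. \<exists>k::nat. bump N (c(i := c i - int k * int L)) (y a) > 0}" for c :: "'d \<Rightarrow> int"
  \<comment> \<open>The default - R covers cells with empty \<open>P c\<close> and keeps U within
    [-R, R].\<close>
  define U where "U c = Max (insert (- R) ((\<lambda>a. x a $ i) ` P c))" for c
  have finP: "finite (P c)" for c using G by (simp add: P_def)
  have comp: "\<bar>x a $ i\<bar> \<le> R" if "a \<in> G" for a
    using component_le_norm_cart[of "x a" i] R(2)[OF that] by linarith
  have U_abs: "\<bar>U c\<bar> \<le> R" for c
  proof -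
    have "U c \<in> insert (- R) ((\<lambda>a. x a $ i) ` P c)"
      unfolding U_def using finP by (intro Max_in) auto
    then show ?thesis using comp R by (auto simp: P_def)
  qed
  have U_ge: "x a $ i \<le> U c" if "a \<in> P c" for a c
    unfolding U_def using finP that by (intro Max_ge) auto
  have P_sub: "P (c(i := c i - int L)) \<subseteq> P c" for c
  proof
    fix a assume "a \<in> P (c(i := c i - int L))"
    then obtain k :: nat where k: "a \<in> G" "bump N (c(i := c i - int L - int k * int L)) (y a) > 0"
      by (auto simp: P_def)
    have "c i - int L - int k * int L = c i - int (Suc k) * int L" by (simp add: algebra_simps)
    then show "a \<in> P c" using k unfolding P_def by (metis (mono_tags, lifting) mem_Collect_eq)
  qed
  define osc where "osc c = U c - U (c(i := c i - int L)) + err" for c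
  show thesis
  proof (rule that)
    fix c
    have "U (c(i := c i - int L)) \<le> U c"
      unfolding U_def using finP P_sub by (intro Max_mono) auto
    then show "osc c \<ge> 0" using err by (simp add: osc_def)
  next
    fix a b c assume ab: "a \<in> G" "b \<in> G" "bump N c (y a) > 0" "bump N c (y b) > 0"
    have "a \<in> P c" unfolding P_def using ab by (auto intro!: exI[of _ 0])
    then have 1: "x a $ i \<le> U c" by (rule U_ge)
    have "U (c(i := c i - int L)) \<in> insert (- R) ((\<lambda>a. x a $ i) ` P (c(i := c i - int L)))"
      unfolding U_def using finP by (intro Max_in) auto
    then have 2: "U (c(i := c i - int L)) \<le> x b $ i + err"
    proof
      assume "U (c(i := c i - int L)) = - R"
      then show ?thesis using comp[OF ab(2)] err by linarith
    next
      assume "U (c(i := c i - int L)) \<in> (\<lambda>a. x a $ i) ` P (c(i := c i - int L))"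
      then obtain a' and k :: nat where a': "a' \<in> G" "U (c(i := c i - int L)) = x a' $ i"
        "bump N (c(i := c i - int L - int k * int L)) (y a') > 0"
        by (auto simp: P_def)
      \<comment> \<open>The maximiser a' belongs to c shifted back by (k + 1) L, hence at least L
        cells behind b even for k = 0.\<close>
      have "x a' $ i \<le> x b $ i + 4 * R * real CARD('d) / of_int (int L - 2)"
        by (rule bump_shift_monotone[OF ab(4) a'(3)]) (use ab a' mono N L R in auto)
      then show ?thesis using a' by (simp add: err_def)
    qed
    show "x a $ i - x b $ i \<le> osc c" using 1 2 by (simp add: osc_def)
  next
    have "(\<Sum>c\<in>grid N. osc c) = (\<Sum>c\<in>grid N. U c - U (c(i := c i - int L))) + (\<Sum>c\<in>(grid N :: ('d \<Rightarrow> int) set). err)"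
      unfolding osc_def by (rule sum.distrib)
    also have "(\<Sum>c\<in>(grid N :: ('d \<Rightarrow> int) set). err) = err * (real N + 1) ^ CARD('d)"
      by (simp add: card_grid add.commute)
    finally show "(\<Sum>c\<in>grid N. osc c) \<le> 2 * R * real L * (real N + 1) ^ (CARD('d) - 1)
        + 4 * R * real CARD('d) / (real L - 2) * (real N + 1) ^ CARD('d)"
      using sum_grid_shift_le[where U = U and N = N and i = i and L = L, OF U_abs] unfolding err_def by linarith
  qed
qed

lemma norm_oscillation:
  fixes x y :: "'i \<Rightarrow> real^'d"
  assumes G: "finite G" and R: "R \<ge> 0" "\<And>a. a \<in> G \<Longrightarrow> norm (x a) \<le> R"
    and mono: "\<And>a b. a \<in> G \<Longrightarrow> b \<in> G \<Longrightarrow> (x a - x b) \<bullet> (y a - y b) \<ge> 0"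
    and N: "N > 0" and L: "L \<ge> (3::nat)"
  obtains osc :: "('d \<Rightarrow> int) \<Rightarrow> real" where "\<And>c. osc c \<ge> 0"
    "\<And>a b c. a \<in> G \<Longrightarrow> b \<in> G \<Longrightarrow> bump N c (y a) > 0 \<Longrightarrow> bump N c (y b) > 0 \<Longrightarrow> norm (x a - x b) \<le> osc c"
    "(\<Sum>c\<in>grid N. osc c) \<le> real CARD('d) * (2 * R * real L * (real N + 1) ^ (CARD('d) - 1)
        + 4 * R * real CARD('d) / (real L - 2) * (real N + 1) ^ CARD('d))"
proof -
  let ?b = "2 * R * real L * (real N + 1) ^ (CARD('d) - 1)
        + 4 * R * real CARD('d) / (real L - 2) * (real N + 1) ^ CARD('d)"
  have "\<forall>i. \<exists>osc :: ('d \<Rightarrow> int) \<Rightarrow> real. (\<forall>c. osc c \<ge> 0) \<and> (\<forall>a\<in>G. \<forall>b\<in>G. \<forall>c. bump N c (y a) > 0 \<longrightarrow>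
      bump N c (y b) > 0 \<longrightarrow> x a $ i - x b $ i \<le> osc c) \<and> (\<Sum>c\<in>grid N. osc c) \<le> ?b"
  proof
    fix i
    show "\<exists>osc :: ('d \<Rightarrow> int) \<Rightarrow> real. (\<forall>c. osc c \<ge> 0) \<and> (\<forall>a\<in>G. \<forall>b\<in>G. \<forall>c. bump N c (y a) > 0 \<longrightarrow>
      bump N c (y b) > 0 \<longrightarrow> x a $ i - x b $ i \<le> osc c) \<and> (\<Sum>c\<in>grid N. osc c) \<le> ?b"
      by (rule coordinate_oscillation[where x = x and y = y and G = G and i = i, OF G R mono N L]) blast+
  qed
  from choice[OF this] obtain osc :: "'d \<Rightarrow> ('d \<Rightarrow> int) \<Rightarrow> real"
    where o: "\<forall>i. (\<forall>c. osc i c \<ge> 0) \<and> (\<forall>a\<in>G. \<forall>b\<in>G. \<forall>c. bump N c (y a) > 0 \<longrightarrow>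
      bump N c (y b) > 0 \<longrightarrow> x a $ i - x b $ i \<le> osc i c) \<and> (\<Sum>c\<in>grid N. osc i c) \<le> ?b"
    by blast
  show thesis
  proof (rule that[of "\<lambda>c. \<Sum>i\<in>UNIV. osc i c"])
    show "0 \<le> (\<Sum>i\<in>UNIV. osc i c)" for c using o by (intro sum_nonneg) auto
    show "norm (x a - x b) \<le> (\<Sum>i\<in>UNIV. osc i c)"
      if "a \<in> G" "b \<in> G" "bump N c (y a) > 0" "bump N c (y b) > 0" for a b c
    proof -
      have "norm (x a - x b) \<le> (\<Sum>i\<in>UNIV. \<bar>(x a - x b) $ i\<bar>)" by (rule norm_le_l1_cart)
      also have "\<dots> \<le> (\<Sum>i\<in>UNIV. osc i c)"
      proof (intro sum_mono)
        fix i
        have "x a $ i - x b $ i \<le> osc i c" "x b $ i - x a $ i \<le> osc i c" using o that by blast+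
        then show "\<bar>(x a - x b) $ i\<bar> \<le> osc i c" by simp
      qed
      finally show ?thesis .
    qed
    have "(\<Sum>c\<in>grid N. \<Sum>i\<in>UNIV. osc i c) = (\<Sum>i\<in>UNIV. \<Sum>c\<in>grid N. osc i c)" by (rule sum.swap)
    also have "\<dots> \<le> (\<Sum>i\<in>(UNIV::'d set). ?b)" using o by (intro sum_mono) auto
    finally show "(\<Sum>c\<in>grid N. \<Sum>i\<in>UNIV. osc i c) \<le> real CARD('d) * ?b" by simp
  qed
qed

section \<open>Comparing two groups through cell averages\<close>

definition avg :: "'i set \<Rightarrow> ('i \<Rightarrow> real) \<Rightarrow> real" where
  "avg A g = (\<Sum>a\<in>A. g a) / real (card A)"

text \<open>Since the tents sum to 1, the error is an average of \<open>f (x a) - fc c\<close> over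
  observations and cells with tent weights. Observations beyond radius R cost at most 2 each, the
  others \<open>k * osc c\<close>. As only the sum of \<open>osc\<close> is controlled later on,
  each cell's share has to be capped by \<open>\<kappa>\<close>.\<close>

lemma avg_cell_approximation:
  fixes x y :: "'i \<Rightarrow> real^'d" and osc fc :: "('d \<Rightarrow> int) \<Rightarrow> real"
  assumes A: "finite A" "\<And>a. a \<in> A \<Longrightarrow> y a \<in> cbox 0 1"
    and f: "\<And>u. \<bar>f u\<bar> \<le> 1" and k: "k \<ge> 0" and osc: "\<And>c. osc c \<ge> 0"
    and fc: "\<And>c. \<bar>fc c\<bar> \<le> 1"
      "\<And>a c. a \<in> A \<Longrightarrow> norm (x a) \<le> R \<Longrightarrow> bump N c (y a) > 0 \<Longrightarrow> \<bar>f (x a) - fc c\<bar> \<le> k * osc c"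
    and \<kappa>: "\<And>c. c \<in> grid N \<Longrightarrow> avg A (\<lambda>a. bump N c (y a)) \<le> \<kappa>"
  shows "\<bar>avg A (\<lambda>a. f (x a)) - (\<Sum>c\<in>grid N. fc c * avg A (\<lambda>a. bump N c (y a)))\<bar>
      \<le> 2 * avg A (\<lambda>a. if norm (x a) \<le> R then 0 else 1) + k * \<kappa> * (\<Sum>c\<in>grid N. osc c)"
proof -
  let ?b = "\<lambda>a. if norm (x a) \<le> R then 0 else 1 :: real"
  have "(\<Sum>a\<in>A. f (x a)) - (\<Sum>c\<in>grid N. fc c * (\<Sum>a\<in>A. bump N c (y a)))
      = (\<Sum>a\<in>A. \<Sum>c\<in>grid N. bump N c (y a) * (f (x a) - fc c))"
  proof -
    have "(\<Sum>a\<in>A. \<Sum>c\<in>grid N. bump N c (y a) * (f (x a) - fc c))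
      = (\<Sum>a\<in>A. (\<Sum>c\<in>grid N. bump N c (y a)) * f (x a)) - (\<Sum>a\<in>A. \<Sum>c\<in>grid N. fc c * bump N c (y a))"
      unfolding sum_distrib_right sum_subtractf[symmetric] by (simp only: algebra_simps)
    also have "(\<Sum>a\<in>A. (\<Sum>c\<in>grid N. bump N c (y a)) * f (x a)) = (\<Sum>a\<in>A. f (x a))"
      using A by (intro sum.cong) (auto simp: sum_bump)
    also have "(\<Sum>a\<in>A. \<Sum>c\<in>grid N. fc c * bump N c (y a)) = (\<Sum>c\<in>grid N. fc c * (\<Sum>a\<in>A. bump N c (y a)))"
      unfolding sum_distrib_left by (rule sum.swap)
    finally show ?thesis by simp
  qed
  also have "\<bar>\<dots>\<bar> \<le> (\<Sum>a\<in>A. \<Sum>c\<in>grid N. bump N c (y a) * (2 * ?b a + k * osc c))"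
  proof (intro order_trans[OF sum_abs] sum_mono)
    fix a c assume a: "a \<in> A"
    have "\<bar>f (x a) - fc c\<bar> \<le> 2 * ?b a + k * osc c" if "bump N c (y a) > 0"
    proof (cases "norm (x a) \<le> R")
      case False
      have "\<bar>f (x a) - fc c\<bar> \<le> 2" using f[of "x a"] fc(1)[of c] by linarith
      moreover have "0 \<le> k * osc c" using k osc by simp
      ultimately show ?thesis using False by simp
    qed (use fc(2)[OF a _ that] in simp)
    then show "\<bar>bump N c (y a) * (f (x a) - fc c)\<bar> \<le> bump N c (y a) * (2 * ?b a + k * osc c)"
      unfolding abs_mult using bump_nonneg[of N c "y a"]
      by (cases "bump N c (y a) = 0") (simp_all add: mult_left_mono del: mult_cancel_left)
  qed
  also have "(\<Sum>a\<in>A. \<Sum>c\<in>grid N. bump N c (y a) * (2 * ?b a + k * osc c))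
     = (\<Sum>a\<in>A. 2 * ?b a) + k * (\<Sum>c\<in>grid N. osc c * (\<Sum>a\<in>A. bump N c (y a)))"
  proof -
    have "(\<Sum>a\<in>A. \<Sum>c\<in>grid N. bump N c (y a) * (2 * ?b a + k * osc c))
      = (\<Sum>a\<in>A. (\<Sum>c\<in>grid N. bump N c (y a)) * (2 * ?b a)) + (\<Sum>a\<in>A. \<Sum>c\<in>grid N. k * (osc c * bump N c (y a)))"
      unfolding sum_distrib_right sum.distrib[symmetric] by (simp only: algebra_simps)
    also have "(\<Sum>a\<in>A. (\<Sum>c\<in>grid N. bump N c (y a)) * (2 * ?b a)) = (\<Sum>a\<in>A. 2 * ?b a)"
      using A by (intro sum.cong) (auto simp: sum_bump)
    also have "(\<Sum>a\<in>A. \<Sum>c\<in>grid N. k * (osc c * bump N c (y a))) = k * (\<Sum>c\<in>grid N. osc c * (\<Sum>a\<in>A. bump N c (y a)))"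
      unfolding sum_distrib_left by (rule sum.swap)
    finally show ?thesis .
  qed
  finally have main: "\<bar>(\<Sum>a\<in>A. f (x a)) - (\<Sum>c\<in>grid N. fc c * (\<Sum>a\<in>A. bump N c (y a)))\<bar>
      \<le> (\<Sum>a\<in>A. 2 * ?b a) + k * (\<Sum>c\<in>grid N. osc c * (\<Sum>a\<in>A. bump N c (y a)))" .
  have "\<bar>avg A (\<lambda>a. f (x a)) - (\<Sum>c\<in>grid N. fc c * avg A (\<lambda>a. bump N c (y a)))\<bar>
     = \<bar>(\<Sum>a\<in>A. f (x a)) - (\<Sum>c\<in>grid N. fc c * (\<Sum>a\<in>A. bump N c (y a)))\<bar> / real (card A)"
    unfolding avg_def by (simp add: diff_divide_distrib[symmetric] sum_divide_distrib[symmetric])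
  also have "\<dots> \<le> ((\<Sum>a\<in>A. 2 * ?b a) + k * (\<Sum>c\<in>grid N. osc c * (\<Sum>a\<in>A. bump N c (y a)))) / real (card A)"
    by (intro divide_right_mono main) simp
  also have "\<dots> = 2 * avg A ?b + k * (\<Sum>c\<in>grid N. osc c * avg A (\<lambda>a. bump N c (y a)))"
    unfolding avg_def by (simp add: add_divide_distrib sum_divide_distrib[symmetric] sum_distrib_left[symmetric])
  also have "\<dots> \<le> 2 * avg A ?b + k * (\<Sum>c\<in>grid N. osc c * \<kappa>)"
    using k osc \<kappa> by (intro add_left_mono mult_left_mono sum_mono) auto
  also have "(\<Sum>c\<in>grid N. osc c * \<kappa>) = \<kappa> * (\<Sum>c\<in>grid N. osc c)"
    by (simp add: sum_distrib_left mult.commute)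
  finally show ?thesis by (simp add: mult.assoc)
qed

text \<open>Multiplied by the cap B / (N + 1)^d, the total oscillation is at most d * B * (2 R L /
  (N + 1) + 4 R d / (L - 2)). The second term is made small by L, then the first by N; neither
  choice depends on the observations.\<close>

lemma exists_grid:
  fixes k R B \<epsilon> :: real
  assumes k: "k \<ge> 0" and R: "R \<ge> 0" and B: "B \<ge> 0" and \<epsilon>: "\<epsilon> > 0"
  obtains N :: nat where "N > 0"
    "\<And>(A :: 'i set) A' (x :: 'i \<Rightarrow> real^'d) y f. finite A \<Longrightarrow> finite A' \<Longrightarrow>
      (\<And>a. a \<in> A \<union> A' \<Longrightarrow> y a \<in> cbox 0 1) \<Longrightarrow>
      (\<And>a b. a \<in> A \<union> A' \<Longrightarrow> b \<in> A \<union> A' \<Longrightarrow> (x a - x b) \<bullet> (y a - y b) \<ge> 0) \<Longrightarrow>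
      (\<And>u. \<bar>f u\<bar> \<le> 1) \<Longrightarrow> (\<And>u v. \<bar>f u - f v\<bar> \<le> k * norm (u - v)) \<Longrightarrow>
      (\<And>c. c \<in> grid N \<Longrightarrow> avg A (\<lambda>a. bump N c (y a)) \<le> B / (real N + 1) ^ CARD('d)) \<Longrightarrow>
      (\<And>c. c \<in> grid N \<Longrightarrow> avg A' (\<lambda>a. bump N c (y a)) \<le> B / (real N + 1) ^ CARD('d)) \<Longrightarrow>
      \<bar>avg A (\<lambda>a. f (x a)) - avg A' (\<lambda>a. f (x a))\<bar> \<le>
        (\<Sum>c\<in>grid N. \<bar>avg A (\<lambda>a. bump N c (y a)) - avg A' (\<lambda>a. bump N c (y a))\<bar>)
        + 2 * avg A (\<lambda>a. if norm (x a) \<le> R then 0 else 1)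
        + 2 * avg A' (\<lambda>a. if norm (x a) \<le> R then 0 else 1) + \<epsilon>"
proof -
  define d where "d = real CARD('d)"
  have d: "d > 0" by (simp add: d_def)
  \<comment> \<open>Lipschitz constant, cap and dimension, with a factor 2 because both groups
    contribute the same error.\<close>
  define D where "D = 2 * k * B * d"
  have D: "D \<ge> 0" using k B d by (simp add: D_def)
  obtain L0 :: nat where L0: "D * (4 * R * d) / (\<epsilon> / 2) < real L0" using reals_Archimedean2 by blast
  \<comment> \<open>The offset 3 secures both L \<ge> 3 and L - 2 > L0.\<close>
  define L where "L = L0 + 3"
  have L: "L \<ge> 3" "D * (4 * R * d / (real L - 2)) \<le> \<epsilon> / 2"
  proof -
    show "L \<ge> 3" by (simp add: L_def)
    have "D * (4 * R * d) < real L0 * (\<epsilon> / 2)" using L0 \<epsilon> by (simp add: field_simps)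
    also have "\<dots> \<le> (real L - 2) * (\<epsilon> / 2)" using \<epsilon> by (intro mult_right_mono) (auto simp: L_def)
    finally show "D * (4 * R * d / (real L - 2)) \<le> \<epsilon> / 2"
      using \<open>L \<ge> 3\<close> by (simp add: field_simps)
  qed
  obtain N0 :: nat where N0: "D * (2 * R * real L) / (\<epsilon> / 2) < real N0" using reals_Archimedean2 by blast
  define N where "N = N0 + 1"
  have N: "N > 0" "D * (2 * R * real L / (real N + 1)) \<le> \<epsilon> / 2"
  proof -
    have "D * (2 * R * real L) < real N0 * (\<epsilon> / 2)" using N0 \<epsilon> by (simp add: field_simps)
    also have "\<dots> \<le> (real N + 1) * (\<epsilon> / 2)" using \<epsilon> by (intro mult_right_mono) (auto simp: N_def)
    finally show "D * (2 * R * real L / (real N + 1)) \<le> \<epsilon> / 2"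
      by (simp add: field_simps)
  qed (simp add: N_def)
  show thesis
  proof (rule that[OF N(1)])
    fix A A' :: "'i set" and x y :: "'i \<Rightarrow> real^'d" and f :: "real^'d \<Rightarrow> real"
    assume A: "finite A" "finite A'" and y: "\<And>a. a \<in> A \<union> A' \<Longrightarrow> y a \<in> cbox 0 1"
      and mono: "\<And>a b. a \<in> A \<union> A' \<Longrightarrow> b \<in> A \<union> A' \<Longrightarrow> (x a - x b) \<bullet> (y a - y b) \<ge> 0"
      and f: "\<And>u. \<bar>f u\<bar> \<le> 1" "\<And>u v. \<bar>f u - f v\<bar> \<le> k * norm (u - v)"
      and \<kappa>: "\<And>c. c \<in> grid N \<Longrightarrow> avg A (\<lambda>a. bump N c (y a)) \<le> B / (real N + 1) ^ CARD('d)"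
        "\<And>c. c \<in> grid N \<Longrightarrow> avg A' (\<lambda>a. bump N c (y a)) \<le> B / (real N + 1) ^ CARD('d)"
    \<comment> \<open>Both groups enter one family: the oscillations and the cell values
      \<open>fc\<close> must be common to them for the two cell sums to be comparable.\<close>
    define G where "G = {a \<in> A \<union> A'. norm (x a) \<le> R}"
    have G: "finite G" "\<And>a. a \<in> G \<Longrightarrow> norm (x a) \<le> R"
      "\<And>a b. a \<in> G \<Longrightarrow> b \<in> G \<Longrightarrow> (x a - x b) \<bullet> (y a - y b) \<ge> 0"
      using A mono by (auto simp: G_def)
    obtain osc :: "('d \<Rightarrow> int) \<Rightarrow> real" where osc: "\<And>c. osc c \<ge> 0"
      "\<And>a b c. a \<in> G \<Longrightarrow> b \<in> G \<Longrightarrow> bump N c (y a) > 0 \<Longrightarrow> bump N c (y b) > 0 \<Longrightarrow> norm (x a - x b) \<le> osc c"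
      "(\<Sum>c\<in>grid N. osc c) \<le> real CARD('d) * (2 * R * real L * (real N + 1) ^ (CARD('d) - 1)
          + 4 * R * real CARD('d) / (real L - 2) * (real N + 1) ^ CARD('d))"
      using norm_oscillation[where x = x and y = y and G = G, OF G(1) R G(2) G(3) N(1) L(1)] by metis
    \<comment> \<open>The value of f at an arbitrary observation of the cell within radius R, with
      default 0 for cells that contain none.\<close>
    define fc where "fc c = (if \<exists>a\<in>G. bump N c (y a) > 0
        then f (x (SOME a. a \<in> G \<and> bump N c (y a) > 0)) else 0)" for c
    have fc1: "\<bar>fc c\<bar> \<le> 1" for c using f(1) by (simp add: fc_def)
    have fc2: "\<bar>f (x a) - fc c\<bar> \<le> k * osc c" if a: "a \<in> A \<union> A'" "norm (x a) \<le> R" "bump N c (y a) > 0" for a c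
    proof -
      have aG: "a \<in> G" using a by (simp add: G_def)
      define b where "b = (SOME a. a \<in> G \<and> bump N c (y a) > 0)"
      have b: "b \<in> G \<and> bump N c (y b) > 0" unfolding b_def by (rule someI[of _ a]) (use a aG in simp)
      have "fc c = f (x b)" using a aG by (auto simp: fc_def b_def)
      then have "\<bar>f (x a) - fc c\<bar> \<le> k * norm (x a - x b)" using f(2) by simp
      also have "\<dots> \<le> k * osc c" using osc(2)[OF aG] b a k by (intro mult_left_mono) auto
      finally show ?thesis .
    qed
    define m where "m = (real N + 1) ^ CARD('d)"
    define S where "S = k * (B / m) * (\<Sum>c\<in>grid N. osc c)"
    have m: "m > 0" by (simp add: m_def)
    have S: "2 * S \<le> \<epsilon>"
    proof -
      have pow: "(real N + 1) ^ (CARD('d) - 1) = m / (real N + 1)"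
        unfolding m_def by (simp add: power_diff)
      have "2 * S \<le> 2 * (k * (B / m) * (d * (2 * R * real L * (m / (real N + 1)) + 4 * R * d / (real L - 2) * m)))"
        unfolding S_def using osc(3) k B m unfolding d_def[symmetric] pow m_def[symmetric]
        by (intro mult_left_mono) auto
      also have "\<dots> = D * (2 * R * real L / (real N + 1)) + D * (4 * R * d / (real L - 2))"
        using m unfolding D_def by (simp add: distrib_left)
      also have "\<dots> \<le> \<epsilon>" using N L by linarith
      finally show ?thesis .
    qed
    define Q where "Q A = (\<Sum>c\<in>grid N. fc c * avg A (\<lambda>a. bump N c (y a)))" for A
    have 1: "\<bar>avg A (\<lambda>a. f (x a)) - Q A\<bar> \<le> 2 * avg A (\<lambda>a. if norm (x a) \<le> R then 0 else 1) + S"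
      unfolding Q_def S_def
      by (rule avg_cell_approximation) (use A y f k osc fc1 fc2 \<kappa> in \<open>auto simp: m_def\<close>)
    have 2: "\<bar>avg A' (\<lambda>a. f (x a)) - Q A'\<bar> \<le> 2 * avg A' (\<lambda>a. if norm (x a) \<le> R then 0 else 1) + S"
      unfolding Q_def S_def
      by (rule avg_cell_approximation) (use A y f k osc fc1 fc2 \<kappa> in \<open>auto simp: m_def\<close>)
    have 3: "\<bar>Q A - Q A'\<bar> \<le> (\<Sum>c\<in>grid N. \<bar>avg A (\<lambda>a. bump N c (y a)) - avg A' (\<lambda>a. bump N c (y a))\<bar>)"
    proof -
      have "Q A - Q A' = (\<Sum>c\<in>grid N. fc c * (avg A (\<lambda>a. bump N c (y a)) - avg A' (\<lambda>a. bump N c (y a))))"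
        by (simp add: Q_def sum_subtractf right_diff_distrib)
      also have "\<bar>\<dots>\<bar> \<le> (\<Sum>c\<in>grid N. \<bar>fc c * (avg A (\<lambda>a. bump N c (y a)) - avg A' (\<lambda>a. bump N c (y a)))\<bar>)"
        by (rule sum_abs)
      also have "\<dots> \<le> (\<Sum>c\<in>grid N. \<bar>avg A (\<lambda>a. bump N c (y a)) - avg A' (\<lambda>a. bump N c (y a))\<bar>)"
        unfolding abs_mult using fc1 by (intro sum_mono mult_left_le_one_le) auto
      finally show ?thesis .
    qed
    show "\<bar>avg A (\<lambda>a. f (x a)) - avg A' (\<lambda>a. f (x a))\<bar> \<le>
        (\<Sum>c\<in>grid N. \<bar>avg A (\<lambda>a. bump N c (y a)) - avg A' (\<lambda>a. bump N c (y a))\<bar>)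
        + 2 * avg A (\<lambda>a. if norm (x a) \<le> R then 0 else 1)
        + 2 * avg A' (\<lambda>a. if norm (x a) \<le> R then 0 else 1) + \<epsilon>"
      using 1 2 3 S by linarith
  qed
qed

section \<open>The optimal assignment of an exchangeable sample is uniform\<close>

definition assign_cost :: "nat \<Rightarrow> (nat \<Rightarrow> real^'d) \<Rightarrow> (nat \<Rightarrow> real^'d) \<Rightarrow> (nat \<Rightarrow> nat) \<Rightarrow> real" where
  "assign_cost n W h \<sigma> = (\<Sum>i=1..n. (norm (W i - h (\<sigma> i)))\<^sup>2)"

abbreviation perms :: "nat \<Rightarrow> (nat \<Rightarrow> nat) set" where
  "perms n \<equiv> {\<sigma>. \<sigma> permutes {1..n}}"

lemma finite_perms: "finite (perms n)"
  by (simp add: finite_permutations)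

lemma perms_ne: "perms n \<noteq> {}"
  using permutes_id by blast

lemma opt_assignment_permutes: "opt_assignment n W h permutes {1..n}"
  and opt_assignment_le: "\<sigma> permutes {1..n} \<Longrightarrow> assign_cost n W h (opt_assignment n W h) \<le> assign_cost n W h \<sigma>"
  using opt_assignment_is_arg_min[where n = n and W = W and h = h]
  by (auto simp: is_arg_min_def assign_cost_def not_less)

text \<open>Exchanging the two targets cannot lower the cost. All squared norms cancel in this
  comparison, and the inner product is what remains.\<close>

lemma empirical_rank_monotone:
  assumes ab: "a \<in> {1..n}" "b \<in> {1..n}"
  shows "(W a - W b) \<bullet> (empirical_rank n W h a - empirical_rank n W h b) \<ge> 0"
proof (cases "a = b")
  case False
  define \<sigma> where "\<sigma> = opt_assignment n W h"
  define \<tau> where "\<tau> = \<sigma> \<circ> Transposition.transpose a b"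
  have "\<tau> permutes {1..n}"
    unfolding \<tau>_def \<sigma>_def using ab
    by (intro permutes_compose permutes_swap_id opt_assignment_permutes) auto
  then have le: "assign_cost n W h \<sigma> \<le> assign_cost n W h \<tau>"
    unfolding \<sigma>_def by (rule opt_assignment_le)
  have split: "sum g {1..n} = g a + (g b + sum g ({1..n} - {a} - {b}))" for g :: "nat \<Rightarrow> real"
    using ab False sum.remove[of "{1..n}" a g] sum.remove[of "{1..n} - {a}" b g] by simp
  have rest: "(\<Sum>i\<in>{1..n} - {a} - {b}. (norm (W i - h (\<tau> i)))\<^sup>2) = (\<Sum>i\<in>{1..n} - {a} - {b}. (norm (W i - h (\<sigma> i)))\<^sup>2)"
    by (intro sum.cong) (auto simp: \<tau>_def Transposition.transpose_def)
  have "\<tau> a = \<sigma> b" "\<tau> b = \<sigma> a" by (simp_all add: \<tau>_def)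
  then have "(norm (W a - h (\<sigma> a)))\<^sup>2 + (norm (W b - h (\<sigma> b)))\<^sup>2
      \<le> (norm (W a - h (\<sigma> b)))\<^sup>2 + (norm (W b - h (\<sigma> a)))\<^sup>2"
    using le rest unfolding assign_cost_def split by simp
  then show ?thesis
    unfolding empirical_rank_def \<sigma>_def[symmetric] power2_norm_eq_inner
    by (simp add: inner_diff_left inner_diff_right inner_commute)
qed simp

lemma assign_cost_cong:
  "(\<And>i. i \<in> {1..n} \<Longrightarrow> W i = W' i) \<Longrightarrow> assign_cost n W h \<sigma> = assign_cost n W' h \<sigma>"
  unfolding assign_cost_def by (intro sum.cong) auto

text \<open>The choice of \<open>opt_assignment\<close> is a function of the finite set of minimisers, so it is measurable
  even where the minimiser is not unique.\<close>

lemma opt_assignment_eq_SOME: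
  "opt_assignment n W h = (SOME \<sigma>. \<sigma> \<in> {\<sigma> \<in> perms n. \<forall>\<tau>\<in>perms n. assign_cost n W h \<sigma> \<le> assign_cost n W h \<tau>})"
  unfolding opt_assignment_def is_arg_min_def assign_cost_def
  by (rule arg_cong[where f = Eps]) (auto simp: not_less)

lemma Collect_eq_iff: "T \<subseteq> A \<Longrightarrow> {x \<in> A. P x} = T \<longleftrightarrow> (\<forall>x\<in>A. (x \<in> T) = P x)"
  by blast

lemma measurable_opt_assignment:
  assumes W: "\<And>i. i \<in> {1..n} \<Longrightarrow> W i \<in> borel_measurable M"
  shows "(\<lambda>\<omega>. opt_assignment n (\<lambda>i. W i \<omega>) h) \<in> measurable M (count_space (perms n))"
proof -
  define Am where "Am \<omega> = {\<sigma> \<in> perms n. \<forall>\<tau>\<in>perms n. assign_cost n (\<lambda>i. W i \<omega>) h \<sigma> \<le> assign_cost n (\<lambda>i. W i \<omega>) h \<tau>}" for \<omega>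
  have cost: "(\<lambda>\<omega>. assign_cost n (\<lambda>i. W i \<omega>) h \<sigma>) \<in> borel_measurable M" for \<sigma>
    unfolding assign_cost_def using W
    by (intro borel_measurable_sum borel_measurable_power borel_measurable_norm borel_measurable_diff) auto
  have "Am \<in> measurable M (count_space (Pow (perms n)))"
    unfolding measurable_count_space_eq2[OF finite_Pow_iff[THEN iffD2, OF finite_perms]]
  proof (intro conjI ballI)
    show "Am \<in> space M \<rightarrow> Pow (perms n)" by (auto simp: Am_def)
    fix T assume T: "T \<in> Pow (perms n)"
    \<comment> \<open>Fixing the set of minimisers amounts to finitely many comparisons of
      measurable costs.\<close>
    have "(Am \<omega> = T) \<longleftrightarrow> (\<forall>\<sigma>\<in>perms n. (\<sigma> \<in> T) = (\<forall>\<tau>\<in>perms n.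
        assign_cost n (\<lambda>i. W i \<omega>) h \<sigma> \<le> assign_cost n (\<lambda>i. W i \<omega>) h \<tau>))" for \<omega>
      unfolding Am_def by (rule Collect_eq_iff) (use T in simp)
    then have "Am -` {T} \<inter> space M = {\<omega>\<in>space M. \<forall>\<sigma>\<in>perms n. (\<sigma> \<in> T) = (\<forall>\<tau>\<in>perms n.
        assign_cost n (\<lambda>i. W i \<omega>) h \<sigma> \<le> assign_cost n (\<lambda>i. W i \<omega>) h \<tau>)}"
      unfolding vimage_def singleton_iff Int_def mem_Collect_eq by (simp only: conj_commute)
    also have "\<dots> \<in> sets M"
    proof (rule sets.sets_Collect_finite_All[OF _ finite_perms])
      fix \<sigma>
      have "{\<omega>\<in>space M. \<forall>\<tau>\<in>perms n. assign_cost n (\<lambda>i. W i \<omega>) h \<sigma> \<le> assign_cost n (\<lambda>i. W i \<omega>) h \<tau>} \<in> sets M"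
        by (rule sets.sets_Collect_finite_All[OF borel_measurable_le[OF cost cost] finite_perms])
      from this sets.sets_Collect_neg[OF this]
      show "{\<omega>\<in>space M. (\<sigma> \<in> T) = (\<forall>\<tau>\<in>perms n. assign_cost n (\<lambda>i. W i \<omega>) h \<sigma> \<le> assign_cost n (\<lambda>i. W i \<omega>) h \<tau>)} \<in> sets M"
        by (cases "\<sigma> \<in> T") (simp_all only: simp_thms)
    qed
    finally show "Am -` {T} \<inter> space M \<in> sets M" .
  qed
  moreover have "(\<lambda>T. SOME \<sigma>. \<sigma> \<in> T) \<in> measurable (count_space (Pow (perms n))) (count_space UNIV)"
    by simp
  ultimately have "(\<lambda>\<omega>. SOME \<sigma>. \<sigma> \<in> Am \<omega>) \<in> measurable M (count_space UNIV)"
    by (rule measurable_compose)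
  moreover have "(SOME \<sigma>. \<sigma> \<in> Am \<omega>) = opt_assignment n (\<lambda>i. W i \<omega>) h" for \<omega>
    unfolding Am_def by (rule opt_assignment_eq_SOME[symmetric])
  ultimately have opt: "(\<lambda>\<omega>. opt_assignment n (\<lambda>i. W i \<omega>) h) \<in> measurable M (count_space UNIV)"
    by simp
  show ?thesis
    unfolding measurable_count_space_eq2[OF finite_perms]
    using opt_assignment_permutes measurable_sets[OF opt] by auto
qed

section \<open>Ties have probability zero\<close>

text \<open>The singleton blocks \<open>{g j}\<close> are disjoint because \<open>g\<close> is
  injective, so independence of blocks applies; each block is then evaluated at its only
  index.\<close>

lemma (in prob_space) indep_vars_reindex:
  assumes "indep_vars (\<lambda>_. N) X I" "inj_on g J" "g ` J \<subseteq> I"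
  shows "indep_vars (\<lambda>_. N) (\<lambda>j. X (g j)) J"
proof -
  have "indep_vars (\<lambda>j. PiM {g j} (\<lambda>_. N)) (\<lambda>j \<omega>. restrict (\<lambda>i. X i \<omega>) {g j}) J"
    using assms by (intro indep_vars_restrict[OF assms(1)]) (auto simp: disjoint_family_on_def inj_on_def)
  from indep_vars_compose2[OF this, of "\<lambda>j f. f (g j)" "\<lambda>_. N"] show ?thesis by simp
qed

text \<open>By Fubini: for each value z of \<open>Z\<close>, the variable \<open>X\<close> would
  have to hit the single point c - z, which has mass zero.\<close>

lemma (in prob_space) AE_indep_sum_neq:
  fixes X Z :: "'a \<Rightarrow> real"
  assumes ind: "indep_var borel X borel Z" and atom: "\<And>z. emeasure (distr M borel X) {z} = 0"
  shows "AE \<omega> in M. X \<omega> + Z \<omega> \<noteq> c"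
proof -
  have [measurable]: "X \<in> borel_measurable M" "Z \<in> borel_measurable M"
    and eq: "distr M borel X \<Otimes>\<^sub>M distr M borel Z = distr M (borel \<Otimes>\<^sub>M borel) (\<lambda>\<omega>. (X \<omega>, Z \<omega>))"
    using ind unfolding indep_var_distribution_eq by auto
  interpret X: prob_space "distr M borel X" by (rule prob_space_distr) simp
  interpret Z: prob_space "distr M borel Z" by (rule prob_space_distr) simp
  interpret pair_sigma_finite "distr M borel X" "distr M borel Z" ..
  let ?A = "{p :: real \<times> real. fst p + snd p = c}"
  have A: "?A \<in> sets (borel \<Otimes>\<^sub>M borel)"
  proof -
    have "{p \<in> space (borel \<Otimes>\<^sub>M borel). fst p + snd p = c} \<in> sets (borel \<Otimes>\<^sub>M (borel :: real measure))"
      by measurable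
    then show ?thesis by (simp add: space_pair_measure)
  qed
  have A': "?A \<in> sets (distr M borel X \<Otimes>\<^sub>M distr M borel Z)"
    using A by (simp cong: sets_pair_measure_cong)
  have "emeasure M {\<omega>\<in>space M. X \<omega> + Z \<omega> = c} = emeasure (distr M (borel \<Otimes>\<^sub>M borel) (\<lambda>\<omega>. (X \<omega>, Z \<omega>))) ?A"
    using A by (subst emeasure_distr) (auto intro!: arg_cong[where f = "emeasure M"])
  also have "\<dots> = (\<integral>\<^sup>+z. emeasure (distr M borel X) ((\<lambda>x. (x, z)) -` ?A) \<partial>distr M borel Z)"
    unfolding eq[symmetric] by (rule emeasure_pair_measure_alt2[OF A'])
  also have "\<dots> = (\<integral>\<^sup>+z. emeasure (distr M borel X) {c - z} \<partial>distr M borel Z)"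
    by (intro nn_integral_cong arg_cong[where f = "emeasure _"]) auto
  also have "\<dots> = 0" using atom by simp
  finally have "emeasure M {\<omega>\<in>space M. X \<omega> + Z \<omega> = c} = 0" .
  then show ?thesis by (subst AE_iff_measurable[OF _ refl]) auto
qed

lemma abs_cont_law_hyperplane:
  fixes \<mu> :: "(real^'d) measure"
  assumes "abs_cont_law \<mu>" "v \<noteq> 0"
  shows "emeasure \<mu> {x. x \<bullet> v = z} = 0"
proof -
  have m: "{x. x \<bullet> v = z} \<in> sets (lborel :: (real^'d) measure)"
    by measurable
  have "negligible {x. v \<bullet> x = z}" using assms(2) by (intro negligible_hyperplane) simp
  then have "{x. x \<bullet> v = z} \<in> null_sets lebesgue"
    by (simp add: negligible_iff_null_sets inner_commute)
  then have "{x. x \<bullet> v = z} \<in> null_sets lborel"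
    using m by (simp add: null_sets_completion_iff)
  then show ?thesis
    using assms(1) unfolding abs_cont_law_def absolutely_continuous_def by auto
qed

text \<open>The squared norms of the observations cancel, so the difference of two costs is affine
  in the sample, with coefficients proportional to \<open>v j\<close>. Injectivity of
  \<open>h\<close> makes some \<open>v i\<close> nonzero; then
  \<open>W i \<omega> \<bullet> v i\<close> has no atoms and is independent of the other
  terms.\<close>

lemma (in prob_space) AE_assign_cost_neq:
  fixes W :: "nat \<Rightarrow> 'a \<Rightarrow> real^'d"
  assumes ind: "indep_vars (\<lambda>_. borel) W {1..n}"
    and law: "\<And>i. i \<in> {1..n} \<Longrightarrow> abs_cont_law (distr M borel (W i))"
    and h: "inj_on h {1..n}"
    and perm: "\<sigma> permutes {1..n}" "\<tau> permutes {1..n}" "\<sigma> \<noteq> \<tau>"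
  shows "AE \<omega> in M. assign_cost n (\<lambda>i. W i \<omega>) h \<sigma> \<noteq> assign_cost n (\<lambda>i. W i \<omega>) h \<tau>"
proof -
  obtain i where i: "\<sigma> i \<noteq> \<tau> i" using perm(3) by blast
  have iI: "i \<in> {1..n}" using i perm by (metis permutes_not_in)
  have W[measurable]: "W j \<in> borel_measurable M" if "j \<in> {1..n}" for j
    using ind that unfolding indep_vars_def by blast
  define v where "v j = h (\<tau> j) - h (\<sigma> j)" for j
  have "\<sigma> i \<in> {1..n}" "\<tau> i \<in> {1..n}"
    using permutes_in_image[OF perm(1), of i] permutes_in_image[OF perm(2), of i] iI by auto
  then have vi: "v i \<noteq> 0"
    using i h unfolding v_def by (auto dest: inj_onD)
  define V where "V j \<omega> = W j \<omega> \<bullet> v j" for j \<omega>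
  have indV: "indep_vars (\<lambda>_. borel) V {1..n}"
    unfolding V_def by (rule indep_vars_compose2[OF ind, of "\<lambda>j x. x \<bullet> v j"]) measurable
  have ins: "{1..n} = insert i ({1..n} - {i})" using iI by auto
  have iv: "indep_var borel (V i) borel (\<lambda>\<omega>. \<Sum>j\<in>{1..n} - {i}. V j \<omega>)"
    by (rule indep_vars_sum) (use indV ins in auto)
  \<comment> \<open>Twice the value that the linear part takes in a tie.\<close>
  define c where "c = (\<Sum>j=1..n. (h (\<tau> j) \<bullet> h (\<tau> j) - h (\<sigma> j) \<bullet> h (\<sigma> j)))"
  have AE_neq: "AE \<omega> in M. V i \<omega> + (\<Sum>j\<in>{1..n} - {i}. V j \<omega>) \<noteq> c / 2"
  proof (rule AE_indep_sum_neq[OF iv])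
    fix z
    have "emeasure (distr M borel (V i)) {z} = emeasure (distr M borel (W i)) {x. x \<bullet> v i = z}"
      using W[OF iI] iI unfolding V_def
      by (subst (1 2) emeasure_distr) (auto intro!: arg_cong[where f = "emeasure M"])
    also have "\<dots> = 0" using abs_cont_law_hyperplane[OF law[OF iI] vi] .
    finally show "emeasure (distr M borel (V i)) {z} = 0" .
  qed
  have eq: "assign_cost n (\<lambda>i. W i \<omega>) h \<sigma> - assign_cost n (\<lambda>i. W i \<omega>) h \<tau>
      = 2 * (V i \<omega> + (\<Sum>j\<in>{1..n} - {i}. V j \<omega>)) - c" for \<omega>
  proof -
    have "V i \<omega> + (\<Sum>j\<in>{1..n} - {i}. V j \<omega>) = (\<Sum>j=1..n. V j \<omega>)"
      using iI by (subst sum.remove[of "{1..n}" i]) auto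
    moreover have "(norm (W j \<omega> - h (\<sigma> j)))\<^sup>2 - (norm (W j \<omega> - h (\<tau> j)))\<^sup>2
        = 2 * V j \<omega> - (h (\<tau> j) \<bullet> h (\<tau> j) - h (\<sigma> j) \<bullet> h (\<sigma> j))" for j
      by (simp add: V_def v_def power2_norm_eq_inner inner_diff_left inner_diff_right inner_commute)
    ultimately show ?thesis
      unfolding assign_cost_def c_def sum_subtractf[symmetric]
      by (simp only: sum_subtractf sum_distrib_left[symmetric])
  qed
  have "assign_cost n (\<lambda>i. W i \<omega>) h \<sigma> \<noteq> assign_cost n (\<lambda>i. W i \<omega>) h \<tau>"
    if "V i \<omega> + (\<Sum>j\<in>{1..n} - {i}. V j \<omega>) \<noteq> c / 2" for \<omega>
    using eq[of \<omega>] that by auto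
  with AE_neq show ?thesis by (auto elim: eventually_mono)
qed

section \<open>Uniformity of the optimal assignment\<close>

text \<open>Strict minimality is used in place of the value of \<open>opt_assignment\<close>: the
  choice made in a tie need not respect relabelling of the sample, strict minimality does.\<close>

definition strict_min :: "nat \<Rightarrow> (nat \<Rightarrow> real^'d) \<Rightarrow> (nat \<Rightarrow> nat) \<Rightarrow> (nat \<Rightarrow> real^'d) set" where
  "strict_min n h \<tau> = {w \<in> space (PiM {1..n} (\<lambda>_. borel)). \<forall>\<sigma>\<in>perms n - {\<tau>}. assign_cost n w h \<tau> < assign_cost n w h \<sigma>}"

lemma sets_strict_min: "strict_min n h \<tau> \<in> sets (PiM {1..n} (\<lambda>_. borel))"
proof -
  have cost: "(\<lambda>w. assign_cost n w h \<sigma>) \<in> borel_measurable (PiM {1..n} (\<lambda>_. borel))" for \<sigma>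
    unfolding assign_cost_def by (intro borel_measurable_sum) measurable
  show ?thesis unfolding strict_min_def
    using finite_perms cost by (intro sets.sets_Collect_finite_All borel_measurable_less) auto
qed

lemma opt_assignment_strict_min:
  assumes "restrict W {1..n} \<in> strict_min n h \<tau>" "\<tau> permutes {1..n}"
  shows "opt_assignment n W h = \<tau>"
proof (rule ccontr)
  assume "opt_assignment n W h \<noteq> \<tau>"
  then have "assign_cost n (restrict W {1..n}) h \<tau> < assign_cost n (restrict W {1..n}) h (opt_assignment n W h)"
    using assms opt_assignment_permutes unfolding strict_min_def by blast
  also have "\<dots> = assign_cost n W h (opt_assignment n W h)" by (intro assign_cost_cong) auto
  also have "\<dots> \<le> assign_cost n W h \<tau>" by (rule opt_assignment_le[OF assms(2)])
  also have "\<dots> = assign_cost n (restrict W {1..n}) h \<tau>" by (intro assign_cost_cong) auto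
  finally show False by simp
qed

lemma assign_cost_compose:
  assumes "\<pi> permutes {1..n}"
  shows "assign_cost n (\<lambda>i. W (\<pi> i)) h (\<sigma> \<circ> \<pi>) = assign_cost n W h \<sigma>"
proof -
  have "assign_cost n W h \<sigma> = (\<Sum>i\<in>{1..n}. (\<lambda>j. (norm (W j - h (\<sigma> j)))\<^sup>2) (\<pi> i))"
    unfolding assign_cost_def using sum.permute[OF assms, of "\<lambda>j. (norm (W j - h (\<sigma> j)))\<^sup>2"] by (simp add: o_def)
  then show ?thesis by (simp add: assign_cost_def)
qed

text \<open>Composing the sample with \<open>\<tau>\<close> turns "\<open>\<tau>\<close> is the strict minimiser" into "the identity is the
  strict minimiser"; exchangeability then makes all permutations equally likely.\<close>

lemma strict_min_compose:
  assumes \<tau>: "\<tau> permutes {1..n}"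
  shows "restrict (\<lambda>i. W (\<tau> i)) {1..n} \<in> strict_min n h \<tau> \<longleftrightarrow> restrict W {1..n} \<in> strict_min n h id"
proof -
  have r: "assign_cost n (restrict V {1..n}) h \<sigma> = assign_cost n V h \<sigma>" for V \<sigma>
    by (intro assign_cost_cong) auto
  have img: "perms n - {\<tau>} = (\<lambda>\<sigma>. \<sigma> \<circ> \<tau>) ` (perms n - {id})"
  proof (intro equalityI subsetI)
    fix \<sigma> assume s: "\<sigma> \<in> perms n - {\<tau>}"
    have eq: "\<sigma> = (\<sigma> \<circ> inv \<tau>) \<circ> \<tau>" using \<tau> by (simp add: comp_assoc permutes_inv_o)
    have "\<sigma> \<circ> inv \<tau> \<noteq> id" using eq s by auto
    moreover have "\<sigma> \<circ> inv \<tau> permutes {1..n}" using s \<tau> by (auto intro!: permutes_compose permutes_inv)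
    ultimately show "\<sigma> \<in> (\<lambda>\<sigma>. \<sigma> \<circ> \<tau>) ` (perms n - {id})" using eq by blast
  next
    fix \<sigma> assume "\<sigma> \<in> (\<lambda>\<sigma>. \<sigma> \<circ> \<tau>) ` (perms n - {id})"
    then obtain \<rho> where \<rho>: "\<rho> permutes {1..n}" "\<rho> \<noteq> id" "\<sigma> = \<rho> \<circ> \<tau>" by auto
    have "\<sigma> \<noteq> \<tau>"
    proof
      assume "\<sigma> = \<tau>"
      then have "\<rho> \<circ> \<tau> \<circ> inv \<tau> = \<tau> \<circ> inv \<tau>" using \<rho> by simp
      then show False using \<rho> \<tau> by (simp add: comp_assoc permutes_inv_o)
    qed
    then show "\<sigma> \<in> perms n - {\<tau>}" using \<rho> \<tau> by (auto intro: permutes_compose)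
  qed
  have "restrict (\<lambda>i. W (\<tau> i)) {1..n} \<in> strict_min n h \<tau> \<longleftrightarrow>
      (\<forall>\<sigma>\<in>perms n - {\<tau>}. assign_cost n (\<lambda>i. W (\<tau> i)) h (id \<circ> \<tau>) < assign_cost n (\<lambda>i. W (\<tau> i)) h \<sigma>)"
    unfolding strict_min_def mem_Collect_eq r by (simp add: space_PiM)
  also have "\<dots> \<longleftrightarrow> (\<forall>\<sigma>\<in>perms n - {id}. assign_cost n (\<lambda>i. W (\<tau> i)) h (id \<circ> \<tau>) < assign_cost n (\<lambda>i. W (\<tau> i)) h (\<sigma> \<circ> \<tau>))"
    unfolding img by blast
  also have "\<dots> \<longleftrightarrow> (\<forall>\<sigma>\<in>perms n - {id}. assign_cost n W h id < assign_cost n W h \<sigma>)"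
    unfolding assign_cost_compose[OF \<tau>] ..
  also have "\<dots> \<longleftrightarrow> restrict W {1..n} \<in> strict_min n h id"
    unfolding strict_min_def mem_Collect_eq r by (simp add: space_PiM)
  finally show ?thesis .
qed

lemma (in prob_space) exchangeable:
  fixes W :: "nat \<Rightarrow> 'a \<Rightarrow> real^'d"
  assumes ind: "indep_vars (\<lambda>_. borel) W {1..n}" and n: "n \<ge> 1"
    and law: "\<And>i. i \<in> {1..n} \<Longrightarrow> distr M borel (W i) = \<mu>"
    and \<pi>: "\<pi> permutes {1..n}"
  shows "distr M (PiM {1..n} (\<lambda>_. borel)) (\<lambda>\<omega>. restrict (\<lambda>i. W (\<pi> i) \<omega>) {1..n}) =
     distr M (PiM {1..n} (\<lambda>_. borel)) (\<lambda>\<omega>. restrict (\<lambda>i. W i \<omega>) {1..n})"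
proof -
  have W: "W j \<in> borel_measurable M" if "j \<in> {1..n}" for j
    using ind that unfolding indep_vars_def by blast
  have \<pi>I: "\<pi> i \<in> {1..n}" if "i \<in> {1..n}" for i using permutes_in_image[OF \<pi>] that by blast
  have ne: "{1..n} \<noteq> {}" using n by auto
  have ind': "indep_vars (\<lambda>_. borel) (\<lambda>i. W (\<pi> i)) {1..n}"
    by (rule indep_vars_reindex[OF ind]) (use \<pi> \<pi>I in \<open>auto simp: permutes_inj_on\<close>)
  have "distr M (PiM {1..n} (\<lambda>_. borel)) (\<lambda>\<omega>. restrict (\<lambda>i. W (\<pi> i) \<omega>) {1..n})
      = PiM {1..n} (\<lambda>i. distr M borel (W (\<pi> i)))"
    using ind' by (subst (asm) indep_vars_iff_distr_eq_PiM'[OF ne]) (use W \<pi>I in auto)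
  also have "\<dots> = PiM {1..n} (\<lambda>i. distr M borel (W i))"
    by (intro PiM_cong refl) (use law \<pi>I in metis)
  also have "\<dots> = distr M (PiM {1..n} (\<lambda>_. borel)) (\<lambda>\<omega>. restrict (\<lambda>i. W i \<omega>) {1..n})"
    using ind by (subst (asm) indep_vars_iff_distr_eq_PiM'[OF ne]) (use W in auto)
  finally show ?thesis .
qed

theorem (in prob_space) opt_assignment_uniform:
  fixes W :: "nat \<Rightarrow> 'a \<Rightarrow> real^'d"
  assumes ind: "indep_vars (\<lambda>_. borel) W {1..n}" and n: "n \<ge> 1"
    and law: "\<And>i. i \<in> {1..n} \<Longrightarrow> distr M borel (W i) = \<mu>" and ac: "abs_cont_law \<mu>"
    and h: "inj_on h {1..n}"
  shows "distr M (count_space (perms n)) (\<lambda>\<omega>. opt_assignment n (\<lambda>i. W i \<omega>) h) = uniform_count_measure (perms n)"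
proof -
  have W: "W j \<in> borel_measurable M" if "j \<in> {1..n}" for j
    using ind that unfolding indep_vars_def by blast
  let ?opt = "\<lambda>\<omega>. opt_assignment n (\<lambda>i. W i \<omega>) h"
  let ?P = "PiM {1..n} (\<lambda>_. borel) :: (nat \<Rightarrow> real^'d) measure"
  have opt: "?opt \<in> measurable M (count_space (perms n))"
    by (rule measurable_opt_assignment[OF W])
  let ?R = "\<lambda>\<pi> \<omega>. restrict (\<lambda>i. W (\<pi> i) \<omega>) {1..n}"
  have R: "?R \<pi> \<in> measurable M ?P" if "\<pi> permutes {1..n}" for \<pi>
    using W permutes_in_image[OF that] by (intro measurable_restrict) auto
  have idp: "id permutes {1..n}" by (rule permutes_id)
  define E where "E \<tau> = ?R id -` strict_min n h \<tau> \<inter> space M" for \<tau>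
  have E: "E \<tau> \<in> events" for \<tau>
    unfolding E_def by (rule measurable_sets[OF R[OF idp] sets_strict_min])
  have pE: "emeasure M (E \<tau>) = emeasure M (E id)" if \<tau>: "\<tau> permutes {1..n}" for \<tau>
  proof -
    have "emeasure M (E \<tau>) = emeasure (distr M ?P (?R id)) (strict_min n h \<tau>)"
      unfolding E_def by (rule emeasure_distr[OF R[OF idp] sets_strict_min, symmetric])
    also have "\<dots> = emeasure (distr M ?P (?R \<tau>)) (strict_min n h \<tau>)"
      using exchangeable[OF ind n law \<tau>] by simp
    also have "\<dots> = emeasure M (?R \<tau> -` strict_min n h \<tau> \<inter> space M)"
      by (rule emeasure_distr[OF R[OF \<tau>] sets_strict_min])
    also have "?R \<tau> -` strict_min n h \<tau> \<inter> space M = E id"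
      unfolding E_def using strict_min_compose[OF \<tau>, of "\<lambda>i. W i _" h] by auto
    finally show ?thesis .
  qed
  have AE_E: "AE \<omega> in M. \<exists>\<tau>\<in>perms n. \<omega> \<in> E \<tau>"
  proof -
    have "AE \<omega> in M. \<forall>\<sigma>\<in>perms n. \<forall>\<tau>\<in>perms n - {\<sigma>}.
        assign_cost n (\<lambda>i. W i \<omega>) h \<sigma> \<noteq> assign_cost n (\<lambda>i. W i \<omega>) h \<tau>"
    proof (intro AE_finite_allI)
      fix \<sigma> \<tau> assume "\<sigma> \<in> perms n" "\<tau> \<in> perms n - {\<sigma>}"
      then show "AE \<omega> in M. assign_cost n (\<lambda>i. W i \<omega>) h \<sigma> \<noteq> assign_cost n (\<lambda>i. W i \<omega>) h \<tau>"
        by (intro AE_assign_cost_neq[OF ind _ h]) (use law ac in auto)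
    qed (use finite_perms in auto)
    then show ?thesis
    proof (rule AE_mp, intro AE_I2 impI)
      fix \<omega> assume \<omega>: "\<omega> \<in> space M" and ne: "\<forall>\<sigma>\<in>perms n. \<forall>\<tau>\<in>perms n - {\<sigma>}.
        assign_cost n (\<lambda>i. W i \<omega>) h \<sigma> \<noteq> assign_cost n (\<lambda>i. W i \<omega>) h \<tau>"
      have p: "?opt \<omega> permutes {1..n}" by (rule opt_assignment_permutes)
      have r: "assign_cost n (?R id \<omega>) h \<sigma> = assign_cost n (\<lambda>i. W i \<omega>) h \<sigma>" for \<sigma>
        by (intro assign_cost_cong) auto
      have "assign_cost n (\<lambda>i. W i \<omega>) h (?opt \<omega>) < assign_cost n (\<lambda>i. W i \<omega>) h \<sigma>"
        if "\<sigma> \<in> perms n - {?opt \<omega>}" for \<sigma>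
        using that opt_assignment_le[of \<sigma> n "\<lambda>i. W i \<omega>" h] ne p by (fastforce simp: order_le_less)
      then have "?R id \<omega> \<in> strict_min n h (?opt \<omega>)"
        unfolding strict_min_def mem_Collect_eq r by (simp add: space_PiM)
      then show "\<exists>\<tau>\<in>perms n. \<omega> \<in> E \<tau>" using p \<omega> by (auto simp: E_def)
    qed
  qed
  have E_opt: "?opt \<omega> = \<tau>" if "\<omega> \<in> E \<tau>" "\<tau> permutes {1..n}" for \<omega> \<tau>
    using that by (intro opt_assignment_strict_min) (auto simp: E_def)
  define Q where "Q = distr M (count_space (perms n)) ?opt"
  interpret Q: prob_space Q unfolding Q_def by (rule prob_space_distr[OF opt])
  \<comment> \<open>Outside a null set exactly one of the events \<open>E \<tau>\<close> occurs, and
    it determines the assignment.\<close>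
  have Q: "measure Q {\<tau>} = measure M (E id)" if \<tau>: "\<tau> \<in> perms n" for \<tau>
  proof -
    have "emeasure Q {\<tau>} = emeasure M (?opt -` {\<tau>} \<inter> space M)"
      unfolding Q_def using \<tau> by (subst emeasure_distr[OF opt]) auto
    also have "\<dots> = emeasure M (E \<tau>)"
    proof (rule emeasure_eq_AE)
      show "AE \<omega> in M. (\<omega> \<in> ?opt -` {\<tau>} \<inter> space M) = (\<omega> \<in> E \<tau>)"
        using AE_E
      proof (rule AE_mp, intro AE_I2 impI)
        fix \<omega> assume \<omega>: "\<omega> \<in> space M" "\<exists>\<tau>\<in>perms n. \<omega> \<in> E \<tau>"
        then obtain \<tau>' where "\<tau>' \<in> perms n" "\<omega> \<in> E \<tau>'" by blast
        then show "(\<omega> \<in> ?opt -` {\<tau>} \<inter> space M) = (\<omega> \<in> E \<tau>)"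
          using E_opt[of \<omega> \<tau>'] E_opt[of \<omega> \<tau>] \<tau> \<omega> by auto
      qed
      show "?opt -` {\<tau>} \<inter> space M \<in> events" by (rule measurable_sets[OF opt]) (use \<tau> in auto)
    qed (rule E)
    also have "\<dots> = emeasure M (E id)" using \<tau> by (intro pE) simp
    finally show ?thesis by (simp add: measure_def)
  qed
  have setsQ: "sets Q = Pow (perms n)" "space Q = perms n" by (simp_all add: Q_def)
  \<comment> \<open>The common mass is read off from the total mass 1, without computing the
    probability of any single event.\<close>
  have "1 = measure Q (perms n)" using Q.prob_space setsQ by simp
  also have "\<dots> = (\<Sum>\<tau>\<in>perms n. measure Q {\<tau>})"
    using finite_perms setsQ by (intro Q.finite_measure_eq_sum_singleton) auto
  also have "\<dots> = card (perms n) * measure M (E id)" using Q by simp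
  finally have "measure M (E id) = 1 / card (perms n)"
    by (metis nonzero_mult_div_cancel_left mult_zero_left zero_neq_one)
  with Q have Q': "measure Q {\<tau>} = 1 / card (perms n)" if "\<tau> \<in> perms n" for \<tau> using that by simp
  show ?thesis unfolding Q_def[symmetric]
  proof (rule measure_eqI_finite[OF setsQ(1) sets_uniform_count_measure finite_perms])
    fix \<tau> assume \<tau>: "\<tau> \<in> perms n"
    show "emeasure Q {\<tau>} = emeasure (uniform_count_measure (perms n)) {\<tau>}"
      using Q'[OF \<tau>] \<tau> finite_perms
      by (simp add: Q.emeasure_eq_measure emeasure_uniform_count_measure)
  qed
qed

section \<open>The rank energy statistic\<close>

lemma pool_index_range:
  assumes "j \<in> {1..K}" "m \<in> {1..ns j}"
  shows "pool_index ns j m \<in> {1..\<Sum>k=1..K. ns k}"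
proof -
  have "(\<Sum>k=1..<j. ns k) + ns j = (\<Sum>k=1..j. ns k)"
    using assms(1) by (metis atLeastAtMost_iff atLeastLessThanSuc_atLeastAtMost sum.atLeastLessThan_Suc)
  also have "\<dots> \<le> (\<Sum>k=1..K. ns k)"
    using assms(1) by (intro sum_mono2) auto
  finally show ?thesis using assms(2) by (auto simp: pool_index_def)
qed

text \<open>Pooling the array of labels \<open>Pair\<close> reads the label (j, m) back from a
  position, which gives injectivity; equality of cardinalities gives the rest.\<close>

lemma bij_betw_pool_index:
  "bij_betw (\<lambda>(j, m). pool_index ns j m) (SIGMA j:{1..K}. {1..ns j}) {1..\<Sum>k=1..K. ns k}"
proof -
  let ?S = "SIGMA j:{1..K}. {1..ns j}" and ?p = "\<lambda>(j, m). pool_index ns j m"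
  have inj: "inj_on ?p ?S"
    by (rule inj_on_inverseI[where g = "pooled_sample K ns Pair"]) (auto simp: pooled_sample_pool_index)
  have sub: "?p ` ?S \<subseteq> {1..\<Sum>k=1..K. ns k}"
    using pool_index_range by auto
  have "card (?p ` ?S) = (\<Sum>k=1..K. ns k)"
    using inj by (simp add: card_image)
  then have "?p ` ?S = {1..\<Sum>k=1..K. ns k}"
    using sub by (intro card_subset_eq) auto
  with inj show ?thesis by (simp add: bij_betw_def)
qed

lemma pool_index_cases:
  assumes "i \<in> {1..\<Sum>k=1..K. ns k}"
  obtains j m where "j \<in> {1..K}" "m \<in> {1..ns j}" "i = pool_index ns j m"
proof -
  have "i \<in> (\<lambda>(j, m). pool_index ns j m) ` (SIGMA j:{1..K}. {1..ns j})"
    using assms bij_betw_pool_index[of ns K] unfolding bij_betw_def by blast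
  then show thesis by (auto intro: that)
qed

definition sample_group :: "(nat \<Rightarrow> nat) \<Rightarrow> nat \<Rightarrow> nat set" where
  "sample_group ns j = pool_index ns j ` {1..ns j}"

lemma inj_pool_index: "inj_on (pool_index ns j) S"
  by (auto simp: pool_index_def inj_on_def)

lemma finite_sample_group: "finite (sample_group ns j)" and card_sample_group: "card (sample_group ns j) = ns j"
  by (auto simp: sample_group_def card_image inj_pool_index)

lemma sample_group_subset: "j \<in> {1..K} \<Longrightarrow> sample_group ns j \<subseteq> {1..\<Sum>k=1..K. ns k}"
  using pool_index_range unfolding sample_group_def by blast

lemma sample_group_disjoint:
  assumes "j \<in> {1..K}" "k \<in> {1..K}" "j \<noteq> k"
  shows "sample_group ns j \<inter> sample_group ns k = {}"
proof -
  have "pool_index ns j m \<noteq> pool_index ns k l" if "m \<in> {1..ns j}" "l \<in> {1..ns k}" for m l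
    using pooled_sample_pool_index[where x = Pair and ns = ns, OF assms(1) that(1)]
      pooled_sample_pool_index[where x = Pair and ns = ns, OF assms(2) that(2)] assms(3)
    by auto
  then show ?thesis by (auto simp: sample_group_def)
qed

lemma sum_sample_group: "(\<Sum>m=1..ns j. g (pool_index ns j m)) = (\<Sum>a\<in>sample_group ns j. g a)"
  unfolding sample_group_def by (simp add: sum.reindex inj_pool_index)

text \<open>The summand of the statistic as a function of the ranks alone, indexed by pooled
  positions. In this form it applies equally to the observed ranks and to a random permutation of
  the reference points.\<close>

definition rank_energy :: "(nat \<Rightarrow> nat) \<Rightarrow> (nat \<Rightarrow> real^'d) \<Rightarrow> nat \<Rightarrow> nat \<Rightarrow> real" where
  "rank_energy ns r j k =
       2 / (real (ns j) * real (ns k)) * (\<Sum>a\<in>sample_group ns j. \<Sum>b\<in>sample_group ns k. norm (r a - r b))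
       - 1 / (real (ns j))\<^sup>2 * (\<Sum>a\<in>sample_group ns j. \<Sum>b\<in>sample_group ns j. norm (r a - r b))
       - 1 / (real (ns k))\<^sup>2 * (\<Sum>a\<in>sample_group ns k. \<Sum>b\<in>sample_group ns k. norm (r a - r b))"

lemma RE2_pair_eq_rank_energy:
  "RE2_pair K ns h x j k = rank_energy ns (empirical_rank (\<Sum>k=1..K. ns k) (pooled_sample K ns x) h) j k"
  unfolding RE2_pair_def rank_energy_def Let_def pooled_rank_def sum_sample_group[symmetric] ..

text \<open>Weights of the signed measure "empirical law of A minus empirical law of B" for disjoint
  groups; every index outside A is counted to B.\<close>

definition two_weights :: "'i set \<Rightarrow> 'i set \<Rightarrow> 'i \<Rightarrow> real" where
  "two_weights A B a = (if a \<in> A then 1 / real (card A) else - 1 / real (card B))"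

lemma sum_two_weights:
  assumes "finite A" "finite B" "A \<inter> B = {}"
  shows "(\<Sum>a\<in>A \<union> B. two_weights A B a * g a) = avg A g - avg B g"
proof -
  have "(\<Sum>a\<in>A. two_weights A B a * g a) = avg A g"
    by (simp add: two_weights_def avg_def sum_divide_distrib)
  moreover have "(\<Sum>a\<in>B. two_weights A B a * g a) = - avg B g"
  proof -
    have "(\<Sum>a\<in>B. two_weights A B a * g a) = (\<Sum>a\<in>B. - (g a / real (card B)))"
      using assms(3) by (intro sum.cong) (auto simp: two_weights_def)
    then show ?thesis by (simp add: avg_def sum_divide_distrib sum_negf)
  qed
  ultimately show ?thesis using assms by (simp add: sum.union_disjoint)
qed

lemma sum_two_weights_zero:
  assumes "finite A" "finite B" "A \<inter> B = {}" "A \<noteq> {}" "B \<noteq> {}"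
  shows "(\<Sum>a\<in>A \<union> B. two_weights A B a) = 0" "(\<Sum>a\<in>A \<union> B. \<bar>two_weights A B a\<bar>) \<le> 2"
proof -
  show "(\<Sum>a\<in>A \<union> B. two_weights A B a) = 0"
    using sum_two_weights[OF assms(1-3), of "\<lambda>_. 1"] assms by (simp add: avg_def)
  have "(\<Sum>a\<in>A. \<bar>two_weights A B a\<bar>) = 1" using assms by (simp add: two_weights_def)
  moreover have "(\<Sum>a\<in>B. \<bar>two_weights A B a\<bar>) = (\<Sum>a\<in>B. 1 / real (card B))"
    using assms by (intro sum.cong) (auto simp: two_weights_def)
  ultimately show "(\<Sum>a\<in>A \<union> B. \<bar>two_weights A B a\<bar>) \<le> 2"
    using assms by (simp add: sum.union_disjoint)
qed

lemma energy_two_weights: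
  fixes r :: "'i \<Rightarrow> 'a::euclidean_space"
  assumes "finite A" "finite B" "A \<inter> B = {}"
  shows "energy (A \<union> B) (two_weights A B) r =
     2 / (real (card A) * real (card B)) * (\<Sum>a\<in>A. \<Sum>b\<in>B. norm (r a - r b))
       - 1 / (real (card A))\<^sup>2 * (\<Sum>a\<in>A. \<Sum>b\<in>A. norm (r a - r b))
       - 1 / (real (card B))\<^sup>2 * (\<Sum>a\<in>B. \<Sum>b\<in>B. norm (r a - r b))"
proof -
  have "energy (A \<union> B) (two_weights A B) r
     = - (\<Sum>a\<in>A \<union> B. two_weights A B a * (\<Sum>b\<in>A \<union> B. two_weights A B b * norm (r a - r b)))"
    unfolding energy_def by (simp add: sum_distrib_left mult_ac)
  also have "\<dots> = - (avg A (\<lambda>a. avg A (\<lambda>b. norm (r a - r b)) - avg B (\<lambda>b. norm (r a - r b)))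
      - avg B (\<lambda>a. avg A (\<lambda>b. norm (r a - r b)) - avg B (\<lambda>b. norm (r a - r b))))"
    unfolding sum_two_weights[OF assms] ..
  also have "avg B (\<lambda>a. avg A (\<lambda>b. norm (r a - r b)) - avg B (\<lambda>b. norm (r a - r b)))
     = avg A (\<lambda>a. avg B (\<lambda>b. norm (r a - r b))) - avg B (\<lambda>a. avg B (\<lambda>b. norm (r a - r b)))"
  proof -
    have "(\<Sum>a\<in>B. \<Sum>b\<in>A. norm (r a - r b)) = (\<Sum>a\<in>A. \<Sum>b\<in>B. norm (r a - r b))"
      by (subst sum.swap) (simp add: norm_minus_commute)
    then show ?thesis
      by (simp add: avg_def sum_subtractf diff_divide_distrib sum_divide_distrib[symmetric])
  qed
  finally show ?thesis
    by (simp add: avg_def sum_subtractf diff_divide_distrib sum_divide_distrib[symmetric] power2_eq_square)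
qed

lemma rank_energy_eq_energy:
  assumes "j \<in> {1..K}" "k \<in> {1..K}" "j \<noteq> k"
  shows "rank_energy ns r j k = energy (sample_group ns j \<union> sample_group ns k) (two_weights (sample_group ns j) (sample_group ns k)) r"
  unfolding rank_energy_def energy_two_weights[OF finite_sample_group finite_sample_group sample_group_disjoint[OF assms]]
  by (simp add: card_sample_group)

lemma rank_energy_nonneg:
  assumes "j \<in> {1..K}" "k \<in> {1..K}" "j \<noteq> k" "ns j \<ge> 1" "ns k \<ge> 1"
  shows "0 \<le> rank_energy ns r j k"
proof -
  have "sample_group ns j \<noteq> {}" "sample_group ns k \<noteq> {}"
    using assms card_sample_group[of ns j] card_sample_group[of ns k] by auto
  then show ?thesis
    unfolding rank_energy_eq_energy[OF assms(1-3)]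
    by (intro energy_nonneg sum_two_weights_zero finite_sample_group sample_group_disjoint[OF assms(1-3)])
qed

definition rank_stat :: "nat \<Rightarrow> (nat \<Rightarrow> nat) \<Rightarrow> (nat \<Rightarrow> real^'d) \<Rightarrow> real" where
  "rank_stat K ns r = (\<Sum>j=1..K - 1. rank_energy ns r j (j + 1))"

lemma RE2_eq_rank_stat:
  "RE2 K ns h x = rank_stat K ns (\<lambda>a. h (opt_assignment (\<Sum>k=1..K. ns k) (pooled_sample K ns x) h a))"
  unfolding RE2_def RE2_pair_eq_rank_energy rank_stat_def empirical_rank_def[abs_def] ..

text \<open>All summands are nonnegative, so a single pair of neighbouring groups suffices to keep
  the statistic large.\<close>

lemma rank_stat_ge:
  assumes "\<And>j. j \<in> {1..K} \<Longrightarrow> ns j \<ge> 1" "j \<in> {1..K - 1}"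
  shows "rank_energy ns r j (j + 1) \<le> rank_stat K ns r"
  unfolding rank_stat_def
proof (rule member_le_sum[OF assms(2)])
  fix i assume "i \<in> {1..K - 1} - {j}"
  then have "i \<in> {1..K}" "i + 1 \<in> {1..K}" by auto
  then show "0 \<le> rank_energy ns r i (i + 1)"
    using assms(1) by (intro rank_energy_nonneg[where K = K]) simp_all
qed simp

lemma rank_stat_nonneg:
  assumes "\<And>j. j \<in> {1..K} \<Longrightarrow> ns j \<ge> 1"
  shows "0 \<le> rank_stat K ns r"
  unfolding rank_stat_def
proof (rule sum_nonneg)
  fix i assume "i \<in> {1..K - 1}"
  then have "i \<in> {1..K}" "i + 1 \<in> {1..K}" by auto
  then show "0 \<le> rank_energy ns r i (i + 1)"
    using assms(1) by (intro rank_energy_nonneg[where K = K]) simp_all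
qed

section \<open>Mean of the statistic under a uniform permutation\<close>

text \<open>The symmetric group is transitive on ordered pairs of distinct indices, so all
  off-diagonal sums share one value \<open>C\<close>.\<close>

lemma sum_perms_norm:
  fixes h :: "nat \<Rightarrow> real^'d"
  assumes D: "\<And>a b. a \<in> {1..n} \<Longrightarrow> b \<in> {1..n} \<Longrightarrow> norm (h a - h b) \<le> D" "D \<ge> 0"
  shows "\<exists>C. 0 \<le> C \<and> C \<le> real (card (perms n)) * D \<and>
    (\<forall>a\<in>{1..n}. \<forall>b\<in>{1..n}. (\<Sum>\<sigma>\<in>perms n. norm (h (\<sigma> a) - h (\<sigma> b))) = (if a = b then 0 else C))"
proof -
  define F where "F a b = (\<Sum>\<sigma>\<in>perms n. norm (h (\<sigma> a) - h (\<sigma> b)))" for a b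
  have F_perm: "F (\<pi> a) (\<pi> b) = F a b" if "\<pi> permutes {1..n}" for \<pi> a b
    unfolding F_def using sum_permutations_compose_right[OF that, of "\<lambda>\<sigma>. norm (h (\<sigma> a) - h (\<sigma> b))"] by simp
  have F_sym: "F a b = F b a" for a b unfolding F_def by (simp add: norm_minus_commute)
  have F_left: "F a b = F a' b" if "a \<in> {1..n}" "a' \<in> {1..n}" "b \<noteq> a" "b \<noteq> a'" for a a' b
    using F_perm[OF permutes_swap_id[OF that(1,2)], of a b] that by (simp add: Transposition.transpose_def)
  have F_const: "F a b = F a' b'"
    if ab: "a \<in> {1..n}" "b \<in> {1..n}" "a \<noteq> b" and ab': "a' \<in> {1..n}" "b' \<in> {1..n}" "a' \<noteq> b'" for a b a' b'
  \<comment> \<open>If a' = b, replacing a by a' would produce a pair of equal indices; in that case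
    a is replaced by b' instead.\<close>
  proof (cases "a' = b")
    case True
    then show ?thesis using F_left[of a b' b] F_sym[of b b'] ab ab' by auto
  next
    case False
    have "F a b = F a' b" by (rule F_left) (use ab ab' False in auto)
    also have "\<dots> = F b a'" by (rule F_sym)
    also have "\<dots> = F b' a'" by (rule F_left) (use ab ab' False in auto)
    also have "\<dots> = F a' b'" by (rule F_sym)
    finally show ?thesis .
  qed
  have F_bound: "0 \<le> F a b \<and> F a b \<le> real (card (perms n)) * D" if "a \<in> {1..n}" "b \<in> {1..n}" for a b
  proof
    show "0 \<le> F a b" unfolding F_def by (simp add: sum_nonneg)
    have "F a b \<le> (\<Sum>\<sigma>\<in>perms n. D)"
      unfolding F_def
    proof (rule sum_mono)
      fix \<sigma> assume "\<sigma> \<in> perms n"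
      then have "\<sigma> a \<in> {1..n}" "\<sigma> b \<in> {1..n}" using that by (metis mem_Collect_eq permutes_in_image)+
      then show "norm (h (\<sigma> a) - h (\<sigma> b)) \<le> D" by (rule D)
    qed
    then show "F a b \<le> real (card (perms n)) * D" by simp
  qed
  show ?thesis
  proof (cases "\<exists>a b. a \<in> {1..n} \<and> b \<in> {1..n} \<and> a \<noteq> b")
    case True
    then obtain a b where ab: "a \<in> {1..n}" "b \<in> {1..n}" "a \<noteq> b" by blast
    show ?thesis
    proof (intro exI[of _ "F a b"] conjI ballI)
      fix a' b' assume "a' \<in> {1..n}" "b' \<in> {1..n}"
      then show "(\<Sum>\<sigma>\<in>perms n. norm (h (\<sigma> a') - h (\<sigma> b'))) = (if a' = b' then 0 else F a b)"
        using F_const[OF _ _ _ ab, of a' b'] unfolding F_def[symmetric] by (auto simp: F_def)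
    qed (use F_bound[OF ab(1,2)] in auto)
  next
    case False
    \<comment> \<open>With at most one index there is no off-diagonal pair, and C = 0
      serves.\<close>
    then have ab: "a = b" if "a \<in> {1..n}" "b \<in> {1..n}" for a b
      using that by blast
    show ?thesis
    proof (intro exI[of _ 0] conjI ballI)
      fix a b assume "a \<in> {1..n}" "b \<in> {1..n}"
      then have "a = b" by (rule ab)
      then show "(\<Sum>\<sigma>\<in>perms n. norm (h (\<sigma> a) - h (\<sigma> b))) = (if a = b then 0 else 0)" by simp
    qed (use D in auto)
  qed
qed

text \<open>With a common off-diagonal value C, the cross term 2 C would cancel the two within-group
  terms but for their zero diagonals, which leave C / n_j + C / n_k. This is the source of the order
  1 / n.\<close>

lemma sum_perms_rank_energy_le:
  fixes h :: "nat \<Rightarrow> real^'d"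
  assumes jk: "j \<in> {1..K}" "k \<in> {1..K}" "j \<noteq> k" "ns j \<ge> 1" "ns k \<ge> 1"
    and n: "n = (\<Sum>k=1..K. ns k)"
    and D: "\<And>a b. a \<in> {1..n} \<Longrightarrow> b \<in> {1..n} \<Longrightarrow> norm (h a - h b) \<le> D" "D \<ge> 0"
  shows "(\<Sum>\<sigma>\<in>perms n. rank_energy ns (\<lambda>a. h (\<sigma> a)) j k)
      \<le> real (card (perms n)) * D * (1 / real (ns j) + 1 / real (ns k))"
proof -
  obtain C where C: "0 \<le> C" "C \<le> real (card (perms n)) * D"
    "\<And>a b. a \<in> {1..n} \<Longrightarrow> b \<in> {1..n} \<Longrightarrow> (\<Sum>\<sigma>\<in>perms n. norm (h (\<sigma> a) - h (\<sigma> b))) = (if a = b then 0 else C)"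
    using sum_perms_norm[of n h D, OF D] by blast
  have swap: "(\<Sum>\<sigma>\<in>perms n. \<Sum>a\<in>A. \<Sum>b\<in>B. norm (h (\<sigma> a) - h (\<sigma> b))) = (\<Sum>a\<in>A. \<Sum>b\<in>B. if a = b then 0 else C)"
    if "A \<subseteq> {1..n}" "B \<subseteq> {1..n}" for A B
  proof -
    have "(\<Sum>\<sigma>\<in>perms n. \<Sum>a\<in>A. \<Sum>b\<in>B. norm (h (\<sigma> a) - h (\<sigma> b))) = (\<Sum>a\<in>A. \<Sum>\<sigma>\<in>perms n. \<Sum>b\<in>B. norm (h (\<sigma> a) - h (\<sigma> b)))"
      by (rule sum.swap)
    also have "\<dots> = (\<Sum>a\<in>A. \<Sum>b\<in>B. \<Sum>\<sigma>\<in>perms n. norm (h (\<sigma> a) - h (\<sigma> b)))"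
      by (intro sum.cong refl sum.swap)
    also have "\<dots> = (\<Sum>a\<in>A. \<Sum>b\<in>B. if a = b then 0 else C)"
      using that by (intro sum.cong refl C) auto
    finally show ?thesis .
  qed
  have g: "sample_group ns j \<subseteq> {1..n}" "sample_group ns k \<subseteq> {1..n}" using sample_group_subset jk unfolding n by blast+
  have same: "(\<Sum>a\<in>sample_group ns i. \<Sum>b\<in>sample_group ns i. if a = b then 0 else C) = (real (ns i))\<^sup>2 * C - real (ns i) * C" for i
  proof -
    have "(\<Sum>b\<in>sample_group ns i. if a = b then 0 else C) = real (ns i) * C - C" if "a \<in> sample_group ns i" for a
    proof -
      have "(\<Sum>b\<in>sample_group ns i. if a = b then 0 else C) = (\<Sum>b\<in>sample_group ns i. C - (if a = b then C else 0))"
        by (intro sum.cong) auto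
      also have "\<dots> = real (ns i) * C - C"
        using that by (simp add: sum_subtractf finite_sample_group card_sample_group)
      finally show ?thesis .
    qed
    then have "(\<Sum>a\<in>sample_group ns i. \<Sum>b\<in>sample_group ns i. if a = b then 0 else C) = (\<Sum>a\<in>sample_group ns i. real (ns i) * C - C)"
      by (intro sum.cong) auto
    then show ?thesis by (simp add: card_sample_group power2_eq_square algebra_simps)
  qed
  have cross: "(\<Sum>a\<in>sample_group ns j. \<Sum>b\<in>sample_group ns k. if a = b then 0 else C) = real (ns j) * real (ns k) * C"
  proof -
    have "(\<Sum>a\<in>sample_group ns j. \<Sum>b\<in>sample_group ns k. if a = b then 0 else C) = (\<Sum>a\<in>sample_group ns j. \<Sum>b\<in>sample_group ns k. C)"
      using sample_group_disjoint[OF jk(1-3), of ns] by (intro sum.cong) auto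
    then show ?thesis by (simp add: card_sample_group)
  qed
  have "(\<Sum>\<sigma>\<in>perms n. rank_energy ns (\<lambda>a. h (\<sigma> a)) j k) =
       2 / (real (ns j) * real (ns k)) * (real (ns j) * real (ns k) * C)
       - 1 / (real (ns j))\<^sup>2 * ((real (ns j))\<^sup>2 * C - real (ns j) * C)
       - 1 / (real (ns k))\<^sup>2 * ((real (ns k))\<^sup>2 * C - real (ns k) * C)"
    unfolding rank_energy_def sum_subtractf sum_distrib_left[symmetric] swap[OF g(1) g(2)] swap[OF g(1) g(1)]
      swap[OF g(2) g(2)] same cross ..
  also have "\<dots> = C * (1 / real (ns j) + 1 / real (ns k))"
    using jk by (simp add: field_simps power2_eq_square)
  also have "\<dots> \<le> real (card (perms n)) * D * (1 / real (ns j) + 1 / real (ns k))"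
    using C by (intro mult_right_mono) auto
  finally show ?thesis .
qed

section \<open>Law of the statistic under the null hypothesis\<close>

lemma pooled_sample_indep:
  fixes X :: "nat \<Rightarrow> nat \<Rightarrow> 'a \<Rightarrow> real^'d"
  assumes "k_sample M K ns X \<mu>"
  shows "prob_space.indep_vars M (\<lambda>_. borel) (\<lambda>i \<omega>. pooled_sample K ns (\<lambda>j m. X j m \<omega>) i) {1..\<Sum>k=1..K. ns k}"
proof -
  interpret prob_space M using assms by (simp add: k_sample_def)
  let ?S = "SIGMA j:{1..K}. {1..ns j}" and ?g = "pooled_sample K ns Pair"
  have g: "?g (pool_index ns j m) = (j, m)" if "j \<in> {1..K}" "m \<in> {1..ns j}" for j m
    using pooled_sample_pool_index[where ns = ns, OF that] .
  have "indep_vars (\<lambda>_. borel) (\<lambda>i. (\<lambda>(j, m). X j m) (?g i)) {1..\<Sum>k=1..K. ns k}"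
  proof (rule indep_vars_reindex)
    show "indep_vars (\<lambda>_. borel) (\<lambda>(j, i). X j i) ?S" using assms by (simp add: k_sample_def)
    show "inj_on ?g {1..\<Sum>k=1..K. ns k}"
    proof (rule inj_onI)
      fix a b assume ab: "a \<in> {1..\<Sum>k=1..K. ns k}" "b \<in> {1..\<Sum>k=1..K. ns k}" "?g a = ?g b"
      obtain j m where 1: "j \<in> {1..K}" "m \<in> {1..ns j}" "a = pool_index ns j m" using ab(1) by (rule pool_index_cases)
      obtain k l where 2: "k \<in> {1..K}" "l \<in> {1..ns k}" "b = pool_index ns k l" using ab(2) by (rule pool_index_cases)
      show "a = b" using ab(3) 1 2 g by simp
    qed
    show "?g ` {1..\<Sum>k=1..K. ns k} \<subseteq> ?S"
    proof (rule image_subsetI)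
      fix a assume "a \<in> {1..\<Sum>k=1..K. ns k}"
      then obtain j m where "j \<in> {1..K}" "m \<in> {1..ns j}" "a = pool_index ns j m" by (rule pool_index_cases)
      then show "?g a \<in> ?S" using g by simp
    qed
  qed
  moreover have "(\<lambda>(j, m). X j m) (?g i) = (\<lambda>\<omega>. pooled_sample K ns (\<lambda>j m. X j m \<omega>) i)"
    if i: "i \<in> {1..\<Sum>k=1..K. ns k}" for i
  proof -
    obtain j m where jm: "j \<in> {1..K}" "m \<in> {1..ns j}" "i = pool_index ns j m" using i by (rule pool_index_cases)
    show ?thesis unfolding jm(3) g[OF jm(1,2)] pooled_sample_pool_index[where ns = ns, OF jm(1,2)] by simp
  qed
  ultimately show ?thesis by (subst indep_vars_cong[OF refl _ refl]) auto
qed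

lemma k_sample_measurable:
  assumes "k_sample M K ns X \<mu>" "j \<in> {1..K}" "m \<in> {1..ns j}"
  shows "X j m \<in> borel_measurable M"
proof -
  interpret prob_space M using assms by (simp add: k_sample_def)
  show ?thesis using assms unfolding k_sample_def indep_vars_def by force
qed

lemma pooled_sample_measurable:
  assumes "k_sample M K ns X \<mu>" "i \<in> {1..\<Sum>k=1..K. ns k}"
  shows "(\<lambda>\<omega>. pooled_sample K ns (\<lambda>j m. X j m \<omega>) i) \<in> borel_measurable M"
proof -
  obtain j m where jm: "j \<in> {1..K}" "m \<in> {1..ns j}" "i = pool_index ns j m" using assms(2) by (rule pool_index_cases)
  show ?thesis
    unfolding jm(3) pooled_sample_pool_index[where ns = ns, OF jm(1,2)] by (rule k_sample_measurable[OF assms(1) jm(1,2)])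
qed

lemma measurable_pooled_opt:
  assumes ks: "k_sample M K ns X \<mu>" and n: "n = (\<Sum>k=1..K. ns k)"
  shows "(\<lambda>\<omega>. opt_assignment n (pooled_sample K ns (\<lambda>j m. X j m \<omega>)) h) \<in> measurable M (count_space (perms n))"
  using measurable_opt_assignment[of n "\<lambda>i \<omega>. pooled_sample K ns (\<lambda>j m. X j m \<omega>) i" M h]
      pooled_sample_measurable[OF ks] unfolding n by simp

lemma RE2_measurable:
  assumes "k_sample M K ns X \<mu>"
  shows "(\<lambda>\<omega>. RE2 K ns h (\<lambda>j i. X j i \<omega>)) \<in> borel_measurable M"
proof -
  let ?n = "\<Sum>k=1..K. ns k"
  have "(\<lambda>\<omega>. (\<lambda>\<sigma>. rank_stat K ns (\<lambda>a. h (\<sigma> a))) (opt_assignment ?n (pooled_sample K ns (\<lambda>j m. X j m \<omega>)) h))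
      \<in> borel_measurable M"
    by (rule measurable_compose[OF measurable_pooled_opt[OF assms refl]]) simp
  then show ?thesis unfolding RE2_eq_rank_stat .
qed

lemma null_sample_opt_uniform:
  assumes ks: "k_sample M K ns X \<mu>" and K: "K \<ge> 1" and ns: "\<And>j. j \<in> {1..K} \<Longrightarrow> ns j \<ge> 1"
    and ac: "\<And>j. j \<in> {1..K} \<Longrightarrow> abs_cont_law (\<mu> j)" and null: "null_hypothesis K \<mu>"
    and n: "n = (\<Sum>k=1..K. ns k)" and h: "inj_on h {1..n}"
  shows "distr M (count_space (perms n)) (\<lambda>\<omega>. opt_assignment n (pooled_sample K ns (\<lambda>j m. X j m \<omega>)) h)
      = uniform_count_measure (perms n)"
proof -
  interpret prob_space M using ks by (simp add: k_sample_def)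
  have "distr M (count_space (perms n)) (\<lambda>\<omega>. opt_assignment n (\<lambda>i. pooled_sample K ns (\<lambda>j m. X j m \<omega>) i) h)
      = uniform_count_measure (perms n)"
  proof (rule opt_assignment_uniform)
    show "indep_vars (\<lambda>_. borel) (\<lambda>i \<omega>. pooled_sample K ns (\<lambda>j m. X j m \<omega>) i) {1..n}"
      unfolding n by (rule pooled_sample_indep[OF ks])
    have "ns 1 \<le> n" unfolding n using K by (intro member_le_sum) auto
    then show "1 \<le> n" using ns[of 1] K by simp
    show "abs_cont_law (\<mu> 1)" using ac K by simp
    show "inj_on h {1..n}" by fact
    fix i assume "i \<in> {1..n}"
    then obtain j m where jm: "j \<in> {1..K}" "m \<in> {1..ns j}" "i = pool_index ns j m"
      unfolding n by (rule pool_index_cases)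
    have "distr M borel (\<lambda>\<omega>. pooled_sample K ns (\<lambda>j m. X j m \<omega>) i) = distr M borel (X j m)"
      unfolding jm(3) pooled_sample_pool_index[where ns = ns, OF jm(1,2)] ..
    also have "\<dots> = \<mu> j" using ks jm by (simp add: k_sample_def)
    also have "\<dots> = \<mu> 1" using null jm(1) K unfolding null_hypothesis_def by (metis atLeastAtMost_iff order_refl)
    finally show "distr M borel (\<lambda>\<omega>. pooled_sample K ns (\<lambda>j m. X j m \<omega>) i) = \<mu> 1" .
  qed
  then show ?thesis by simp
qed

text \<open>The statistic depends on the sample only through the assignment, whose law is uniform.
  The right-hand side mentions neither \<open>M\<close> nor \<open>\<mu>\<close>, and that is
  distribution-freeness.\<close>

lemma null_law_RE2:
  assumes ks: "k_sample M K ns X \<mu>" and K: "K \<ge> 1" and ns: "\<And>j. j \<in> {1..K} \<Longrightarrow> ns j \<ge> 1"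
    and ac: "\<And>j. j \<in> {1..K} \<Longrightarrow> abs_cont_law (\<mu> j)" and null: "null_hypothesis K \<mu>"
    and n: "n = (\<Sum>k=1..K. ns k)" and h: "inj_on h {1..n}"
  shows "distr M borel (\<lambda>\<omega>. RE2 K ns h (\<lambda>j i. X j i \<omega>)) =
     distr (uniform_count_measure (perms n)) borel (\<lambda>\<sigma>. rank_stat K ns (\<lambda>a. h (\<sigma> a)))"
proof -
  have "distr (uniform_count_measure (perms n)) borel (\<lambda>\<sigma>. rank_stat K ns (\<lambda>a. h (\<sigma> a))) =
     distr (distr M (count_space (perms n)) (\<lambda>\<omega>. opt_assignment n (pooled_sample K ns (\<lambda>j m. X j m \<omega>)) h)) borel
       (\<lambda>\<sigma>. rank_stat K ns (\<lambda>a. h (\<sigma> a)))"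
    using null_sample_opt_uniform[OF ks K ns ac null n h] by simp
  also have "\<dots> = distr M borel (\<lambda>\<omega>. RE2 K ns h (\<lambda>j i. X j i \<omega>))"
    unfolding RE2_eq_rank_stat n[symmetric]
    by (subst distr_distr[OF _ measurable_pooled_opt[OF ks n]]) (auto simp: o_def)
  finally show ?thesis ..
qed

text \<open>Markov's inequality for the law over permutations. For fixed \<epsilon> the bound
  vanishes as the groups grow.\<close>

lemma null_RE2_tail:
  assumes ks: "k_sample M K ns X \<mu>" and K: "K \<ge> 1" and ns: "\<And>j. j \<in> {1..K} \<Longrightarrow> ns j \<ge> 1"
    and ac: "\<And>j. j \<in> {1..K} \<Longrightarrow> abs_cont_law (\<mu> j)" and null: "null_hypothesis K \<mu>"
    and n: "n = (\<Sum>k=1..K. ns k)" and h: "inj_on h {1..n}"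
    and D: "\<And>a b. a \<in> {1..n} \<Longrightarrow> b \<in> {1..n} \<Longrightarrow> norm (h a - h b) \<le> D" "D \<ge> 0" and \<epsilon>: "\<epsilon> > 0"
  shows "measure M {\<omega>\<in>space M. \<epsilon> \<le> RE2 K ns h (\<lambda>j i. X j i \<omega>)}
      \<le> D * (\<Sum>j=1..K-1. 1 / real (ns j) + 1 / real (ns (j + 1))) / \<epsilon>"
proof -
  let ?U = "uniform_count_measure (perms n)" and ?G = "\<lambda>\<sigma>. rank_stat K ns (\<lambda>a. h (\<sigma> a))"
  have c: "card (perms n) > 0" using finite_perms perms_ne by (simp add: card_gt_0_iff)
  have "measure M {\<omega>\<in>space M. \<epsilon> \<le> RE2 K ns h (\<lambda>j i. X j i \<omega>)}
      = measure (distr M borel (\<lambda>\<omega>. RE2 K ns h (\<lambda>j i. X j i \<omega>))) {\<epsilon>..}"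
    by (subst measure_distr[OF RE2_measurable[OF ks]]) (auto intro!: arg_cong[where f = "measure M"])
  also have "\<dots> = measure (distr ?U borel ?G) {\<epsilon>..}"
    using null_law_RE2[OF ks K ns ac null n h] by simp
  also have "\<dots> = measure ?U {\<sigma>\<in>space ?U. \<epsilon> \<le> ?G \<sigma>}"
    by (subst measure_distr) (simp_all add: vimage_def Int_def conj_commute)
  also have "\<dots> \<le> (\<integral>\<sigma>. ?G \<sigma> \<partial>?U) / \<epsilon>"
  proof (rule integral_Markov_inequality_measure)
    show "integrable ?U ?G"
      unfolding uniform_count_measure_def using finite_perms by (rule integrable_point_measure_finite)
    show "{} \<in> sets ?U" by simp
    show "AE \<sigma> in ?U. 0 \<le> ?G \<sigma>" using rank_stat_nonneg[of K ns] ns by (intro AE_I2) auto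
  qed (rule \<epsilon>)
  also have "(\<integral>\<sigma>. ?G \<sigma> \<partial>?U) = (\<Sum>\<sigma>\<in>perms n. ?G \<sigma>) / real (card (perms n))"
    using finite_perms by (rule integral_uniform_count_measure)
  also have "(\<Sum>\<sigma>\<in>perms n. ?G \<sigma>) \<le> real (card (perms n)) * (D * (\<Sum>j=1..K-1. 1 / real (ns j) + 1 / real (ns (j + 1))))"
  proof -
    have "(\<Sum>\<sigma>\<in>perms n. ?G \<sigma>) = (\<Sum>j=1..K-1. \<Sum>\<sigma>\<in>perms n. rank_energy ns (\<lambda>a. h (\<sigma> a)) j (j + 1))"
      unfolding rank_stat_def by (rule sum.swap)
    also have "\<dots> \<le> (\<Sum>j=1..K-1. real (card (perms n)) * D * (1 / real (ns j) + 1 / real (ns (j + 1))))"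
      using ns by (intro sum_mono sum_perms_rank_energy_le[OF _ _ _ _ _ n D]) auto
    finally show ?thesis by (simp add: sum_distrib_left mult_ac)
  qed
  finally show ?thesis using c \<epsilon> by (simp add: divide_right_mono)
qed

text \<open>Lets the results on samples apply to the reference law inside
  \<open>critical_value\<close>.\<close>

lemma null_space_k_sample:
  fixes \<nu> :: "(real^'d) measure"
  assumes ac: "abs_cont_law \<nu>" and K: "K \<ge> 1" and ns: "\<And>j. j \<in> {1..K} \<Longrightarrow> ns j \<ge> 1"
  shows "k_sample (null_space K ns \<nu>) K ns (\<lambda>j i y. y (j, i)) (\<lambda>_. \<nu>)"
proof -
  let ?S = "SIGMA j:{1..K}. {1..ns j}"
  have sets: "sets \<nu> = sets borel" and p\<nu>: "prob_space \<nu>" using ac by (auto simp: abs_cont_law_def)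
  interpret prob_space "null_space K ns \<nu>"
    unfolding null_space_def by (rule prob_space_PiM[OF p\<nu>])
  have ne: "?S \<noteq> {}"
  proof -
    have "(1, 1) \<in> ?S" using K ns[of 1] by simp
    then show ?thesis by blast
  qed
  have comp: "distr (null_space K ns \<nu>) borel (\<lambda>y. y p) = \<nu>" if "p \<in> ?S" for p
  proof -
    \<comment> \<open>\<open>\<nu>\<close> and \<open>borel\<close> share their sets but are
      different measures, so the target space is exchanged before the product lemma applies.\<close>
    have "distr (null_space K ns \<nu>) borel (\<lambda>y. y p) = distr (null_space K ns \<nu>) \<nu> (\<lambda>y. y p)"
      by (rule distr_cong) (auto simp: sets)
    also have "\<dots> = \<nu>" unfolding null_space_def using distr_PiM_component[of ?S "\<lambda>_. \<nu>" p] p\<nu> that by simp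
    finally show ?thesis .
  qed
  have meas: "(\<lambda>y. y p) \<in> borel_measurable (null_space K ns \<nu>)" if "p \<in> ?S" for p
    unfolding null_space_def using measurable_component_singleton[OF that, of "\<lambda>_. \<nu>"]
    by (simp cong: measurable_cong_sets add: sets)
  have "indep_vars (\<lambda>_. borel) (\<lambda>p y. y p) ?S"
  proof (subst indep_vars_iff_distr_eq_PiM'[OF ne meas])
    have "distr (null_space K ns \<nu>) (PiM ?S (\<lambda>_. borel)) (\<lambda>y. \<lambda>p\<in>?S. y p)
        = distr (null_space K ns \<nu>) (null_space K ns \<nu>) (\<lambda>y. y)"
    proof (rule distr_cong)
      show "sets (PiM ?S (\<lambda>_. borel)) = sets (null_space K ns \<nu>)"
        unfolding null_space_def by (intro sets_PiM_cong) (auto simp: sets)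
      show "(\<lambda>p\<in>?S. y p) = y" if "y \<in> space (null_space K ns \<nu>)" for y
        using that unfolding null_space_def space_PiM by (simp add: PiE_restrict)
    qed simp
    also have "\<dots> = PiM ?S (\<lambda>p. distr (null_space K ns \<nu>) borel (\<lambda>y. y p))"
      unfolding distr_id by (subst null_space_def, intro PiM_cong refl comp[symmetric])
    finally show "distr (null_space K ns \<nu>) (PiM ?S (\<lambda>_. borel)) (\<lambda>y. \<lambda>p\<in>?S. y p)
       = PiM ?S (\<lambda>p. distr (null_space K ns \<nu>) borel (\<lambda>y. y p))" .
  qed
  then show ?thesis
    unfolding k_sample_def using prob_space_axioms comp by (auto simp: case_prod_unfold)
qed

text \<open>The null tail bound puts \<open>real n * \<epsilon>\<close> into the set whose infimum
  is the critical value.\<close>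

lemma critical_value_le:
  fixes \<nu> :: "(real^'d) measure"
  assumes ac: "abs_cont_law \<nu>" and K: "K \<ge> 1" and ns: "\<And>j. j \<in> {1..K} \<Longrightarrow> ns j \<ge> 1"
    and n: "n = (\<Sum>k=1..K. ns k)" and h: "inj_on h {1..n}"
    and D: "\<And>a b. a \<in> {1..n} \<Longrightarrow> b \<in> {1..n} \<Longrightarrow> norm (h a - h b) \<le> D" "D \<ge> 0" and \<epsilon>: "\<epsilon> > 0"
    and \<alpha>: "D * (\<Sum>j=1..K-1. 1 / real (ns j) + 1 / real (ns (j + 1))) / \<epsilon> \<le> \<alpha>" "\<alpha> < 1"
  shows "critical_value \<nu> \<alpha> K ns h \<le> real n * \<epsilon>"
proof -
  let ?M = "null_space K ns \<nu>"
  have ks: "k_sample ?M K ns (\<lambda>j i y. y (j, i)) (\<lambda>_. \<nu>)" by (rule null_space_k_sample[OF ac K ns])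
  interpret prob_space ?M using ks by (simp add: k_sample_def)
  have n1: "n \<ge> 1"
  proof -
    have "ns 1 \<le> n" unfolding n using K by (intro member_le_sum) auto
    then show "1 \<le> n" using ns[of 1] K by simp
  qed
  let ?R = "\<lambda>y. RE2 K ns h (\<lambda>j i. y (j, i))"
  show ?thesis unfolding critical_value_def n[symmetric]
  proof (rule cInf_lower)
    have "{y \<in> space ?M. real n * \<epsilon> \<le> real n * ?R y} = {y\<in>space ?M. \<epsilon> \<le> ?R y}" using n1 by auto
    then have "prob {y \<in> space ?M. real n * \<epsilon> \<le> real n * ?R y} \<le> \<alpha>"
      using null_RE2_tail[OF ks K ns _ _ n h D \<epsilon>] ac \<alpha>(1) by (auto simp: null_hypothesis_def)
    then show "real n * \<epsilon> \<in> {c. prob {y \<in> space ?M. c \<le> real n * ?R y} \<le> \<alpha>}" by simp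
    \<comment> \<open>A real infimum is informative only for a set bounded below: the statistic is
      nonnegative, so a negative c would be reached with probability 1 > \<alpha>.\<close>
    show "bdd_below {c. prob {y \<in> space ?M. c \<le> real n * ?R y} \<le> \<alpha>}"
    proof (rule bdd_belowI[of _ 0])
      fix c assume "c \<in> {c. prob {y \<in> space ?M. c \<le> real n * ?R y} \<le> \<alpha>}"
      then have p: "prob {y \<in> space ?M. c \<le> real n * ?R y} < 1" using \<alpha> by simp
      show "0 \<le> c"
      proof (rule ccontr)
        assume "\<not> 0 \<le> c"
        then have "c \<le> real n * ?R y" for y
          using rank_stat_nonneg[of K ns] ns unfolding RE2_eq_rank_stat
          by (meson mult_nonneg_nonneg of_nat_0_le_iff order_trans linear)
        then show False using p prob_space by simp
      qed
    qed
  qed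
qed

section \<open>Sampling under the alternative\<close>

text \<open>Hoeffding's inequality for variables in [-1, 1]; the squared range 4 turns the exponent
  into n_j \<epsilon>^2 / 2. Samples for different n may live on unrelated probability spaces, so an
  explicit bound for each n takes the place of an almost sure law of large numbers.\<close>

lemma k_sample_concentration:
  fixes f :: "real^'d \<Rightarrow> real"
  assumes ks: "k_sample M K ns X \<mu>" and j: "j \<in> {1..K}" and ns: "ns j \<ge> 1"
    and f[measurable]: "f \<in> borel_measurable borel" and bound: "\<And>x. \<bar>f x\<bar> \<le> 1" and \<epsilon>: "\<epsilon> \<ge> 0"
  shows "measure M {\<omega>\<in>space M. \<epsilon> \<le> \<bar>(\<Sum>m=1..ns j. f (X j m \<omega>)) / real (ns j) - (\<integral>x. f x \<partial>\<mu> j)\<bar>}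
      \<le> 2 * exp (- (real (ns j) * \<epsilon>\<^sup>2 / 2))"
proof -
  interpret prob_space M using ks by (simp add: k_sample_def)
  have X[measurable]: "X j m \<in> borel_measurable M" if "m \<in> {1..ns j}" for m
    by (rule k_sample_measurable[OF ks j that])
  have law: "distr M borel (X j m) = \<mu> j" if "m \<in> {1..ns j}" for m
    using ks j that by (simp add: k_sample_def)
  have one: "1 \<in> {1..ns j}" using ns by simp
  interpret H: Hoeffding_ineq_iid M "{1..ns j}" "\<lambda>m \<omega>. f (X j m \<omega>)" "\<lambda>\<omega>. f (X j 1 \<omega>)" "-1" 1
    "expectation (\<lambda>\<omega>. f (X j 1 \<omega>))"
  proof (unfold_locales; (intro AE_I2)?)
    have "indep_vars (\<lambda>_. borel) (\<lambda>m. (\<lambda>(j, i). X j i) (j, m)) {1..ns j}"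
      by (rule indep_vars_reindex[where I = "SIGMA j:{1..K}. {1..ns j}"])
        (use ks j in \<open>auto simp: k_sample_def inj_on_def\<close>)
    then have "indep_vars (\<lambda>_. borel) (\<lambda>m. X j m) {1..ns j}" by simp
    from indep_vars_compose2[OF this, of "\<lambda>_. f" "\<lambda>_. borel"]
    show "indep_vars (\<lambda>_. borel) (\<lambda>m \<omega>. f (X j m \<omega>)) {1..ns j}" by simp
    show "(\<lambda>\<omega>. f (X j 1 \<omega>)) \<in> borel_measurable M" using X[OF one] by simp
    show "f (X j 1 \<omega>) \<in> {-1..1}" for \<omega> using bound[of "X j 1 \<omega>"] by (auto simp: abs_le_iff)
    fix m assume m: "m \<in> {1..ns j}"
    have "distr M borel (\<lambda>\<omega>. f (X j i \<omega>)) = distr (\<mu> j) borel f" if "i \<in> {1..ns j}" for i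
      unfolding law[OF that, symmetric] by (subst distr_distr) (use X[OF that] in \<open>auto simp: o_def\<close>)
    then show "distr M borel (\<lambda>\<omega>. f (X j m \<omega>)) = distr M borel (\<lambda>\<omega>. f (X j 1 \<omega>))"
      using m one by simp
  qed auto
  have e: "expectation (\<lambda>\<omega>. f (X j 1 \<omega>)) = (\<integral>x. f x \<partial>\<mu> j)"
    unfolding law[OF one, symmetric] by (subst integral_distr[OF X[OF one]]) auto
  have "{1..ns j} \<noteq> {}" using ns by simp
  from H.Hoeffding_ineq_abs_ge'[OF \<epsilon> _ this] show ?thesis
    unfolding e by simp
qed

lemma integral_empirical_law:
  fixes \<phi> :: "real^'d \<Rightarrow> real"
  assumes "bij_betw h {1..n} A" "\<phi> \<in> borel_measurable borel"
  shows "(\<integral>x. \<phi> x \<partial>empirical_law A) = (\<Sum>i=1..n. \<phi> (h i)) / real n"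
proof -
  have A: "finite A" "card A = n" using assms(1) bij_betw_finite bij_betw_same_card by fastforce+
  have "(\<integral>x. \<phi> x \<partial>empirical_law A) = (\<integral>x. \<phi> x \<partial>uniform_count_measure A)"
    unfolding empirical_law_def using assms(2) by (intro integral_distr) (auto simp: measurable_def sets_uniform_count_measure space_uniform_count_measure)
  also have "\<dots> = (\<Sum>x\<in>A. \<phi> x) / real n"
    using A by (simp add: integral_uniform_count_measure)
  also have "(\<Sum>x\<in>A. \<phi> x) = (\<Sum>i=1..n. \<phi> (h i))"
    by (rule sum.reindex_bij_betw[OF assms(1), symmetric])
  finally show ?thesis .
qed

text \<open>A tent is at most 1 and supported in a cube of side 2 / N, and 2 / N \<le> 4 / (N + 1).
  The bound is put in terms of N + 1 to match the cap B / (N + 1)^d of the cell argument.\<close>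

lemma integral_bump_uniform_cube:
  fixes c :: "'d::finite \<Rightarrow> int"
  assumes N: "N > 0"
  shows "(\<integral>x. bump N c x \<partial>uniform_cube) \<le> (4 / (real N + 1)) ^ CARD('d)"
proof -
  let ?a = "(\<chi> i. (of_int (c i) - 1) / real N) :: real^'d" and ?b = "(\<chi> i. (of_int (c i) + 1) / real N) :: real^'d"
  have one: "emeasure lborel (cbox 0 (1::real^'d)) = 1"
  proof -
    have "measure lborel (cbox 0 (1::real^'d)) = 1"
      by (subst content_cbox_cart) (auto simp: interval_ne_empty_cart)
    then show ?thesis
      using emeasure_eq_ennreal_measure[of lborel "cbox 0 (1::real^'d)"] emeasure_lborel_cbox_finite[of 0 "1::real^'d"]
      by simp
  qed
  interpret U: prob_space "uniform_cube :: (real^'d) measure"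
    unfolding uniform_cube_def by (rule prob_space_uniform_measure) (simp_all add: one)
  have sets: "sets (uniform_cube :: (real^'d) measure) = sets borel" by (simp add: uniform_cube_def)
  have sub: "bump N c x \<le> indicator (cbox ?a ?b) x" for x
  proof (cases "bump N c x = 0")
    case False
    then have "bump N c x > 0" using bump_nonneg[of N c x] by linarith
    then have "\<bar>real N * x $ i - of_int (c i)\<bar> < 1" for i unfolding bump_pos_iff by blast
    then have "of_int (c i) - 1 \<le> x $ i * real N" "x $ i * real N \<le> of_int (c i) + 1" for i
      by (simp_all add: abs_less_iff mult.commute) (smt (verit))+
    then have "x \<in> cbox ?a ?b" using N by (simp add: mem_box_cart divide_le_eq le_divide_eq)
    then show ?thesis using bump_le_1 by simp
  qed simp
  have "(\<integral>x. bump N c x \<partial>uniform_cube) \<le> (\<integral>x. indicator (cbox ?a ?b) x \<partial>uniform_cube)"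
  proof (rule integral_mono)
    show "integrable uniform_cube (bump N c)"
      using continuous_on_bump[of UNIV N c] bump_nonneg[of N c] bump_le_1[of N c]
      by (intro U.integrable_const_bound[of _ 1])
        (auto simp: sets borel_measurable_continuous_onI cong: measurable_cong_sets)
    show "integrable uniform_cube (indicat_real (cbox ?a ?b))"
      by (intro integrable_real_indicator) (auto simp: sets U.emeasure_eq_measure)
  qed (rule sub)
  also have "\<dots> = measure uniform_cube (cbox ?a ?b)" by (simp add: sets sets_eq_imp_space_eq[OF sets])
  also have "\<dots> = measure lborel (cbox 0 1 \<inter> cbox ?a ?b)"
    unfolding uniform_cube_def using one by (subst measure_uniform_measure) (auto simp: measure_def)
  also have "\<dots> \<le> measure lborel (cbox ?a ?b)"
    by (rule measure_mono_fmeasurable) (auto simp: fmeasurable_cbox)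
  also have "\<dots> = (2 / real N) ^ CARD('d)"
  proof -
    have ne: "cbox ?a ?b \<noteq> {}" using N by (simp add: interval_ne_empty_cart divide_right_mono)
    have "(\<Prod>i\<in>(UNIV::'d set). ?b $ i - ?a $ i) = (\<Prod>i\<in>(UNIV::'d set). 2 / real N)"
      by (intro prod.cong) (auto simp: diff_divide_distrib[symmetric])
    then show ?thesis by (subst content_cbox_cart[OF ne]) simp
  qed
  also have "\<dots> \<le> (4 / (real N + 1)) ^ CARD('d)"
    using N by (intro power_mono) (auto simp: field_simps)
  finally show ?thesis .
qed

text \<open>The functions max 0 (1 - m * infdist x A) are m-Lipschitz and converge to the indicator
  of a nonempty closed A, so integrals of Lipschitz functions determine the measure of closed sets,
  an intersection-stable generator of the Borel sets.\<close>

lemma lipschitz_separating_function: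
  fixes \<mu> \<nu> :: "(real^'d) measure"
  assumes \<mu>: "prob_space \<mu>" "sets \<mu> = sets borel" and \<nu>: "prob_space \<nu>" "sets \<nu> = sets borel"
    and ne: "\<mu> \<noteq> \<nu>"
  shows "\<exists>(f :: real^'d \<Rightarrow> real) k. k \<ge> 0 \<and> (\<forall>x. \<bar>f x\<bar> \<le> 1) \<and> (\<forall>x y. \<bar>f x - f y\<bar> \<le> k * norm (x - y)) \<and>
    (\<integral>x. f x \<partial>\<mu>) \<noteq> (\<integral>x. f x \<partial>\<nu>)"
proof (rule ccontr)
  assume neg: "\<not> ?thesis"
  have eq: "(\<integral>x. f x \<partial>\<mu>) = (\<integral>x. f x \<partial>\<nu>)"
    if "k \<ge> 0" "\<And>x. \<bar>f x\<bar> \<le> 1" "\<And>x y. \<bar>f x - f y\<bar> \<le> k * norm (x - y)" for f :: "real^'d \<Rightarrow> real" and k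
    using neg that by blast
  define f where "f A m x = max 0 (1 - real m * infdist x A)" for A :: "(real^'d) set" and m x
  have f_bound: "\<bar>f A m x\<bar> \<le> 1" for A m x
    using infdist_nonneg[of x A] by (auto simp: f_def)
  have f_lip: "\<bar>f A m x - f A m y\<bar> \<le> real m * norm (x - y)" for A m x y
  proof -
    have "\<bar>f A m x - f A m y\<bar> \<le> \<bar>real m * infdist x A - real m * infdist y A\<bar>"
      unfolding f_def by linarith
    also have "\<dots> = real m * \<bar>infdist x A - infdist y A\<bar>"
      by (simp add: right_diff_distrib[symmetric] abs_mult)
    also have "\<dots> \<le> real m * norm (x - y)"
      using infdist_triangle_abs[of x A y] by (intro mult_left_mono) (auto simp: dist_norm)
    finally show ?thesis .
  qed
  have f_meas: "f A m \<in> borel_measurable borel" for A m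
    unfolding f_def by (intro borel_measurable_continuous_onI continuous_intros)
  have f_lim: "(\<lambda>m. f A m x) \<longlonglongrightarrow> indicator A x" if A: "closed A" "A \<noteq> {}" for A x
  proof (cases "x \<in> A")
    case True
    then show ?thesis by (simp add: f_def)
  next
    case False
    then have pos: "infdist x A > 0"
      using A infdist_pos_not_in_closed by blast
    obtain m0 :: nat where m0: "1 / infdist x A < real m0" using reals_Archimedean2 by blast
    have "f A m x = 0" if "m \<ge> m0" for m
    proof -
      have "1 / infdist x A \<le> real m" using m0 that by linarith
      then have "1 \<le> real m * infdist x A" using pos by (simp add: field_simps)
      then show ?thesis by (simp add: f_def)
    qed
    then have "eventually (\<lambda>m. f A m x = 0) sequentially" by (auto simp: eventually_sequentially)
    then show ?thesis using False by (simp add: tendsto_eventually)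
  qed
  have lim: "(\<lambda>m. \<integral>x. f A m x \<partial>\<rho>) \<longlonglongrightarrow> measure \<rho> A"
    if A: "closed A" "A \<noteq> {}" and \<rho>: "prob_space \<rho>" "sets \<rho> = sets borel" for A \<rho>
  proof -
    interpret prob_space \<rho> by fact
    have "(\<lambda>m. \<integral>x. f A m x \<partial>\<rho>) \<longlonglongrightarrow> (\<integral>x. indicator A x \<partial>\<rho>)"
    proof (rule integral_dominated_convergence[where w = "\<lambda>_. 1"])
      show "indicat_real A \<in> borel_measurable \<rho>" using A \<rho> by (simp add: borel_measurable_indicator)
      show "f A m \<in> borel_measurable \<rho>" for m
        using f_meas \<rho> by (simp cong: measurable_cong_sets)
      show "AE x in \<rho>. (\<lambda>m. f A m x) \<longlonglongrightarrow> indicat_real A x" using f_lim[OF A] by simp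
      show "AE x in \<rho>. norm (f A m x) \<le> 1" for m using f_bound by simp
    qed simp
    then show ?thesis using A \<rho> by (simp add: sets_eq_imp_space_eq[OF \<rho>(2)])
  qed
  have "\<mu> = \<nu>"
  proof (rule measure_eqI_generator_eq[where E = "Collect closed" and \<Omega> = UNIV and A = "\<lambda>_. UNIV"])
    show "Int_stable (Collect closed :: (real^'d) set set)" by (auto simp: Int_stable_def)
    have "sets borel = sigma_sets UNIV (Collect closed :: (real^'d) set set)"
      unfolding borel_eq_closed by simp
    then show "sets \<mu> = sigma_sets UNIV (Collect closed)" "sets \<nu> = sigma_sets UNIV (Collect closed)"
      using \<mu> \<nu> by auto
    show "emeasure \<mu> UNIV \<noteq> \<infinity>"
      using prob_space.emeasure_space_1[OF \<mu>(1)] sets_eq_imp_space_eq[OF \<mu>(2)] by simp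
    fix A :: "(real^'d) set" assume "A \<in> Collect closed"
    then have A: "closed A" by simp
    show "emeasure \<mu> A = emeasure \<nu> A"
    \<comment> \<open>For the empty set \<open>infdist\<close> is 0 by convention and the
      approximation would converge to 1, so this set is treated apart.\<close>
    proof (cases "A = {}")
      case False
      have "(\<lambda>m. \<integral>x. f A m x \<partial>\<mu>) = (\<lambda>m. \<integral>x. f A m x \<partial>\<nu>)"
      proof
        fix m show "(\<integral>x. f A m x \<partial>\<mu>) = (\<integral>x. f A m x \<partial>\<nu>)"
          by (rule eq[of "real m", OF _ f_bound f_lip]) simp
      qed
      then have "measure \<mu> A = measure \<nu> A"
        using lim[OF A False \<mu>] lim[OF A False \<nu>] LIMSEQ_unique by metis
      then show ?thesis
        using \<mu>(1) \<nu>(1) by (simp add: finite_measure.emeasure_eq_measure prob_space.finite_measure)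
    qed simp
  qed auto
  then show False using ne by simp
qed

text \<open>Dominated convergence along integer radii, then monotonicity in R. Stating it for all
  larger R allows one radius to serve two laws.\<close>

lemma tail_bound:
  fixes \<mu> :: "(real^'d) measure"
  assumes \<mu>: "prob_space \<mu>" "sets \<mu> = sets borel" and \<eta>: "(\<eta>::real) > 0"
  shows "\<exists>r::nat. \<forall>R\<ge>real r. (\<integral>x. (if norm x \<le> R then 0 else 1) \<partial>\<mu>) < \<eta>"
proof -
  interpret prob_space \<mu> by fact
  have "(\<lambda>m. \<integral>x. (if norm x \<le> real m then 0 else 1 :: real) \<partial>\<mu>) \<longlonglongrightarrow> (\<integral>x. 0 \<partial>\<mu>)"
  proof (rule integral_dominated_convergence[where w = "\<lambda>_. 1"])
    show "(\<lambda>x. if norm x \<le> real m then 0 else 1 :: real) \<in> borel_measurable \<mu>" for m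
      using \<mu>(2) by (simp cong: measurable_cong_sets)
    show "AE x in \<mu>. (\<lambda>m. if norm x \<le> real m then 0 else 1 :: real) \<longlonglongrightarrow> 0"
    proof (intro AE_I2 tendsto_eventually)
      fix x :: "real^'d"
      obtain m0 :: nat where "norm x < real m0" using reals_Archimedean2 by blast
      then show "\<forall>\<^sub>F m in sequentially. (if norm x \<le> real m then 0 else 1 :: real) = 0"
        unfolding eventually_sequentially by (intro exI[of _ m0]) auto
    qed
  qed auto
  then have "\<forall>\<^sub>F m in sequentially. (\<integral>x. (if norm x \<le> real m then 0 else 1) \<partial>\<mu>) < \<eta>"
    using \<eta> by (intro order_tendstoD(2)) auto
  then obtain m where m: "(\<integral>x. (if norm x \<le> real m then 0 else 1) \<partial>\<mu>) < \<eta>"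
    by (auto simp: eventually_sequentially)
  show ?thesis
  proof (intro exI[of _ m] allI impI)
    fix R assume R: "real m \<le> R"
    have int: "integrable \<mu> (\<lambda>x. if norm x \<le> r then 0 else 1 :: real)" for r
      using \<mu>(2) by (intro integrable_const_bound[of _ 1]) (auto cong: measurable_cong_sets)
    have "(\<integral>x. (if norm x \<le> R then 0 else 1 :: real) \<partial>\<mu>) \<le> (\<integral>x. (if norm x \<le> real m then 0 else 1) \<partial>\<mu>)"
      by (rule integral_mono[OF int int]) (use R in auto)
    then show "(\<integral>x. (if norm x \<le> R then 0 else 1) \<partial>\<mu>) < \<eta>" using m by linarith
  qed
qed

text \<open>The statistic compares neighbouring groups only, so the alternative is reduced to such a
  pair: equality along the chain would give equality throughout.\<close>

lemma adjacent_laws_differ: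
  assumes "\<not> null_hypothesis K \<mu>"
  shows "\<exists>j\<in>{1..K - 1}. \<mu> j \<noteq> \<mu> (j + 1)"
proof (rule ccontr)
  assume "\<not> ?thesis"
  then have step: "\<mu> j = \<mu> (j + 1)" if "j \<in> {1..K - 1}" for j using that by blast
  have "j \<le> K \<Longrightarrow> 1 \<le> j \<Longrightarrow> \<mu> j = \<mu> 1" for j
  proof (induction j)
    case (Suc j)
    then show ?case using step[of j] by (cases "j = 0") auto
  qed simp
  then have "null_hypothesis K \<mu>" unfolding null_hypothesis_def by (metis atLeastAtMost_iff)
  then show False using assms by simp
qed

text \<open>The assignment permutes the reference points, so enlarging the group to the whole pool
  turns its sum into the sum over all points. The bound holds for every sample, whichever ranks the
  group receives.\<close>

lemma avg_sample_group_le: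
  assumes n: "n = (\<Sum>k=1..K. ns k)" and j: "j \<in> {1..K}" and \<phi>: "\<And>x. \<phi> x \<ge> 0" and n0: "n \<ge> 1"
  shows "avg (sample_group ns j) (\<lambda>a. \<phi> (empirical_rank n W h a))
      \<le> real n / real (ns j) * ((\<Sum>i=1..n. \<phi> (h i)) / real n)"
proof -
  have "(\<Sum>a\<in>sample_group ns j. \<phi> (empirical_rank n W h a)) \<le> (\<Sum>a=1..n. \<phi> (h (opt_assignment n W h a)))"
    unfolding empirical_rank_def using sample_group_subset[OF j, of ns] \<phi> n by (intro sum_mono2) auto
  also have "\<dots> = (\<Sum>i=1..n. \<phi> (h i))"
    using sum.permute[OF opt_assignment_permutes, of "\<lambda>i. \<phi> (h i)" n W h] by (simp add: o_def)
  finally show ?thesis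
    unfolding avg_def card_sample_group using n0 by (simp add: divide_right_mono)
qed

section \<open>Separation under the alternative\<close>

text \<open>Deterministic core of consistency: \<open>N\<close> and \<open>\<delta>\<close> precede
  group sizes, points and sample. Of the gap 3 \<Delta> / 4, tails and grid error use up at most 3
  \<Delta> / 8, so the cell differences sum to more than \<Delta> / 8 and some cell shows a
  difference that the energy detects.\<close>

lemma rank_energy_lower_bound:
  fixes f :: "real^'d \<Rightarrow> real"
  assumes k: "k \<ge> 0" and R: "R \<ge> 0" and B: "B \<ge> 0" and \<Delta>: "\<Delta> > 0"
    and f: "\<And>x. \<bar>f x\<bar> \<le> 1" "\<And>x y. \<bar>f x - f y\<bar> \<le> k * norm (x - y)"
  obtains N :: nat and \<delta> :: real where "N > 0" "\<delta> > 0"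
    "\<And>K ns n (W :: nat \<Rightarrow> real^'d) h i j. i \<in> {1..K} \<Longrightarrow> j \<in> {1..K} \<Longrightarrow> i \<noteq> j \<Longrightarrow> ns i \<ge> 1 \<Longrightarrow> ns j \<ge> 1 \<Longrightarrow>
       n = (\<Sum>k=1..K. ns k) \<Longrightarrow> (\<And>a. a \<in> {1..n} \<Longrightarrow> h a \<in> cbox 0 1) \<Longrightarrow>
       (\<And>c. c \<in> grid N \<Longrightarrow> avg (sample_group ns i) (\<lambda>a. bump N c (empirical_rank n W h a)) \<le> B / (real N + 1) ^ CARD('d)) \<Longrightarrow>
       (\<And>c. c \<in> grid N \<Longrightarrow> avg (sample_group ns j) (\<lambda>a. bump N c (empirical_rank n W h a)) \<le> B / (real N + 1) ^ CARD('d)) \<Longrightarrow>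
       avg (sample_group ns i) (\<lambda>a. if norm (W a) \<le> R then 0 else 1) \<le> \<Delta> / 16 \<Longrightarrow>
       avg (sample_group ns j) (\<lambda>a. if norm (W a) \<le> R then 0 else 1) \<le> \<Delta> / 16 \<Longrightarrow>
       3 * \<Delta> / 4 \<le> \<bar>avg (sample_group ns i) (\<lambda>a. f (W a)) - avg (sample_group ns j) (\<lambda>a. f (W a))\<bar> \<Longrightarrow>
       \<delta> \<le> rank_energy ns (empirical_rank n W h) i j"
proof -
  obtain N :: nat where N: "N > 0"
    and NN: "\<And>(A :: nat set) A' (x :: nat \<Rightarrow> real^'d) y f. finite A \<Longrightarrow> finite A' \<Longrightarrow>
      (\<And>a. a \<in> A \<union> A' \<Longrightarrow> y a \<in> cbox 0 1) \<Longrightarrow>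
      (\<And>a b. a \<in> A \<union> A' \<Longrightarrow> b \<in> A \<union> A' \<Longrightarrow> (x a - x b) \<bullet> (y a - y b) \<ge> 0) \<Longrightarrow>
      (\<And>u. \<bar>f u\<bar> \<le> 1) \<Longrightarrow> (\<And>u v. \<bar>f u - f v\<bar> \<le> k * norm (u - v)) \<Longrightarrow>
      (\<And>c. c \<in> grid N \<Longrightarrow> avg A (\<lambda>a. bump N c (y a)) \<le> B / (real N + 1) ^ CARD('d)) \<Longrightarrow>
      (\<And>c. c \<in> grid N \<Longrightarrow> avg A' (\<lambda>a. bump N c (y a)) \<le> B / (real N + 1) ^ CARD('d)) \<Longrightarrow>
      \<bar>avg A (\<lambda>a. f (x a)) - avg A' (\<lambda>a. f (x a))\<bar> \<le>
        (\<Sum>c\<in>grid N. \<bar>avg A (\<lambda>a. bump N c (y a)) - avg A' (\<lambda>a. bump N c (y a))\<bar>)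
        + 2 * avg A (\<lambda>a. if norm (x a) \<le> R then 0 else 1)
        + 2 * avg A' (\<lambda>a. if norm (x a) \<le> R then 0 else 1) + \<Delta> / 8"
    by (rule exists_grid[where 'i = nat and 'd = 'd, OF k R B, of "\<Delta> / 8"]) (use \<Delta> in auto)
  let ?g = "grid N :: ('d \<Rightarrow> int) set"
  \<comment> \<open>The pigeonhole share of \<Delta> / 8 per cell.\<close>
  define \<epsilon> where "\<epsilon> = \<Delta> / (8 * real (card ?g))"
  have cg: "card ?g > 0" by (simp add: card_grid)
  have \<epsilon>: "\<epsilon> > 0" using \<Delta> cg by (simp add: \<epsilon>_def)
  have ex: "\<exists>\<delta>>0. \<forall>(I :: nat set) w y. finite I \<longrightarrow> (\<forall>a\<in>I. y a \<in> cbox 0 1) \<longrightarrow> (\<Sum>a\<in>I. w a) = 0 \<longrightarrow>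
      (\<Sum>a\<in>I. \<bar>w a\<bar>) \<le> 2 \<longrightarrow> \<epsilon> \<le> \<bar>\<Sum>a\<in>I. w a * bump N c (y a)\<bar> \<longrightarrow> \<delta> \<le> energy I w y" for c :: "'d \<Rightarrow> int"
  proof -
    have "continuous_on (cbox 0 1) (bump N c)" by (rule continuous_on_bump)
    show ?thesis
      by (rule energy_separates[where 'i = nat, OF compact_cbox \<open>continuous_on _ _\<close> \<epsilon>]) blast
  qed
  have "\<forall>c :: 'd \<Rightarrow> int. \<exists>\<delta>>0. \<forall>(I :: nat set) w y. finite I \<longrightarrow> (\<forall>a\<in>I. y a \<in> cbox 0 1) \<longrightarrow> (\<Sum>a\<in>I. w a) = 0 \<longrightarrow>
      (\<Sum>a\<in>I. \<bar>w a\<bar>) \<le> 2 \<longrightarrow> \<epsilon> \<le> \<bar>\<Sum>a\<in>I. w a * bump N c (y a)\<bar> \<longrightarrow> \<delta> \<le> energy I w y"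
    by (intro allI ex)
  from choice[OF this] obtain \<delta> :: "('d \<Rightarrow> int) \<Rightarrow> real" where \<delta>: "\<forall>c. \<delta> c > 0 \<and> (\<forall>(I :: nat set) w y. finite I \<longrightarrow> (\<forall>a\<in>I. y a \<in> cbox 0 1) \<longrightarrow>
      (\<Sum>a\<in>I. w a) = 0 \<longrightarrow> (\<Sum>a\<in>I. \<bar>w a\<bar>) \<le> 2 \<longrightarrow> \<epsilon> \<le> \<bar>\<Sum>a\<in>I. w a * bump N c (y a)\<bar> \<longrightarrow> \<delta> c \<le> energy I w y)" ..
  note \<delta>_pos = \<delta>[THEN spec, THEN conjunct1] and \<delta>_le = \<delta>[THEN spec, THEN conjunct2, rule_format]
  \<comment> \<open>There is one constant per tent; the minimum over the finite grid serves
    whichever cell turns out to differ.\<close>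
  define \<delta>0 where "\<delta>0 = Min (\<delta> ` ?g)"
  have fin: "finite (\<delta> ` ?g)" "\<delta> ` ?g \<noteq> {}" using cg finite_grid by (auto simp: card_gt_0_iff)
  show thesis
  proof (rule that[OF N])
    show "\<delta>0 > 0" unfolding \<delta>0_def using fin \<delta>_pos by (subst Min_gr_iff) auto
    fix K ns n h i j and W :: "nat \<Rightarrow> real^'d"
    assume ij: "i \<in> {1..K}" "j \<in> {1..K}" "i \<noteq> j" "ns i \<ge> 1" "ns j \<ge> 1"
      and n: "n = (\<Sum>k=1..K. ns k)" and h: "\<And>a. a \<in> {1..n} \<Longrightarrow> h a \<in> cbox 0 1"
      and bi: "\<And>c. c \<in> grid N \<Longrightarrow> avg (sample_group ns i) (\<lambda>a. bump N c (empirical_rank n W h a)) \<le> B / (real N + 1) ^ CARD('d)"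
      and bj: "\<And>c. c \<in> grid N \<Longrightarrow> avg (sample_group ns j) (\<lambda>a. bump N c (empirical_rank n W h a)) \<le> B / (real N + 1) ^ CARD('d)"
      and ti: "avg (sample_group ns i) (\<lambda>a. if norm (W a) \<le> R then 0 else 1) \<le> \<Delta> / 16"
      and tj: "avg (sample_group ns j) (\<lambda>a. if norm (W a) \<le> R then 0 else 1) \<le> \<Delta> / 16"
      and diff: "3 * \<Delta> / 4 \<le> \<bar>avg (sample_group ns i) (\<lambda>a. f (W a)) - avg (sample_group ns j) (\<lambda>a. f (W a))\<bar>"
    let ?A = "sample_group ns i" and ?B = "sample_group ns j" and ?r = "empirical_rank n W h"
    have sub: "?A \<union> ?B \<subseteq> {1..n}" using sample_group_subset ij unfolding n by blast
    have r: "?r a \<in> cbox 0 1" if "a \<in> {1..n}" for a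
      unfolding empirical_rank_def
      using that permutes_in_image[OF opt_assignment_permutes[of n W h], of a] by (intro h) auto
    have "\<bar>avg ?A (\<lambda>a. f (W a)) - avg ?B (\<lambda>a. f (W a))\<bar> \<le>
        (\<Sum>c\<in>?g. \<bar>avg ?A (\<lambda>a. bump N c (?r a)) - avg ?B (\<lambda>a. bump N c (?r a))\<bar>)
        + 2 * avg ?A (\<lambda>a. if norm (W a) \<le> R then 0 else 1)
        + 2 * avg ?B (\<lambda>a. if norm (W a) \<le> R then 0 else 1) + \<Delta> / 8"
      by (rule NN[OF finite_sample_group finite_sample_group _ _ f bi bj])
        (use sub r empirical_rank_monotone[of _ n _ W h] in blast)+
    then have S: "(\<Sum>c\<in>?g. \<bar>avg ?A (\<lambda>a. bump N c (?r a)) - avg ?B (\<lambda>a. bump N c (?r a))\<bar>) > \<Delta> / 8"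
      using diff ti tj \<Delta> by linarith
    have "\<exists>c\<in>?g. \<epsilon> \<le> \<bar>avg ?A (\<lambda>a. bump N c (?r a)) - avg ?B (\<lambda>a. bump N c (?r a))\<bar>"
    proof (rule ccontr)
      assume "\<not> ?thesis"
      then have "(\<Sum>c\<in>?g. \<bar>avg ?A (\<lambda>a. bump N c (?r a)) - avg ?B (\<lambda>a. bump N c (?r a))\<bar>) \<le> (\<Sum>c\<in>?g. \<epsilon>)"
        by (intro sum_mono) (auto simp: not_le less_imp_le)
      also have "\<dots> = \<Delta> / 8" using cg by (simp add: \<epsilon>_def)
      finally show False using S by simp
    qed
    then obtain c where c: "c \<in> ?g" "\<epsilon> \<le> \<bar>avg ?A (\<lambda>a. bump N c (?r a)) - avg ?B (\<lambda>a. bump N c (?r a))\<bar>" by blast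
    have ne: "?A \<noteq> {}" "?B \<noteq> {}" using ij card_sample_group[of ns i] card_sample_group[of ns j] by auto
    note disj = sample_group_disjoint[OF ij(1-3), of ns]
    have "\<delta> c \<le> energy (?A \<union> ?B) (two_weights ?A ?B) ?r"
    proof (rule \<delta>_le)
      show "?r a \<in> cbox 0 1" if "a \<in> ?A \<union> ?B" for a using that sub r by blast
      show "\<epsilon> \<le> \<bar>\<Sum>a\<in>?A \<union> ?B. two_weights ?A ?B a * bump N c (?r a)\<bar>"
        using c(2) unfolding sum_two_weights[OF finite_sample_group finite_sample_group disj] .
    qed (use sum_two_weights_zero[OF finite_sample_group finite_sample_group disj ne] finite_sample_group in auto)
    then have "\<delta> c \<le> rank_energy ns ?r i j" unfolding rank_energy_eq_energy[OF ij(1-3)] .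
    moreover have "\<delta>0 \<le> \<delta> c" unfolding \<delta>0_def using fin c by (intro Min_le) auto
    ultimately show "\<delta>0 \<le> rank_energy ns ?r i j" by linarith
  qed
qed

section \<open>Consistency of the test\<close>

theorem rank_energy_test_consistent:
  fixes H :: "nat \<Rightarrow> (real^'d) set" and h :: "nat \<Rightarrow> nat \<Rightarrow> real^'d" and M :: "nat \<Rightarrow> 'c measure"
  assumes K: "K \<ge> 2" and H_cube: "\<And>n. H n \<subseteq> cbox 0 1" and H_enum: "\<And>n. bij_betw (h n) {1..n} (H n)"
    and sum_ns: "\<And>n. (\<Sum>j=1..K. ns n j) = n"
    and lam_pos: "\<And>j. j \<in> {1..K} \<Longrightarrow> 0 < lam j"
    and lam: "\<And>j. j \<in> {1..K} \<Longrightarrow> (\<lambda>n. real (ns n j) / real n) \<longlonglongrightarrow> lam j"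
    and weak: "weakly_converges (\<lambda>n. empirical_law (H n)) uniform_cube"
    and \<alpha>: "0 < \<alpha>" "\<alpha> < 1" and \<nu>: "abs_cont_law \<nu>"
    and ac: "\<And>j. j \<in> {1..K} \<Longrightarrow> abs_cont_law (\<mu> j)" and alt: "\<not> null_hypothesis K \<mu>"
    and ks: "\<And>n. k_sample (M n) K (ns n) (X n) \<mu>"
  shows "(\<lambda>n. measure (M n) {\<omega> \<in> space (M n). real n * RE2 K (ns n) (h n) (\<lambda>j i. X n j i \<omega>)
        \<ge> critical_value \<nu> \<alpha> K (ns n) (h n)}) \<longlonglongrightarrow> 1"
proof -
  have h_cube: "h n a \<in> cbox 0 1" if "a \<in> {1..n}" for n a
    using H_enum[of n] H_cube[of n] that unfolding bij_betw_def by blast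
  have h_inj: "inj_on (h n) {1..n}" for n using H_enum[of n] by (simp add: bij_betw_def)
  obtain j where j0: "j \<in> {1..K - 1}" "\<mu> j \<noteq> \<mu> (j + 1)" using adjacent_laws_differ[OF alt] by blast
  define j' where "j' = j + 1"
  have j: "j \<in> {1..K}" "j' \<in> {1..K}" "j \<noteq> j'" and ne: "\<mu> j \<noteq> \<mu> j'"
    using j0 by (auto simp: j'_def)
  have pj: "prob_space (\<mu> i)" "sets (\<mu> i) = sets borel" if "i \<in> {1..K}" for i
    using ac[OF that] by (auto simp: abs_cont_law_def)
  obtain f :: "real^'d \<Rightarrow> real" and k where f: "k \<ge> 0" "\<And>x. \<bar>f x\<bar> \<le> 1" "\<And>x y. \<bar>f x - f y\<bar> \<le> k * norm (x - y)"
    and f_ne: "(\<integral>x. f x \<partial>\<mu> j) \<noteq> (\<integral>x. f x \<partial>\<mu> j')"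
    using lipschitz_separating_function[OF pj[OF j(1)] pj[OF j(2)] ne] by blast
  have f_meas: "f \<in> borel_measurable borel"
  proof (intro borel_measurable_continuous_onI continuous_at_imp_continuous_on ballI)
    have "k-lipschitz_on UNIV f"
      using f by (intro lipschitz_onI) (auto simp: dist_norm)
    then show "isCont f x" for x
      using lipschitz_on_continuous_on by (metis UNIV_I continuous_on_eq_continuous_within)
  qed
  define \<Delta> where "\<Delta> = \<bar>(\<integral>x. f x \<partial>\<mu> j) - (\<integral>x. f x \<partial>\<mu> j')\<bar>"
  have \<Delta>: "\<Delta> > 0" using f_ne by (simp add: \<Delta>_def)
  define t where "t R x = (if norm x \<le> R then 0 else 1 :: real)" for R and x :: "real^'d"
  have t_meas: "t R \<in> borel_measurable borel" for R unfolding t_def by measurable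
  have t_bound: "\<bar>t R x\<bar> \<le> 1" for R x by (simp add: t_def)
  obtain r1 r2 :: nat where r: "\<And>R. R \<ge> real r1 \<Longrightarrow> (\<integral>x. t R x \<partial>\<mu> j) < \<Delta> / 32"
      "\<And>R. R \<ge> real r2 \<Longrightarrow> (\<integral>x. t R x \<partial>\<mu> j') < \<Delta> / 32"
    using tail_bound[OF pj[OF j(1)], of "\<Delta> / 32"] tail_bound[OF pj[OF j(2)], of "\<Delta> / 32"] \<Delta>
    unfolding t_def by (metis divide_pos_pos zero_less_numeral)
  define R where "R = real (max r1 r2)"
  have R: "R \<ge> 0" "(\<integral>x. t R x \<partial>\<mu> j) < \<Delta> / 32" "(\<integral>x. t R x \<partial>\<mu> j') < \<Delta> / 32"
    using r by (auto simp: R_def)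
  define l0 where "l0 = min (lam j) (lam j')"
  have l0: "l0 > 0" "l0 \<le> lam j" "l0 \<le> lam j'" using lam_pos j by (auto simp: l0_def)
  \<comment> \<open>Eventually 2 / l0 bounds n / n_j, and 2 * 4^d / (N + 1)^d bounds the average of
    a tent over the reference points; the product is B / (N + 1)^d.\<close>
  define B where "B = 4 * 4 ^ CARD('d) / l0"
  have B: "B \<ge> 0" using l0 by (simp add: B_def)
  obtain N \<delta> where N: "N > 0" and \<delta>: "\<delta> > 0" and energy_ge:
    "\<And>K ns n (W :: nat \<Rightarrow> real^'d) h i j. i \<in> {1..K} \<Longrightarrow> j \<in> {1..K} \<Longrightarrow> i \<noteq> j \<Longrightarrow> ns i \<ge> 1 \<Longrightarrow> ns j \<ge> 1 \<Longrightarrow>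
       n = (\<Sum>k=1..K. ns k) \<Longrightarrow> (\<And>a. a \<in> {1..n} \<Longrightarrow> h a \<in> cbox 0 1) \<Longrightarrow>
       (\<And>c. c \<in> grid N \<Longrightarrow> avg (sample_group ns i) (\<lambda>a. bump N c (empirical_rank n W h a)) \<le> B / (real N + 1) ^ CARD('d)) \<Longrightarrow>
       (\<And>c. c \<in> grid N \<Longrightarrow> avg (sample_group ns j) (\<lambda>a. bump N c (empirical_rank n W h a)) \<le> B / (real N + 1) ^ CARD('d)) \<Longrightarrow>
       avg (sample_group ns i) (\<lambda>a. if norm (W a) \<le> R then 0 else 1) \<le> \<Delta> / 16 \<Longrightarrow>
       avg (sample_group ns j) (\<lambda>a. if norm (W a) \<le> R then 0 else 1) \<le> \<Delta> / 16 \<Longrightarrow>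
       3 * \<Delta> / 4 \<le> \<bar>avg (sample_group ns i) (\<lambda>a. f (W a)) - avg (sample_group ns j) (\<lambda>a. f (W a))\<bar> \<Longrightarrow>
       \<delta> \<le> rank_energy ns (empirical_rank n W h) i j"
    by (rule rank_energy_lower_bound[OF f(1) R(1) B \<Delta> f(2) f(3)]) blast

  \<comment> \<open>For small n groups may be empty. The positive limits \<open>lam i\<close>
    eventually force linear growth, with half the limit as a margin.\<close>
  have ev_ns: "\<forall>\<^sub>F n in sequentially. n \<ge> 1 \<and> (\<forall>i\<in>{1..K}. 1 \<le> ns n i \<and> real n * (lam i / 2) \<le> real (ns n i))"
  proof -
    have "\<forall>\<^sub>F n in sequentially. \<forall>i\<in>{1..K}. lam i / 2 < real (ns n i) / real n"
      using lam lam_pos by (intro eventually_ball_finite ballI order_tendstoD(1)[OF lam]) auto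
    moreover have "\<forall>\<^sub>F n in sequentially. n \<ge> (1::nat)" by (rule eventually_ge_at_top)
    ultimately show ?thesis
    proof eventually_elim
      case (elim n)
      have "1 \<le> ns n i \<and> real n * (lam i / 2) \<le> real (ns n i)" if "i \<in> {1..K}" for i
      proof
        have "lam i / 2 < real (ns n i) / real n" using elim that by blast
        then have lt: "real n * (lam i / 2) < real (ns n i)"
          using elim by (simp add: field_simps)
        then show "real n * (lam i / 2) \<le> real (ns n i)" by simp
        have "0 < real n * (lam i / 2)" using lam_pos[OF that] elim by simp
        then have "0 < ns n i" using lt by (metis less_trans of_nat_0_less_iff)
        then show "1 \<le> ns n i" by simp
      qed
      then show ?case using elim by blast
    qed
  qed
  have ns_top: "filterlim (\<lambda>n. real (ns n i)) at_top sequentially" if i: "i \<in> {1..K}" for i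
  proof (rule filterlim_at_top_mono)
    show "filterlim (\<lambda>n. real n * (lam i / 2)) at_top sequentially"
      using lam_pos[OF i]
      by (intro filterlim_at_top_mult_tendsto_pos[OF tendsto_const _ filterlim_real_sequentially]) simp
    show "\<forall>\<^sub>F n in sequentially. real n * (lam i / 2) \<le> real (ns n i)"
      using ev_ns by eventually_elim (use i in blast)
  qed

  \<comment> \<open>Weak convergence enters here, for the finitely many tents of the fixed grid; the
    factor 2 leaves room above the limit.\<close>
  have ev_bump: "\<forall>\<^sub>F n in sequentially. \<forall>c\<in>grid N. (\<Sum>i=1..n. bump N c (h n i)) / real n
      \<le> 2 * (4 / (real N + 1)) ^ CARD('d)"
  proof (intro eventually_ball_finite ballI finite_grid)
    fix c :: "'d \<Rightarrow> int"
    have "bounded (range (bump N c))"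
      using bump_nonneg[of N c] bump_le_1[of N c] by (intro boundedI[of _ 1]) auto
    then have "(\<lambda>n. \<integral>x. bump N c x \<partial>empirical_law (H n)) \<longlonglongrightarrow> (\<integral>x. bump N c x \<partial>uniform_cube)"
      using weak continuous_on_bump unfolding weakly_converges_def by blast
    moreover have "(\<integral>x. bump N c x \<partial>uniform_cube) < 2 * (4 / (real N + 1)) ^ CARD('d)"
    proof -
      have "0 < (4 / (real N + 1)) ^ CARD('d)" by simp
      then show ?thesis using integral_bump_uniform_cube[OF N, of c] by linarith
    qed
    ultimately have "\<forall>\<^sub>F n in sequentially. (\<integral>x. bump N c x \<partial>empirical_law (H n)) < 2 * (4 / (real N + 1)) ^ CARD('d)"
      by (rule order_tendstoD(2))
    then show "\<forall>\<^sub>F n in sequentially. (\<Sum>i=1..n. bump N c (h n i)) / real n \<le> 2 * (4 / (real N + 1)) ^ CARD('d)"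
    proof eventually_elim
      case (elim n)
      have "bump N c \<in> borel_measurable borel"
        by (intro borel_measurable_continuous_onI continuous_on_bump)
      from integral_empirical_law[OF H_enum[of n] this] show ?case using elim by simp
    qed
  qed

  \<comment> \<open>The \<delta> of the lower bound is used again, so n times the statistic reaches
    the critical value as soon as the statistic is at least \<delta>.\<close>
  have ev_crit: "\<forall>\<^sub>F n in sequentially. critical_value \<nu> \<alpha> K (ns n) (h n) \<le> real n * \<delta>"
  proof -
    define D where "D = diameter (cbox 0 (1::real^'d))"
    have D: "norm (h n a - h n b) \<le> D" if "a \<in> {1..n}" "b \<in> {1..n}" for n a b
      unfolding D_def dist_norm[symmetric] using h_cube that
      by (intro diameter_bounded_bound bounded_cbox)
    have D0: "D \<ge> 0" unfolding D_def by (rule diameter_ge_0[OF bounded_cbox])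
    have inv0: "(\<lambda>n. 1 / real (ns n i)) \<longlonglongrightarrow> 0" if "i \<in> {1..K}" for i
      using tendsto_inverse_0_at_top[OF ns_top[OF that]] by (simp add: divide_inverse)
    have "(\<lambda>n. D * (\<Sum>j=1..K-1. 1 / real (ns n j) + 1 / real (ns n (j + 1))) / \<delta>) \<longlonglongrightarrow> D * (\<Sum>j=1..K-1. 0 + 0) / \<delta>"
      using \<delta> by (intro tendsto_intros inv0) auto
    then have "\<forall>\<^sub>F n in sequentially. D * (\<Sum>j=1..K-1. 1 / real (ns n j) + 1 / real (ns n (j + 1))) / \<delta> < \<alpha>"
      using \<alpha> by (intro order_tendstoD(2)) auto
    then show ?thesis using ev_ns
    proof eventually_elim
      case (elim n)
      show ?case
        by (rule critical_value_le[OF \<nu> _ _ _ h_inj D D0 \<delta> _ \<alpha>(2)]) (use elim K sum_ns in auto)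
    qed
  qed

  define bad where "bad g i e n = {\<omega>\<in>space (M n). e \<le> \<bar>(\<Sum>m=1..ns n i. g (X n i m \<omega>)) / real (ns n i) - (\<integral>x. g x \<partial>\<mu> i)\<bar>}"
    for g :: "real^'d \<Rightarrow> real" and i e n
  have bad_meas: "bad g i e n \<in> sets (M n)" if "g \<in> borel_measurable borel" "i \<in> {1..K}" for g i e n
  proof -
    have "X n i m \<in> borel_measurable (M n)" if "m \<in> {1..ns n i}" for m
      by (rule k_sample_measurable[OF ks \<open>i \<in> {1..K}\<close> that])
    then have "(\<lambda>\<omega>. (\<Sum>m=1..ns n i. g (X n i m \<omega>)) / real (ns n i) - (\<integral>x. g x \<partial>\<mu> i)) \<in> borel_measurable (M n)"
      using that(1) by (intro borel_measurable_diff borel_measurable_divide borel_measurable_sum) auto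
    then show ?thesis unfolding bad_def by measurable
  qed
  have bad_lim: "(\<lambda>n. measure (M n) (bad g i e n)) \<longlonglongrightarrow> 0"
    if g: "g \<in> borel_measurable borel" "\<And>x. \<bar>g x\<bar> \<le> 1" and i: "i \<in> {1..K}" and e: "e > 0" for g i e
  proof (rule tendsto_sandwich)
    show "\<forall>\<^sub>F n in sequentially. 0 \<le> measure (M n) (bad g i e n)" by simp
    show "\<forall>\<^sub>F n in sequentially. measure (M n) (bad g i e n) \<le> 2 * exp (- (real (ns n i) * (e\<^sup>2 / 2)))"
      using ev_ns
    proof eventually_elim
      case (elim n)
      show ?case
        using k_sample_concentration[OF ks i _ g, of n e] elim i e unfolding bad_def by auto
    qed
    have "filterlim (\<lambda>n. real (ns n i) * (e\<^sup>2 / 2)) at_top sequentially"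
      using e by (intro filterlim_at_top_mult_tendsto_pos[OF tendsto_const _ ns_top[OF i]]) simp
    then have "(\<lambda>n. exp (- (real (ns n i) * (e\<^sup>2 / 2)))) \<longlonglongrightarrow> 0"
      by (intro filterlim_compose[OF exp_at_bot] filterlim_uminus_at_bot_at_top filterlim_compose[OF filterlim_uminus_at_bot_at_top])
    then show "(\<lambda>n. 2 * exp (- (real (ns n i) * (e\<^sup>2 / 2)))) \<longlonglongrightarrow> 0"
      by (rule tendsto_mult_right_zero)
  qed simp

  let ?S = "\<lambda>n. {\<omega> \<in> space (M n). real n * RE2 K (ns n) (h n) (\<lambda>j i. X n j i \<omega>) \<ge> critical_value \<nu> \<alpha> K (ns n) (h n)}"
  \<comment> \<open>The tolerances fit the lower bound: \<Delta> - 2 * \<Delta> / 8 = 3 \<Delta> / 4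
    for the means of f, and \<Delta> / 32 + \<Delta> / 32 = \<Delta> / 16 for the tails.\<close>
  define Bad where "Bad n = (bad f j (\<Delta> / 8) n \<union> bad f j' (\<Delta> / 8) n) \<union> (bad (t R) j (\<Delta> / 32) n \<union> bad (t R) j' (\<Delta> / 32) n)" for n
  define b where "b n = (measure (M n) (bad f j (\<Delta> / 8) n) + measure (M n) (bad f j' (\<Delta> / 8) n))
      + (measure (M n) (bad (t R) j (\<Delta> / 32) n) + measure (M n) (bad (t R) j' (\<Delta> / 32) n))" for n
  have b0: "b \<longlonglongrightarrow> (0 + 0) + (0 + 0)"
    unfolding b_def using \<Delta> by (intro tendsto_add bad_lim f_meas t_meas f t_bound j) auto
  have incl: "\<forall>\<^sub>F n in sequentially. space (M n) - Bad n \<subseteq> ?S n"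
    using ev_ns ev_bump ev_crit
  proof eventually_elim
    case (elim n)
    show ?case
    proof
      fix \<omega> assume \<omega>: "\<omega> \<in> space (M n) - Bad n"
      define W where "W = pooled_sample K (ns n) (\<lambda>j i. X n j i \<omega>)"
      have ns1: "1 \<le> ns n i" if "i \<in> {1..K}" for i using elim that by blast
      have avg_W: "avg (sample_group (ns n) i) (\<lambda>a. g (W a)) = (\<Sum>m=1..ns n i. g (X n i m \<omega>)) / real (ns n i)"
        if i: "i \<in> {1..K}" for g :: "real^'d \<Rightarrow> real" and i
      proof -
        have "(\<Sum>a\<in>sample_group (ns n) i. g (W a)) = (\<Sum>m=1..ns n i. g (W (pool_index (ns n) i m)))"
          by (rule sum_sample_group[symmetric])
        also have "\<dots> = (\<Sum>m=1..ns n i. g (X n i m \<omega>))"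
          unfolding W_def by (intro sum.cong refl arg_cong[where f = g] pooled_sample_pool_index[OF i])
        finally show ?thesis unfolding avg_def card_sample_group by simp
      qed
      have not_bad: "\<bar>avg (sample_group (ns n) i) (\<lambda>a. g (W a)) - (\<integral>x. g x \<partial>\<mu> i)\<bar> < e"
        if "\<omega> \<notin> bad g i e n" "i \<in> {1..K}" for g i e
        unfolding avg_W[OF that(2)] using that(1) \<omega> by (auto simp: bad_def)
      have fj: "\<bar>avg (sample_group (ns n) j) (\<lambda>a. f (W a)) - (\<integral>x. f x \<partial>\<mu> j)\<bar> < \<Delta> / 8"
        and fj': "\<bar>avg (sample_group (ns n) j') (\<lambda>a. f (W a)) - (\<integral>x. f x \<partial>\<mu> j')\<bar> < \<Delta> / 8"
        and tj: "\<bar>avg (sample_group (ns n) j) (\<lambda>a. t R (W a)) - (\<integral>x. t R x \<partial>\<mu> j)\<bar> < \<Delta> / 32"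
        and tj': "\<bar>avg (sample_group (ns n) j') (\<lambda>a. t R (W a)) - (\<integral>x. t R x \<partial>\<mu> j')\<bar> < \<Delta> / 32"
        using \<omega> j unfolding Bad_def by (blast intro: not_bad)+
      have bump_le: "avg (sample_group (ns n) i) (\<lambda>a. bump N c (empirical_rank n W (h n) a)) \<le> B / (real N + 1) ^ CARD('d)"
        if i: "i \<in> {1..K}" "l0 \<le> lam i" and c: "c \<in> grid N" for i c
      proof -
        have n1: "n \<ge> 1" using elim by blast
        have "avg (sample_group (ns n) i) (\<lambda>a. bump N c (empirical_rank n W (h n) a))
            \<le> real n / real (ns n i) * ((\<Sum>a=1..n. bump N c (h n a)) / real n)"
          by (rule avg_sample_group_le[OF sum_ns[symmetric] i(1) bump_nonneg n1])
        also have "\<dots> \<le> (2 / l0) * (2 * (4 / (real N + 1)) ^ CARD('d))"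
        proof (rule mult_mono)
          have "real n * (l0 / 2) \<le> real n * (lam i / 2)" using i by (intro mult_left_mono) auto
          also have "\<dots> \<le> real (ns n i)" using elim i by blast
          finally show "real n / real (ns n i) \<le> 2 / l0"
            using l0 ns1[OF i(1)] by (simp add: field_simps)
          show "(\<Sum>a=1..n. bump N c (h n a)) / real n \<le> 2 * (4 / (real N + 1)) ^ CARD('d)"
            using elim c by blast
        qed (use l0 in \<open>auto simp: sum_nonneg bump_nonneg\<close>)
        also have "\<dots> = B / (real N + 1) ^ CARD('d)" by (simp add: B_def power_divide)
        finally show ?thesis .
      qed
      have "\<delta> \<le> rank_energy (ns n) (empirical_rank n W (h n)) j j'"
      proof (rule energy_ge[OF j ns1[OF j(1)] ns1[OF j(2)] sum_ns[symmetric] h_cube bump_le[OF j(1) l0(2)] bump_le[OF j(2) l0(3)]])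
        show "avg (sample_group (ns n) j) (\<lambda>a. if norm (W a) \<le> R then 0 else 1) \<le> \<Delta> / 16"
          using tj R unfolding t_def by linarith
        show "avg (sample_group (ns n) j') (\<lambda>a. if norm (W a) \<le> R then 0 else 1) \<le> \<Delta> / 16"
          using tj' R unfolding t_def by linarith
        show "3 * \<Delta> / 4 \<le> \<bar>avg (sample_group (ns n) j) (\<lambda>a. f (W a)) - avg (sample_group (ns n) j') (\<lambda>a. f (W a))\<bar>"
        proof -
          have "\<Delta> \<le> \<bar>avg (sample_group (ns n) j) (\<lambda>a. f (W a)) - avg (sample_group (ns n) j') (\<lambda>a. f (W a))\<bar>
              + \<bar>avg (sample_group (ns n) j) (\<lambda>a. f (W a)) - (\<integral>x. f x \<partial>\<mu> j)\<bar>
              + \<bar>avg (sample_group (ns n) j') (\<lambda>a. f (W a)) - (\<integral>x. f x \<partial>\<mu> j')\<bar>"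
            unfolding \<Delta>_def by linarith
          then show ?thesis using fj fj' by linarith
        qed
      qed
      also have "\<dots> \<le> rank_stat K (ns n) (empirical_rank n W (h n))"
        unfolding j'_def by (rule rank_stat_ge) (use ns1 j0 in auto)
      also have "\<dots> = RE2 K (ns n) (h n) (\<lambda>j i. X n j i \<omega>)"
        unfolding RE2_eq_rank_stat sum_ns W_def empirical_rank_def[abs_def] ..
      finally have "real n * \<delta> \<le> real n * RE2 K (ns n) (h n) (\<lambda>j i. X n j i \<omega>)"
        by (intro mult_left_mono) auto
      then show "\<omega> \<in> ?S n" using elim(3) \<omega> by simp
    qed
  qed
  show ?thesis
  proof (rule tendsto_sandwich)
    show "\<forall>\<^sub>F n in sequentially. 1 - b n \<le> measure (M n) (?S n)"
      using incl
    proof eventually_elim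
      case (elim n)
      interpret prob_space "M n" using ks[of n] by (simp add: k_sample_def)
      have S: "?S n \<in> events"
        using RE2_measurable[OF ks[of n], of "h n"] by measurable
      have BadE: "Bad n \<in> events" unfolding Bad_def by (intro sets.Un bad_meas f_meas t_meas j)
      have "prob (Bad n) \<le> b n"
        unfolding Bad_def b_def
        by (rule order_trans[OF measure_Un_le]; (intro add_mono measure_Un_le)?; intro sets.Un bad_meas f_meas t_meas j)
      moreover have "prob (space (M n) - Bad n) \<le> prob (?S n)"
        by (rule finite_measure_mono[OF elim S])
      moreover have "prob (space (M n) - Bad n) = 1 - prob (Bad n)" by (rule prob_compl[OF BadE])
      ultimately show "1 - b n \<le> prob (?S n)" by linarith
    qed
    show "\<forall>\<^sub>F n in sequentially. measure (M n) (?S n) \<le> 1"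
      using ks by (intro always_eventually allI prob_space.prob_le_1) (simp add: k_sample_def)
    show "(\<lambda>n. 1 - b n) \<longlonglongrightarrow> 1" using tendsto_diff[OF tendsto_const b0, of 1] by simp
  qed simp
qed

theorem propositionD2:
  fixes K :: nat
    and H :: "nat \<Rightarrow> (real^'d) set"
    and h :: "nat \<Rightarrow> nat \<Rightarrow> real^'d"
  assumes K: "K \<ge> 2"
    and H_cube: "\<And>n. H n \<subseteq> cbox 0 1"
    and H_enum: "\<And>n. bij_betw (h n) {1..n} (H n)"
  shows
    "(\<forall>(ns :: nat \<Rightarrow> nat) n
        (M :: 'a measure) X (\<mu> :: nat \<Rightarrow> (real^'d) measure)
        (M' :: 'b measure) X' (\<mu>' :: nat \<Rightarrow> (real^'d) measure).
        (\<forall>j\<in>{1..K}. ns j \<ge> 1) \<longrightarrow> n = (\<Sum>j=1..K. ns j) \<longrightarrow>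
        k_sample M K ns X \<mu> \<longrightarrow> (\<forall>j\<in>{1..K}. abs_cont_law (\<mu> j)) \<longrightarrow> null_hypothesis K \<mu> \<longrightarrow>
        k_sample M' K ns X' \<mu>' \<longrightarrow> (\<forall>j\<in>{1..K}. abs_cont_law (\<mu>' j)) \<longrightarrow> null_hypothesis K \<mu>' \<longrightarrow>
        (\<lambda>\<omega>. RE2 K ns (h n) (\<lambda>j i. X j i \<omega>)) \<in> borel_measurable M \<and>
        (\<lambda>\<omega>. RE2 K ns (h n) (\<lambda>j i. X' j i \<omega>)) \<in> borel_measurable M' \<and>
        distr M borel (\<lambda>\<omega>. RE2 K ns (h n) (\<lambda>j i. X j i \<omega>)) =
        distr M' borel (\<lambda>\<omega>. RE2 K ns (h n) (\<lambda>j i. X' j i \<omega>)))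
     \<and>
     (\<forall>(ns :: nat \<Rightarrow> nat \<Rightarrow> nat) (lam :: nat \<Rightarrow> real) (\<alpha> :: real) (\<nu> :: (real^'d) measure)
        (\<mu> :: nat \<Rightarrow> (real^'d) measure) (M :: nat \<Rightarrow> 'c measure) X.
        (\<forall>n. (\<Sum>j=1..K. ns n j) = n) \<longrightarrow>
        (\<forall>j\<in>{1..K}. 0 < lam j \<and> lam j < 1 \<and> (\<lambda>n. real (ns n j) / real n) \<longlonglongrightarrow> lam j) \<longrightarrow>
        (\<Sum>j=1..K. lam j) = 1 \<longrightarrow>
        weakly_converges (\<lambda>n. empirical_law (H n)) uniform_cube \<longrightarrow>
        0 < \<alpha> \<longrightarrow> \<alpha> < 1 \<longrightarrow> abs_cont_law \<nu> \<longrightarrow>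
        (\<forall>j\<in>{1..K}. abs_cont_law (\<mu> j)) \<longrightarrow> \<not> null_hypothesis K \<mu> \<longrightarrow>
        (\<forall>n. k_sample (M n) K (ns n) (X n) \<mu>) \<longrightarrow>
        (\<lambda>n. measure (M n)
               {\<omega> \<in> space (M n).
                  real n * RE2 K (ns n) (h n) (\<lambda>j i. X n j i \<omega>)
                    \<ge> critical_value \<nu> \<alpha> K (ns n) (h n)})
          \<longlonglongrightarrow> 1)"
proof (intro conjI allI impI)
  fix ns :: "nat \<Rightarrow> nat" and n and M :: "'a measure" and X and \<mu> :: "nat \<Rightarrow> (real^'d) measure"
    and M' :: "'b measure" and X' and \<mu>' :: "nat \<Rightarrow> (real^'d) measure"
  assume ns: "\<forall>j\<in>{1..K}. ns j \<ge> 1" and n: "n = (\<Sum>j=1..K. ns j)"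
    and ks: "k_sample M K ns X \<mu>" and ac: "\<forall>j\<in>{1..K}. abs_cont_law (\<mu> j)" and null: "null_hypothesis K \<mu>"
    and ks': "k_sample M' K ns X' \<mu>'" and ac': "\<forall>j\<in>{1..K}. abs_cont_law (\<mu>' j)" and null': "null_hypothesis K \<mu>'"
  show "(\<lambda>\<omega>. RE2 K ns (h n) (\<lambda>j i. X j i \<omega>)) \<in> borel_measurable M" by (rule RE2_measurable[OF ks])
  show "(\<lambda>\<omega>. RE2 K ns (h n) (\<lambda>j i. X' j i \<omega>)) \<in> borel_measurable M'" by (rule RE2_measurable[OF ks'])
  have K1: "K \<ge> 1" using K by simp
  have inj: "inj_on (h n) {1..n}" using H_enum[of n] by (simp add: bij_betw_def)
  \<comment> \<open>Both null laws are compared with the law at a uniform permutation, which refers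
    to neither sample.\<close>
  have "distr M borel (\<lambda>\<omega>. RE2 K ns (h n) (\<lambda>j i. X j i \<omega>)) =
      distr (uniform_count_measure (perms n)) borel (\<lambda>\<sigma>. rank_stat K ns (\<lambda>a. h n (\<sigma> a)))"
    by (rule null_law_RE2[OF ks K1 ns[rule_format] ac[rule_format] null n inj])
  also have "\<dots> = distr M' borel (\<lambda>\<omega>. RE2 K ns (h n) (\<lambda>j i. X' j i \<omega>))"
    by (rule null_law_RE2[OF ks' K1 ns[rule_format] ac'[rule_format] null' n inj, symmetric])
  finally show "distr M borel (\<lambda>\<omega>. RE2 K ns (h n) (\<lambda>j i. X j i \<omega>)) =
      distr M' borel (\<lambda>\<omega>. RE2 K ns (h n) (\<lambda>j i. X' j i \<omega>))" .
next
  fix ns :: "nat \<Rightarrow> nat \<Rightarrow> nat" and lam :: "nat \<Rightarrow> real" and \<alpha> :: real and \<nu> :: "(real^'d) measure"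
    and \<mu> :: "nat \<Rightarrow> (real^'d) measure" and M :: "nat \<Rightarrow> 'c measure" and X
  assume sum_ns: "\<forall>n. (\<Sum>j=1..K. ns n j) = n"
    and lam: "\<forall>j\<in>{1..K}. 0 < lam j \<and> lam j < 1 \<and> (\<lambda>n. real (ns n j) / real n) \<longlonglongrightarrow> lam j"
    and weak: "weakly_converges (\<lambda>n. empirical_law (H n)) uniform_cube"
    and \<alpha>: "0 < \<alpha>" "\<alpha> < 1" and \<nu>: "abs_cont_law \<nu>"
    and ac: "\<forall>j\<in>{1..K}. abs_cont_law (\<mu> j)" and alt: "\<not> null_hypothesis K \<mu>"
    and ks: "\<forall>n. k_sample (M n) K (ns n) (X n) \<mu>"
  show "(\<lambda>n. measure (M n) {\<omega> \<in> space (M n). real n * RE2 K (ns n) (h n) (\<lambda>j i. X n j i \<omega>)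
      \<ge> critical_value \<nu> \<alpha> K (ns n) (h n)}) \<longlonglongrightarrow> 1"
    by (rule rank_energy_test_consistent[OF K H_cube H_enum _ _ _ weak \<alpha> \<nu> _ alt])
      (use sum_ns lam ac ks in auto)
qed

end
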